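(* Let $G$ be a hamiltonian graph of order $n\ge 440$ satisfying $e(G)>\left\lfloor \frac{n^2}{4}\right\rfloor+1$. Then, for every integer $\ell$ with $3\le \ell\le n$, $c_\ell(G)\ge n-\ell+2$.
   Context: All graphs are finite and simple. The order of a graph is its number of vertices, and $e(G)$ denotes the number of edges of $G$. A graph is hamiltonian if it contains a Hamilton cycle, i.e. a cycle through every vertex. $c_\ell(G)$ denotes the number of cycles of length $\ell$ in $G$, where cycles are counted as subgraphs (not necessarily induced). *)

theory Defs
  imports Main
begin

text \<open>A graph is a pair consisting of its vertex set and its set of edges, an edge being a
  two-element set of vertices.\<close>

type_synonym 'a ugraph = "'a set \<times> 'a set set"

definition verts :: "'a ugraph \<Rightarrow> 'a set" where
  "verts G = fst G"

definition edges :: "'a ugraph \<Rightarrow> 'a set set" where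
  "edges G = snd G"

definition finite_simple_graph :: "'a ugraph \<Rightarrow> bool" where
  "finite_simple_graph G \<longleftrightarrow>
     finite (verts G) \<and> (\<forall>e\<in>edges G. e \<subseteq> verts G \<and> card e = 2)"

definition order :: "'a ugraph \<Rightarrow> nat" where
  "order G = card (verts G)"

definition num_edges :: "'a ugraph \<Rightarrow> nat" where
  "num_edges G = card (edges G)"

definition subgraph :: "'a ugraph \<Rightarrow> 'a ugraph \<Rightarrow> bool" where
  "subgraph H G \<longleftrightarrow>
     finite_simple_graph H \<and> verts H \<subseteq> verts G \<and> edges H \<subseteq> edges G"

text \<open>The graph with vertices \<open>x\<^sub>0, \<dots>, x\<^sub>l\<^sub>-\<^sub>1\<close> and edges
  \<open>x\<^sub>0x\<^sub>1, x\<^sub>1x\<^sub>2, \<dots>, x\<^sub>l\<^sub>-\<^sub>2x\<^sub>l\<^sub>-\<^sub>1, x\<^sub>l\<^sub>-\<^sub>1x\<^sub>0\<close>.\<close>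

definition closed_list_graph :: "'a list \<Rightarrow> 'a ugraph" where
  "closed_list_graph xs =
     (set xs, {{xs ! i, xs ! (Suc i mod length xs)} | i. i < length xs})"

text \<open>A cycle is itself a graph, not a vertex sequence, so that rotations and reversals of the
  same sequence yield one and the same cycle.\<close>

definition is_cycle :: "nat \<Rightarrow> 'a ugraph \<Rightarrow> bool" where
  "is_cycle l C \<longleftrightarrow>
     (\<exists>xs. 3 \<le> l \<and> length xs = l \<and> distinct xs \<and> C = closed_list_graph xs)"

definition hamiltonian :: "'a ugraph \<Rightarrow> bool" where
  "hamiltonian G \<longleftrightarrow> (\<exists>l C. is_cycle l C \<and> subgraph C G \<and> verts C = verts G)"

definition num_cycles :: "nat \<Rightarrow> 'a ugraph \<Rightarrow> nat" where
  "num_cycles l G = card {C. is_cycle l C \<and> subgraph C G}"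

text \<open>The set counted by \<^const>\<open>num_cycles\<close> is finite, so its \<^const>\<open>card\<close> is the true count.\<close>

lemma finite_cycles:
  assumes "finite_simple_graph G"
  shows "finite {C. is_cycle l C \<and> subgraph C G}"
proof (rule finite_subset)
  show "{C. is_cycle l C \<and> subgraph C G} \<subseteq> Pow (verts G) \<times> Pow (edges G)"
    by (auto simp: subgraph_def verts_def edges_def)
  have "finite (edges G)"
    using assms by (auto simp: finite_simple_graph_def intro: finite_subset[of _ "Pow (verts G)"])
  then show "finite (Pow (verts G) \<times> Pow (edges G))"
    using assms by (simp add: finite_simple_graph_def)
qed

end

theory Submission
  imports Defs Complex_Main
begin

text \<open>Let \<open>c\<close> be the number of cycles of length \<open>l = n - h\<close> and \<open>Q = 4 e(G) - n\<^sup>2\<close>, so that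
  \<open>Q \<ge> 7\<close>. Different ranges of \<open>l\<close> need different arguments.

  Long cycles, \<open>3 h \<le> n - 3\<close>: fix a Hamilton cycle. A chord with \<open>h + 1\<close> edges on one side closes a
  cycle of length \<open>l\<close>, and so do two chords in suitable relative position. Such pairs cover the possible
  chords evenly, and the number of pairs with both chords present minus the number of pairs with both absent
  is governed by \<open>Q\<close>. If \<open>c \<le> h + 1\<close>, then for each \<open>d\<close> with \<open>2 \<le> d \<le> h\<close> the chords of length \<open>d\<close> are
  either all absent or almost all present, according to the parity of \<open>d\<close>, and this propagates
  until a contradiction arises. For \<open>h \<le> 2\<close> the pairs alone suffice. For \<open>h = 0\<close>, a unique Hamilton cycle
  would allow, for every \<open>d\<close>, at most \<open>n / 2\<close> chords of the form \<open>x\<^sub>i x\<^sub>i\<^sub>+\<^sub>d\<close>. Then \<open>n\<close> is even and some odd \<open>d\<close> attains this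
  bound; these chords form a perfect matching, so together with the cycle they form a cubic graph, which has a second
  Hamilton cycle.

  Intermediate lengths, \<open>33 \<le> l\<close> and \<open>3 h \<ge> n - 2\<close>: choose a vertex set \<open>W\<close> with \<open>k > l\<close> elements that
  induces a hamiltonian graph and maximizes \<open>4 e(W) - k\<^sup>2 + 20 k\<close>. Maximality bounds the total amount by which
  degrees in \<open>W\<close> fall below \<open>k / 2\<close>. For a cycle of length \<open>l\<close> in \<open>W\<close>, few cycles of length \<open>l\<close> means
  that cycle vertices at distance two or four have nearly disjoint neighbourhoods off the cycle, so that three of
  them cannot all have degree near \<open>k / 2\<close>.

  Short lengths, \<open>4 \<le> l \<le> 32\<close>: a vertex set \<open>W\<close> maximizing \<open>e(W)\<^sup>5 / |W|\<^sup>8\<close> induces a graph of large minimum degree,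
  in which every short cycle extends to at least \<open>n\<close> cycles with two more vertices.

  Triangles: a graph with \<open>\<lfloor>n\<^sup>2 / 4\<rfloor> + 2\<close> edges has at least \<open>2 \<lfloor>n / 2\<rfloor>\<close> triangles, by induction
  on \<open>n\<close>, deleting a vertex of small degree or an edge \<open>uv\<close> with \<open>deg u + deg v \<le> n\<close>.\<close>

text \<open>\<open>Q\<close> can be 7 for every \<open>n\<close>, so averaging over pairs of chords
  yields only \<open>2 c >= Q\<close>, a constant, while up to \<open>n - 1\<close> cycles are
  wanted. For long cycles the missing factor comes from rigidity: a small \<open>c\<close> forces
  nearly every pair to have exactly one chord present, and the rows then resemble a balanced
  complete bipartite graph, odd lengths present and even ones absent. \<open>Q >= 7\<close> says
  that even chords outnumber absent odd ones, and \<open>h + 1\<close> different shifts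
  \<open>t\<close> turn this excess into about \<open>(h + 1) Q / 4\<close> cycles. The bound
  \<open>3 h + 3 <= n\<close> enters because a row is empty or has size at least
  \<open>n - h + 3\<close>, and the latter must exceed \<open>2 h + 4\<close>. For shorter cycles
  the excess is amplified in an extremal subgraph: the bonus \<open>20 k\<close> keeps the number of
  deleted vertices below \<open>c / 10\<close> at the price of a degree deficit of 21/4, and the
  exponents 5 and 8 trade size against density. The thresholds 33 and 440 meet in
  \<open>mid_numeric\<close>: with cycle length 33 its estimates contradict each other from
  \<open>h = 399\<close> on, and order at least 440 forces longer cycles for smaller
  \<open>h\<close>.\<close>

section \<open>Cycles as vertex lists, and the counting principle\<close>

fun path_edges :: "'a list \<Rightarrow> 'a set set" where
  "path_edges [] = {}"
| "path_edges [a] = {}"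
| "path_edges (a # b # r) = insert {a, b} (path_edges (b # r))"

text \<open>The closing edge is added to a recursive path edge set, so that a cycle assembled from
  arcs and chords can be taken apart with \<open>path_edges_append\<close>.\<close>

definition cycle_edges :: "'a list \<Rightarrow> 'a set set" where
  "cycle_edges xs = insert {last xs, hd xs} (path_edges xs)"

definition cyc :: "'a ugraph \<Rightarrow> 'a list \<Rightarrow> bool" where
  "cyc G xs \<longleftrightarrow> 3 \<le> length xs \<and> distinct xs \<and> cycle_edges xs \<subseteq> edges G"

lemma path_edges_nth: "path_edges xs = {{xs ! i, xs ! Suc i} | i. Suc i < length xs}"
proof (induction xs rule: path_edges.induct)
  case (3 a b r)
  have "{{(a # b # r) ! i, (a # b # r) ! Suc i} |i. Suc i < length (a # b # r)}
     = insert {a, b} {{(b # r) ! i, (b # r) ! Suc i} |i. Suc i < length (b # r)}" (is "?L = ?R")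
  proof
    show "?L \<subseteq> ?R"
    proof
      fix e assume "e \<in> ?L"
      then obtain i where i: "e = {(a # b # r) ! i, (a # b # r) ! Suc i}" "Suc i < length (a # b # r)"
        by blast
      then show "e \<in> ?R" by (cases i) auto
    qed
    show "?R \<subseteq> ?L"
      by (force intro: exI[of _ 0] exI[of _ "Suc _"])
  qed
  with 3 show ?case by simp
qed auto

lemma path_edges_append:
  "xs \<noteq> [] \<Longrightarrow> ys \<noteq> [] \<Longrightarrow>
    path_edges (xs @ ys) = insert {last xs, hd ys} (path_edges xs \<union> path_edges ys)"
proof (induction xs rule: path_edges.induct)
  case (2 a) then show ?case by (cases ys) auto
qed auto

lemma path_edges_rev [simp]: "path_edges (rev xs) = path_edges xs"
proof (induction xs rule: path_edges.induct)
  case (3 a b r)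
  have "path_edges (rev (a # b # r)) = path_edges (rev (b # r) @ [a])" by simp
  also have "\<dots> = insert {b, a} (path_edges (rev (b # r)))"
    by (subst path_edges_append) (auto simp: last_rev)
  finally show ?case using 3 by (simp add: insert_commute)
qed auto

lemma path_edges_subset: "e \<in> path_edges xs \<Longrightarrow> e \<subseteq> set xs"
  by (auto simp: path_edges_nth)

lemma path_edges_int:
  "path_edges (map x [a..b]) = (\<lambda>j. {x j, x (j + 1)}) ` {a..<b :: int}"
proof (cases "a \<le> b")
  case True
  have "path_edges (map x [a..a + int k]) = (\<lambda>j. {x j, x (j + 1)}) ` {a..<a + int k}" for k
  proof (induction k)
    case (Suc k)
    have "[a..a + int (Suc k)] = [a..a + int k] @ [a + int k + 1]"
      using upto_rec2[of a "a + int (Suc k)"] by (simp add: algebra_simps)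
    moreover have "last [a..a + int k] = a + int k"
      by (subst upto_rec2) auto
    moreover have "{a..<a + int (Suc k)} = insert (a + int k) {a..<a + int k}" by auto
    ultimately show ?case using Suc by (simp add: path_edges_append last_map)
  qed simp
  from this[of "nat (b - a)"] True show ?thesis by simp
qed simp

lemma cycle_edges_nth:
  assumes "xs \<noteq> []"
  shows "cycle_edges xs = {{xs ! i, xs ! (Suc i mod length xs)} | i. i < length xs}" (is "_ = ?R")
proof -
  have l: "last xs = xs ! (length xs - 1)" "hd xs = xs ! 0"
    using assms by (auto simp: last_conv_nth hd_conv_nth)
  have "e \<in> ?R" if "e \<in> cycle_edges xs" for e
  proof -
    from that consider "e = {last xs, hd xs}" | "e \<in> path_edges xs"
      by (auto simp: cycle_edges_def)
    then show ?thesis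
    proof cases
      case 1 with l assms show ?thesis by (auto intro!: exI[of _ "length xs - 1"])
    next
      case 2
      then obtain i where "e = {xs ! i, xs ! Suc i}" "Suc i < length xs" by (auto simp: path_edges_nth)
      then show ?thesis by (auto intro!: exI[of _ i])
    qed
  qed
  moreover have "e \<in> cycle_edges xs" if e: "e \<in> ?R" for e
  proof -
    obtain i where i: "e = {xs ! i, xs ! (Suc i mod length xs)}" "i < length xs" using e by blast
    show ?thesis
    proof (cases "Suc i < length xs")
      case True with i show ?thesis by (auto simp: cycle_edges_def path_edges_nth)
    next
      case False
      then have "Suc i = length xs" using i by simp
      then have "i = length xs - 1" "Suc i mod length xs = 0" by auto
      with i l show ?thesis by (auto simp: cycle_edges_def)
    qed
  qed
  ultimately show ?thesis by blast
qed

lemma closed_list_graph_eq: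
  "xs \<noteq> [] \<Longrightarrow> closed_list_graph xs = (set xs, cycle_edges xs)"
  by (simp add: closed_list_graph_def cycle_edges_nth)

lemma cycle_edges_cover:
  assumes "length xs \<ge> 2" "v \<in> set xs"
  shows "\<exists>e\<in>cycle_edges xs. v \<in> e"
proof -
  obtain i where "i < length xs" "v = xs ! i" using assms(2) by (auto simp: in_set_conv_nth)
  moreover have "xs \<noteq> []" using assms by auto
  ultimately show ?thesis by (auto simp: cycle_edges_nth)
qed

lemma edges_finite: "finite_simple_graph G \<Longrightarrow> finite (edges G)"
  by (auto simp: finite_simple_graph_def intro: finite_subset[of _ "Pow (verts G)"])

lemma cyc_set: "finite_simple_graph G \<Longrightarrow> cyc G xs \<Longrightarrow> set xs \<subseteq> verts G"
proof
  fix v assume a: "finite_simple_graph G" "cyc G xs" "v \<in> set xs"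
  then obtain e where "e \<in> cycle_edges xs" "v \<in> e"
    using cycle_edges_cover[of xs v] by (auto simp: cyc_def)
  with a show "v \<in> verts G" unfolding cyc_def finite_simple_graph_def by blast
qed

lemma cyc_is_cycle:
  assumes "finite_simple_graph G" "cyc G xs"
  shows "is_cycle (length xs) (closed_list_graph xs) \<and> subgraph (closed_list_graph xs) G"
proof -
  have ne: "xs \<noteq> []" using assms by (auto simp: cyc_def)
  have "e \<subseteq> set xs" if "e \<in> cycle_edges xs" for e
    using that path_edges_subset[of e xs] ne by (auto simp: cycle_edges_def)
  moreover have "card e = 2" if "e \<in> cycle_edges xs" for e
    using that assms by (auto simp: cyc_def finite_simple_graph_def)
  ultimately have "subgraph (closed_list_graph xs) G"
    using assms(2) cyc_set[OF assms]
    by (simp add: subgraph_def closed_list_graph_eq[OF ne] verts_def edges_def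
        finite_simple_graph_def cyc_def)
  moreover have "is_cycle (length xs) (closed_list_graph xs)"
    unfolding is_cycle_def using assms(2) by (intro exI[of _ xs]) (simp add: cyc_def)
  ultimately show ?thesis by simp
qed

text \<open>Different edge sets belong to different cycles, so all lower bounds below reduce to
  building lists and proving \<open>cycle_edges\<close> injective on their parameters; no canonical
  list of a cycle has to be chosen.\<close>

lemma num_cycles_ge:
  assumes "finite_simple_graph G"
    and "\<And>i. i \<in> I \<Longrightarrow> cyc G (F i) \<and> length (F i) = l"
    and "inj_on (\<lambda>i. cycle_edges (F i)) I"
  shows "card I \<le> num_cycles l G"
proof -
  have *: "closed_list_graph (F i) = (set (F i), cycle_edges (F i))" if "i \<in> I" for i
    using assms(2)[OF that] by (intro closed_list_graph_eq) (auto simp: cyc_def)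
  have "inj_on (\<lambda>i. closed_list_graph (F i)) I"
    using assms(3) by (auto simp: inj_on_def *)
  then show ?thesis unfolding num_cycles_def
  proof (rule card_inj_on_le)
    show "(\<lambda>i. closed_list_graph (F i)) ` I \<subseteq> {C. is_cycle l C \<and> subgraph C G}"
    proof (rule image_subsetI)
      fix i assume "i \<in> I"
      then have "cyc G (F i)" "length (F i) = l" using assms(2) by auto
      with cyc_is_cycle[OF assms(1), of "F i"]
      show "closed_list_graph (F i) \<in> {C. is_cycle l C \<and> subgraph C G}" by simp
    qed
  qed (rule finite_cycles[OF assms(1)])
qed

lemma num_cycles_obtain:
  assumes "num_cycles l G > 0"
  obtains xs where "cyc G xs" "length xs = l"
proof -
  have "{C. is_cycle l C \<and> subgraph C G} \<noteq> {}"
    using assms unfolding num_cycles_def by (metis card.empty less_irrefl)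
  then obtain C where "is_cycle l C" "subgraph C G" by blast
  then obtain xs where "3 \<le> l" "length xs = l" "distinct xs" "C = closed_list_graph xs"
    by (auto simp: is_cycle_def)
  moreover have "xs \<noteq> []" using calculation by auto
  ultimately show ?thesis using \<open>subgraph C G\<close> that[of xs]
    by (auto simp: cyc_def subgraph_def closed_list_graph_eq edges_def)
qed

lemma hamiltonian_obtain:
  assumes "hamiltonian G"
  obtains xs where "cyc G xs" "set xs = verts G"
proof -
  obtain l C where C: "is_cycle l C" "subgraph C G" "verts C = verts G"
    using assms by (auto simp: hamiltonian_def)
  then obtain xs where "3 \<le> l" "length xs = l" "distinct xs" "C = closed_list_graph xs"
    by (auto simp: is_cycle_def)
  moreover have "xs \<noteq> []" using calculation by auto
  ultimately show ?thesis using C that[of xs]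
    by (auto simp: cyc_def subgraph_def closed_list_graph_eq edges_def verts_def)
qed

lemma cyc_hamiltonian:
  assumes "finite_simple_graph G" "cyc G xs" "set xs = verts G"
  shows "hamiltonian G"
proof -
  have "xs \<noteq> []" using assms by (auto simp: cyc_def)
  then show ?thesis unfolding hamiltonian_def
    using cyc_is_cycle[OF assms(1,2)] assms(3) by (auto simp: closed_list_graph_eq verts_def)
qed

lemma cycle_edges_nbr:
  assumes "distinct ys" "Suc j < length ys" "0 < j" "{ys ! j, b} \<in> cycle_edges ys"
  shows "b = ys ! Suc j \<or> b = ys ! (j - 1)"
proof -
  have "ys \<noteq> []" using assms by auto
  then obtain i where i: "{ys ! j, b} = {ys ! i, ys ! (Suc i mod length ys)}" "i < length ys"
    using assms(4) by (auto simp: cycle_edges_nth)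
  consider "ys ! j = ys ! i" "b = ys ! (Suc i mod length ys)"
    | "ys ! j = ys ! (Suc i mod length ys)" "b = ys ! i"
    using i(1) by (auto simp: doubleton_eq_iff)
  then show ?thesis
  proof cases
    case 1
    then have "i = j" using assms i nth_eq_iff_index_eq[of ys j i] by auto
    with 1 assms show ?thesis by simp
  next
    case 2
    have "Suc i mod length ys < length ys" using assms by (intro mod_less_divisor) auto
    then have j: "j = Suc i mod length ys"
      using assms 2 nth_eq_iff_index_eq[of ys j "Suc i mod length ys"] by auto
    have "j = Suc i"
    proof (cases "Suc i < length ys")
      case False
      then have "Suc i = length ys" using i by simp
      then show ?thesis using j assms(3) by simp
    qed (use j in simp)
    with 2 show ?thesis by simp
  qed
qed

text \<open>Two consecutive vertices fix starting point and direction; from there every next vertex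
  is the only neighbour on the cycle that has not just been visited.\<close>

lemma cycle_edges_unique:
  assumes "distinct xs" "distinct ys" "length xs = length ys" "length xs \<ge> 2"
    and "xs ! 0 = ys ! 0" "xs ! 1 = ys ! 1" "cycle_edges xs = cycle_edges ys"
  shows "xs = ys"
proof (rule nth_equalityI)
  fix k assume "k < length xs"
  then show "xs ! k = ys ! k"
  proof (induction k rule: less_induct)
    case (less k)
    consider "k = 0" | "k = 1" | j where "k = Suc (Suc j)"
      by (metis One_nat_def not0_implies_Suc)
    then show ?case
    proof cases
      case 3
      have "{xs ! Suc j, xs ! k} \<in> cycle_edges xs"
        using 3 less.prems by (auto simp: cycle_edges_def path_edges_nth)
      then have "{ys ! Suc j, xs ! k} \<in> cycle_edges ys"
        using less.IH[of "Suc j"] 3 less.prems assms(7) by auto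
      then have "xs ! k = ys ! k \<or> xs ! k = ys ! j"
        using cycle_edges_nbr[OF assms(2), of "Suc j"] 3 less.prems assms(3) by auto
      moreover have "xs ! k \<noteq> xs ! j" using 3 less.prems assms(1) by (auto simp: nth_eq_iff_index_eq)
      ultimately show ?thesis using less.IH[of j] 3 less.prems by auto
    qed (use assms in auto)
  qed
qed (use assms in auto)

lemma num_cycles_mono:
  assumes "finite_simple_graph G" "subgraph H G"
  shows "num_cycles l H \<le> num_cycles l G"
  unfolding num_cycles_def
  by (rule card_mono[OF finite_cycles[OF assms(1)]]) (use assms(2) in \<open>auto simp: subgraph_def\<close>)

subsection \<open>Adjacency, degrees and induced subgraphs\<close>

definition adj :: "'a ugraph \<Rightarrow> 'a \<Rightarrow> 'a \<Rightarrow> bool" where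
  "adj G u v \<longleftrightarrow> {u, v} \<in> edges G"

definition nbrs :: "'a ugraph \<Rightarrow> 'a \<Rightarrow> 'a set" where
  "nbrs G v = {u. adj G v u}"

definition deg :: "'a ugraph \<Rightarrow> 'a \<Rightarrow> nat" where
  "deg G v = card (nbrs G v)"

definition induced :: "'a ugraph \<Rightarrow> 'a set \<Rightarrow> 'a ugraph" where
  "induced G W = (W, {e \<in> edges G. e \<subseteq> W})"

lemma adj_sym: "adj G u v \<longleftrightarrow> adj G v u"
  by (simp add: adj_def insert_commute)

lemma adj_verts: "finite_simple_graph G \<Longrightarrow> adj G u v \<Longrightarrow> u \<in> verts G \<and> v \<in> verts G"
  by (auto simp: finite_simple_graph_def adj_def)

lemma adj_irrefl: "finite_simple_graph G \<Longrightarrow> \<not> adj G u u"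
  by (force simp: finite_simple_graph_def adj_def)

lemma nbrs_subset: "finite_simple_graph G \<Longrightarrow> nbrs G v \<subseteq> verts G"
  by (auto simp: nbrs_def dest: adj_verts)

lemma verts_finite: "finite_simple_graph G \<Longrightarrow> finite (verts G)"
  by (simp add: finite_simple_graph_def)

lemma nbrs_finite: "finite_simple_graph G \<Longrightarrow> finite (nbrs G v)"
  using nbrs_subset verts_finite finite_subset by metis

lemma induced_simple:
  "finite_simple_graph G \<Longrightarrow> W \<subseteq> verts G \<Longrightarrow> finite_simple_graph (induced G W)"
  by (auto simp: finite_simple_graph_def induced_def verts_def edges_def dest: finite_subset)

lemma induced_subgraph:
  "finite_simple_graph G \<Longrightarrow> W \<subseteq> verts G \<Longrightarrow> subgraph (induced G W) G"
  using induced_simple[of G W] by (auto simp: subgraph_def induced_def verts_def edges_def)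

lemma verts_induced [simp]: "verts (induced G W) = W"
  by (simp add: induced_def verts_def)

lemma edges_induced: "edges (induced G W) = {e \<in> edges G. e \<subseteq> W}"
  by (simp add: induced_def edges_def)

lemma adj_induced: "adj (induced G W) u v \<longleftrightarrow> adj G u v \<and> u \<in> W \<and> v \<in> W"
  by (auto simp: adj_def edges_induced)

lemma deg_card_edges:
  assumes "finite_simple_graph G"
  shows "deg G v = card {e \<in> edges G. v \<in> e}"
proof -
  have "bij_betw (\<lambda>u. {v, u}) (nbrs G v) {e \<in> edges G. v \<in> e}"
  proof (rule bij_betw_imageI)
    show "inj_on (\<lambda>u. {v, u}) (nbrs G v)" by (auto simp: inj_on_def doubleton_eq_iff)
    have "e \<in> (\<lambda>u. {v, u}) ` nbrs G v" if e: "e \<in> edges G" "v \<in> e" for e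
    proof -
      have "card e = 2" using e assms by (auto simp: finite_simple_graph_def)
      then obtain a b where "e = {a, b}" by (auto simp: card_2_iff)
      with e show ?thesis by (auto simp: nbrs_def adj_def insert_commute)
    qed
    then show "(\<lambda>u. {v, u}) ` nbrs G v = {e \<in> edges G. v \<in> e}"
      by (auto simp: nbrs_def adj_def)
  qed
  then show ?thesis by (simp add: deg_def bij_betw_same_card)
qed

lemma handshake:
  assumes "finite_simple_graph G"
  shows "(\<Sum>v\<in>verts G. deg G v) = 2 * num_edges G"
proof -
  have fE: "finite (edges G)" using assms by (rule edges_finite)
  have fV: "finite (verts G)" using assms by (rule verts_finite)
  have c2: "card e = 2" "e \<subseteq> verts G" if "e \<in> edges G" for e
    using assms that by (auto simp: finite_simple_graph_def)
  have "(\<Sum>v\<in>verts G. deg G v) = (\<Sum>v\<in>verts G. \<Sum>e\<in>edges G. if v \<in> e then 1 else 0)"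
    by (simp add: deg_card_edges[OF assms] fE flip: sum.inter_filter)
  also have "\<dots> = (\<Sum>e\<in>edges G. \<Sum>v\<in>verts G. if v \<in> e then 1 else 0)"
    by (rule sum.swap)
  also have "\<dots> = (\<Sum>e\<in>edges G. card e)"
  proof (rule sum.cong[OF refl])
    fix e assume "e \<in> edges G"
    then have "{v \<in> verts G. v \<in> e} = e" using c2 by auto
    then show "(\<Sum>v\<in>verts G. if v \<in> e then 1 else 0) = card e"
      using fV by (simp flip: sum.inter_filter)
  qed
  also have "\<dots> = 2 * num_edges G" by (simp add: c2 num_edges_def)
  finally show ?thesis .
qed

subsection \<open>Cyclic sequences and detours\<close>

text \<open>Indexing by all integers with period \<open>n\<close> turns rotations into translations
  and keeps \<open>mod\<close> out of the constructions; positions less than \<open>n\<close> apart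
  are compared by \<open>x_near\<close>.\<close>

locale cyclic =
  fixes x :: "int \<Rightarrow> 'a" and n :: int
  assumes n3: "3 \<le> n" and periodic: "x (i + n) = x i" and inj: "inj_on x {0..<n}"
begin

lemma x_add_mult: "x (i + k * n) = x i"
proof (induction k rule: int_induct[where k = 0])
  case (step1 k) then show ?case using periodic[of "i + k * n"] by (simp add: algebra_simps)
next
  case (step2 k) then show ?case using periodic[of "i + (k - 1) * n"] by (simp add: algebra_simps)
qed simp

lemma x_mod: "x (i mod n) = x i"
  using x_add_mult[of "i mod n" "i div n"] by (simp add: add.commute mult.commute)

lemma x_eq_iff: "x i = x j \<longleftrightarrow> i mod n = j mod n"
proof
  assume "x i = x j"
  then have "x (i mod n) = x (j mod n)" by (simp add: x_mod)
  then show "i mod n = j mod n"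
    using inj n3 by (auto simp: inj_on_def)
qed (metis x_mod)

lemma x_near: "\<bar>i - j\<bar> < n \<Longrightarrow> x i = x j \<longleftrightarrow> i = j"
  unfolding x_eq_iff mod_eq_dvd_iff
  by (metis abs_0_eq abs_ge_zero dvd_0_right eq_iff_diff_eq_0 zdvd_not_zless dvd_abs_iff
      less_le)

lemma x_shift: "x i = x j \<Longrightarrow> x (i + k) = x (j + k)"
  unfolding x_eq_iff by (rule mod_add_cong) simp_all

lemma inj_window: "inj_on x {a..<a + n}"
  using x_near by (auto simp: inj_on_def)

lemma window: "\<exists>j\<in>{a..<a + n}. x i = x j"
proof
  show "a + (i - a) mod n \<in> {a..<a + n}" using n3 by simp
  show "x i = x (a + (i - a) mod n)"
    by (simp add: x_eq_iff mod_add_right_eq)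
qed

lemma range_window: "range x = x ` {a..<a + n}"
  using window[of a] by blast

lemma card_range: "card (range x) = nat n"
  using range_window[of 0] card_image[OF inj_window[of 0]] by simp

lemma finite_range: "finite (range x)"
  using range_window[of 0] by simp

lemma distinct_map_x:
  "distinct js \<Longrightarrow> set js \<subseteq> {a..<a + n} \<Longrightarrow> distinct (map x js)"
  using inj_window[of a] by (simp add: distinct_map inj_on_subset)

lemma card_shift:
  assumes "\<And>i. P (i + n) \<longleftrightarrow> P i"
  shows "card {p \<in> {0..<n}. P (p + k)} = card {p \<in> {0..<n}. P p}"
proof -
  have P: "P (i mod n) \<longleftrightarrow> P i" for i
  proof -
    have "P (j + k * n) \<longleftrightarrow> P j" for j k
    proof (induction k rule: int_induct[where k = 0])
      case (step1 k) then show ?case using assms[of "j + k * n"] by (simp add: algebra_simps)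
    next
      case (step2 k) then show ?case using assms[of "j + (k - 1) * n"] by (simp add: algebra_simps)
    qed simp
    from this[of "i mod n" "i div n"] show ?thesis by (simp add: add.commute mult.commute)
  qed
  have "bij_betw (\<lambda>p. (p + k) mod n) {p \<in> {0..<n}. P (p + k)} {p \<in> {0..<n}. P p}"
  proof (rule bij_betw_byWitness[where f' = "\<lambda>p. (p - k) mod n"])
    show "\<forall>a\<in>{p \<in> {0..<n}. P (p + k)}. ((a + k) mod n - k) mod n = a"
      by (auto simp: mod_diff_left_eq)
    show "\<forall>a\<in>{p \<in> {0..<n}. P p}. ((a - k) mod n + k) mod n = a"
      by (auto simp: mod_add_left_eq)
    show "(\<lambda>p. (p + k) mod n) ` {p \<in> {0..<n}. P (p + k)} \<subseteq> {p \<in> {0..<n}. P p}"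
      using n3 by (auto simp: P)
    have "P ((p - k) mod n + k) \<longleftrightarrow> P p" for p
      by (metis P diff_add_cancel mod_add_left_eq)
    then show "(\<lambda>p. (p - k) mod n) ` {p \<in> {0..<n}. P p} \<subseteq> {p \<in> {0..<n}. P (p + k)}"
      using n3 by auto
  qed
  then show ?thesis by (rule bij_betw_same_card)
qed

text \<open>A chord can be read from either end, and the two lengths so obtained add up to
  \<open>n\<close>. All later injectivity proofs have to exclude the reversed reading.\<close>

lemma chord_eq:
  assumes "{x a, x (a + d)} = {x b, x (b + d')}" "0 < d" "d < n" "0 < d'" "d' < n"
  shows "(x a = x b \<and> d = d') \<or> (x a = x (b + d') \<and> d + d' = n)"
proof -
  consider "x a = x b" "x (a + d) = x (b + d')" | "x a = x (b + d')" "x (a + d) = x b"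
    using assms(1) by (auto simp: doubleton_eq_iff)
  then show ?thesis
  proof cases
    case 1
    then have "x (b + d) = x (b + d')" using x_shift[of a b d] by simp
    then show ?thesis using 1 x_near[of "b + d" "b + d'"] assms by auto
  next
    case 2
    then have "x (b + (d + d')) = x (b + n)"
      using x_shift[of a "b + d'" d] periodic[of b] by (simp add: algebra_simps)
    then show ?thesis using 2 x_near[of "b + (d + d')" "b + n"] assms by auto
  qed
qed

end

text \<open>The cycle need not span the graph: the vertices off it supply detours in the ranges of
  short and intermediate lengths. The locale \<open>ham\<close> adds that it spans.\<close>

locale gcyc = cyclic x n for x :: "int \<Rightarrow> 'a" and n +
  fixes G :: "'a ugraph"
  assumes simple: "finite_simple_graph G" and ham_edge: "{x i, x (i + 1)} \<in> edges G"

lemma list_gcyc: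
  assumes "finite_simple_graph G" "cyc G xs"
  defines "x \<equiv> \<lambda>i. xs ! nat (i mod int (length xs))"
  shows "gcyc x (int (length xs)) G" and "range x = set xs"
    and "cycle_edges xs = range (\<lambda>i. {x i, x (i + 1)})"
proof -
  let ?n = "int (length xs)"
  have n: "3 \<le> length xs" "distinct xs" "cycle_edges xs \<subseteq> edges G"
    using assms(2) by (auto simp: cyc_def)
  have ne: "xs \<noteq> []" using n by auto
  have lt: "nat (i mod ?n) < length xs" for i
  proof -
    have "0 \<le> i mod ?n" "i mod ?n < ?n" using ne by auto
    then show ?thesis by linarith
  qed
  have r: "\<exists>i. j = nat (i mod ?n)" if "j < length xs" for j
    using that by (intro exI[of _ "int j"]) simp
  show "range x = set xs"
    using lt r by (force simp: x_def in_set_conv_nth)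
  have suc: "nat ((i + 1) mod ?n) = Suc (nat (i mod ?n)) mod length xs" for i
  proof -
    have "(i + 1) mod ?n = (i mod ?n + 1) mod ?n" by (simp add: mod_add_left_eq)
    also have "i mod ?n + 1 = int (Suc (nat (i mod ?n)))" using ne by simp
    also have "int (Suc (nat (i mod ?n))) mod ?n = int (Suc (nat (i mod ?n)) mod length xs)"
      by (simp only: zmod_int)
    finally show ?thesis by (simp only: nat_int)
  qed
  show ce: "cycle_edges xs = range (\<lambda>i. {x i, x (i + 1)})"
    unfolding cycle_edges_nth[OF ne] x_def suc using lt r by blast
  show "gcyc x ?n G"
  proof
    show "inj_on x {0..<?n}"
      using n by (auto simp: inj_on_def x_def nth_eq_iff_index_eq)
    show "{x i, x (i + 1)} \<in> edges G" for i using ce n(3) by auto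
  qed (use n assms(1) in \<open>auto simp: x_def\<close>)
qed

context gcyc
begin

lemma x_verts: "x i \<in> verts G"
  using ham_edge[of i] simple by (auto simp: finite_simple_graph_def)

lemma hm_adj: "adj G (x i) (x (i + 1))"
  using ham_edge by (simp add: adj_def)

text \<open>Replacing the inner vertices of the arc from \<open>x i\<close> to \<open>x (i + m)\<close> by \<open>ws\<close>.\<close>

definition ins :: "int \<Rightarrow> int \<Rightarrow> 'a list \<Rightarrow> 'a list" where
  "ins i m ws = map x [i + m..i + n] @ ws"

definition detour :: "int \<Rightarrow> int \<Rightarrow> 'a list \<Rightarrow> bool" where
  "detour i m ws \<longleftrightarrow> ws \<noteq> [] \<and> distinct ws \<and> set ws \<inter> range x = {} \<and>
     path_edges (x i # ws @ [x (i + m)]) \<subseteq> edges G"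

lemma ins_cyc:
  assumes "detour i m ws" "1 \<le> m" "m \<le> n - 1"
  shows "cyc G (ins i m ws)" "int (length (ins i m ws)) = n - m + 1 + int (length ws)"
proof -
  have ws: "ws \<noteq> []" "distinct ws" "set ws \<inter> range x = {}"
    "path_edges (x i # ws @ [x (i + m)]) \<subseteq> edges G"
    using assms(1) by (auto simp: detour_def)
  have ne: "map x [i + m..i + n] \<noteq> []" using assms by simp
  have l: "last (map x [i + m..i + n]) = x i"
    using assms by (subst upto_rec2) (auto simp: periodic)
  have hd: "hd (map x [i + m..i + n]) = x (i + m)"
    using assms by (simp add: upto.simps)
  have "path_edges (x i # ws @ [x (i + m)]) =
      insert {x i, hd ws} (insert {last ws, x (i + m)} (path_edges ws))"
  proof -
    have "path_edges ([x i] @ (ws @ [x (i + m)])) = insert {x i, hd ws} (path_edges (ws @ [x (i + m)]))"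
      using ws(1) by (subst path_edges_append) auto
    then show ?thesis using ws(1) by (simp add: path_edges_append)
  qed
  moreover have "path_edges (map x [i + m..i + n]) \<subseteq> edges G"
    using ham_edge by (auto simp: path_edges_int)
  ultimately have "cycle_edges (ins i m ws) \<subseteq> edges G"
    using ws(4) l hd ne ws(1) unfolding cycle_edges_def ins_def by (simp add: path_edges_append)
  moreover have "distinct (map x [i + m..i + n])"
    using assms by (intro distinct_map_x[of _ "i + m"]) auto
  then have "distinct (ins i m ws)"
    using ws unfolding ins_def by auto
  moreover have len: "int (length (ins i m ws)) = n - m + 1 + int (length ws)"
    using assms by (simp add: ins_def)
  moreover have "3 \<le> length (ins i m ws)"
    using len assms ws(1) by (cases ws) auto
  ultimately show "cyc G (ins i m ws)" using assms by (simp add: cyc_def)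
  show "int (length (ins i m ws)) = n - m + 1 + int (length ws)" by (rule len)
qed

text \<open>As \<open>m <= n - 1\<close>, the retained arc has at least two vertices, and these
  anchor \<open>cycle_edges_unique\<close>.\<close>

lemma ins_inj:
  assumes "detour i m ws" "detour i m ws'" "length ws = length ws'" "1 \<le> m" "m \<le> n - 1"
    and "cycle_edges (ins i m ws) = cycle_edges (ins i m ws')"
  shows "ws = ws'"
proof -
  have e: "[i + m..i + n] = (i + m) # (i + m + 1) # [i + m + 2..i + n]"
    using assms(4,5) upto_rec1[of "i + m" "i + n"] upto_rec1[of "i + m + 1" "i + n"]
    by (simp add: add.assoc)
  have "ins i m ws = ins i m ws'"
  proof (rule cycle_edges_unique)
    show "distinct (ins i m ws)" "distinct (ins i m ws')" "2 \<le> length (ins i m ws)"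
      using ins_cyc[OF assms(1,4,5)] ins_cyc[OF assms(2,4,5)] by (auto simp: cyc_def)
  qed (use assms in \<open>auto simp: ins_def e\<close>)
  then show ?thesis by (simp add: ins_def)
qed

lemma card_detours:
  assumes "\<And>ws. ws \<in> A \<Longrightarrow> detour i m ws \<and> length ws = w" "1 \<le> m" "m \<le> n - 1"
  shows "card A \<le> num_cycles (nat (n - m + 1) + w) G"
proof (rule num_cycles_ge[OF simple, where F = "ins i m"])
  fix ws assume "ws \<in> A"
  then show "cyc G (ins i m ws) \<and> length (ins i m ws) = nat (n - m + 1) + w"
    using ins_cyc[of i m ws] assms by (auto simp: ins_def)
next
  show "inj_on (\<lambda>ws. cycle_edges (ins i m ws)) A"
    using ins_inj assms by (force simp: inj_on_def)
qed

text \<open>Three ways to close a cycle of length \<open>n - h\<close> from arcs of the given cycle: with one chord,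
  with two crossing chords and with two parallel chords.\<close>

definition one :: "int \<Rightarrow> int \<Rightarrow> 'a list" where
  "one h p = map x [p + h + 1..p + n]"

text \<open>The omitted gaps have \<open>t - 1\<close> vertices after \<open>x p\<close> and
  \<open>h + 1 - t\<close> vertices after \<open>x (p + d)\<close>, together \<open>h\<close>. The
  second arc is traversed backwards, and the second chord has length
  \<open>d + h + 2 - 2 t\<close>.\<close>

definition cross :: "int \<Rightarrow> int \<Rightarrow> int \<Rightarrow> int \<Rightarrow> 'a list" where
  "cross h p d t = map x [p + t..p + d] @ rev (map x [p + d + h + 2 - t..p + n])"

text \<open>The chords cut off \<open>d - 1\<close> and \<open>h + 1 - d\<close> vertices, together
  \<open>h\<close>; \<open>g\<close> is the number of cycle edges between the two cut-off
  arcs.\<close>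

definition par :: "int \<Rightarrow> int \<Rightarrow> int \<Rightarrow> int \<Rightarrow> 'a list" where
  "par h p d g = map x [p + d..p + d + g] @ map x [p + h + 2 + g..p + n]"

abbreviation hm :: "int \<Rightarrow> 'a set" where "hm j \<equiv> {x j, x (j + 1)}"

abbreviation ch :: "int \<Rightarrow> int \<Rightarrow> bool" where "ch p d \<equiv> adj G (x p) (x (p + d))"

lemma hd_upto: "a \<le> b \<Longrightarrow> hd (map x [a..b]) = x a"
  by (simp add: upto.simps)

lemma last_upto: "a \<le> b \<Longrightarrow> last (map x [a..b]) = x b"
  by (simp add: upto_rec2)

lemma one_edges:
  assumes "0 \<le> h" "h + 3 \<le> n"
  shows "cycle_edges (one h p) = insert {x p, x (p + h + 1)} (hm ` {p + h + 1..<p + n})"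
  using assms unfolding cycle_edges_def one_def
  by (simp add: path_edges_int hd_upto last_upto periodic del: upto.simps)

lemma cross_edges:
  assumes "1 \<le> t" "t \<le> h + 1" "t < d" "d + h + 2 - t < n"
  shows "cycle_edges (cross h p d t) =
    {{x p, x (p + d)}, {x (p + t), x (p + d + h + 2 - t)}} \<union>
    hm ` ({p + t..<p + d} \<union> {p + d + h + 2 - t..<p + n})"
  using assms unfolding cycle_edges_def cross_def
  by (subst path_edges_append)
    (auto simp add: path_edges_int hd_upto last_upto hd_rev last_rev periodic insert_commute)

lemma par_edges:
  assumes "2 \<le> d" "d \<le> h" "0 \<le> g" "g + h + 2 \<le> n"
  shows "cycle_edges (par h p d g) =
    {{x p, x (p + d)}, {x (p + d + g), x (p + h + 2 + g)}} \<union>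
    hm ` ({p + d..<p + d + g} \<union> {p + h + 2 + g..<p + n})"
  using assms unfolding cycle_edges_def par_def
  by (subst path_edges_append)
    (auto simp add: path_edges_int hd_upto last_upto periodic insert_commute)

lemma one_cyc:
  assumes "0 \<le> h" "h + 3 \<le> n" "ch p (h + 1)"
  shows "cyc G (one h p) \<and> length (one h p) = nat (n - h)"
proof -
  have "distinct (one h p)"
    unfolding one_def using assms by (intro distinct_map_x[of _ "p + 1"]) auto
  moreover have "cycle_edges (one h p) \<subseteq> edges G"
    using assms ham_edge unfolding one_edges[OF assms(1,2)] by (auto simp: adj_def add.assoc)
  moreover have "length (one h p) = nat (n - h)"
    using assms by (simp add: one_def)
  ultimately show ?thesis using assms by (simp add: cyc_def)
qed

lemma cross_cyc:
  assumes "0 \<le> h" "h + 3 \<le> n" "1 \<le> t" "t \<le> h + 1" "t < d" "d + h + 2 - t < n"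
    and "ch p d" "ch (p + t) (d + h + 2 - 2 * t)"
  shows "cyc G (cross h p d t) \<and> length (cross h p d t) = nat (n - h)"
proof -
  have e: "p + t + (d + h + 2 - 2 * t) = p + d + h + 2 - t" by simp
  have "cross h p d t = map x ([p + t..p + d] @ rev [p + d + h + 2 - t..p + n])"
    by (simp add: cross_def rev_map)
  moreover have "distinct (map x ([p + t..p + d] @ rev [p + d + h + 2 - t..p + n]))"
    using assms by (intro distinct_map_x[of _ "p + 1"]) auto
  ultimately have "distinct (cross h p d t)" by simp
  moreover have "cycle_edges (cross h p d t) \<subseteq> edges G"
    using assms ham_edge unfolding cross_edges[OF assms(3-6)] adj_def e by auto
  moreover have "length (cross h p d t) = nat (n - h)"
    using assms by (simp add: cross_def)
  ultimately show ?thesis using assms by (simp add: cyc_def)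
qed

lemma par_cyc:
  assumes "h + 3 \<le> n" "2 \<le> d" "d \<le> h" "0 \<le> g" "g + h + 2 \<le> n"
    and "ch p d" "ch (p + d + g) (h + 2 - d)"
  shows "cyc G (par h p d g) \<and> length (par h p d g) = nat (n - h)"
proof -
  have e: "p + d + g + (h + 2 - d) = p + h + 2 + g" by simp
  have "par h p d g = map x ([p + d..p + d + g] @ [p + h + 2 + g..p + n])"
    by (simp add: par_def)
  moreover have "distinct (map x ([p + d..p + d + g] @ [p + h + 2 + g..p + n]))"
    using assms by (intro distinct_map_x[of _ "p + 1"]) auto
  ultimately have "distinct (par h p d g)" by simp
  moreover have "cycle_edges (par h p d g) \<subseteq> edges G"
    using assms ham_edge unfolding par_edges[OF assms(2-5)] adj_def e by auto
  moreover have "length (par h p d g) = nat (n - h)"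
    using assms by (simp add: par_def)
  ultimately show ?thesis using assms by (simp add: cyc_def)
qed

text \<open>Starting positions are counted, so each chord appears once from each end, in
  \<open>row d\<close> and in \<open>row (n - d)\<close>. Hence the rows add up to a degree
  sum.\<close>

definition row :: "int \<Rightarrow> int" where
  "row d = int (card {p \<in> {0..<n}. ch p d})"

lemma ch_periodic: "ch (i + n) d \<longleftrightarrow> ch i d"
  using periodic[of i] periodic[of "i + d"] by (simp add: algebra_simps)

lemma row_shift: "int (card {p \<in> {0..<n}. ch (p + k) d}) = row d"
  unfolding row_def using card_shift[of "\<lambda>p. ch p d" k] ch_periodic by simp

lemma ch_sym: "ch (p + d) (n - d) \<longleftrightarrow> ch p d"
  using periodic[of p] by (simp add: adj_sym algebra_simps)

lemma row_sym: "row (n - d) = row d"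
  using row_shift[of d "n - d"] unfolding row_def ch_sym by simp

lemma row_1: "row 1 = n"
  using n3 hm_adj unfolding row_def by (simp del: atLeastLessThan_iff)

lemma row_nonneg: "0 \<le> row d"
  by (simp add: row_def)

lemma row_le: "row d \<le> n"
proof -
  have "card {p \<in> {0..<n}. ch p d} \<le> card {0..<n}" by (rule card_mono) auto
  then show ?thesis using n3 unfolding row_def by simp
qed

lemma deg_ge: "int (card {d \<in> {1..<n}. ch i d}) = int (card (nbrs G (x i) \<inter> range x))"
proof -
  have "bij_betw (\<lambda>d. x (i + d)) {d \<in> {1..<n}. ch i d} (nbrs G (x i) \<inter> range x)"
  proof (rule bij_betw_imageI)
    show "inj_on (\<lambda>d. x (i + d)) {d \<in> {1..<n}. ch i d}"
      using x_near by (auto simp: inj_on_def)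
    have "v \<in> (\<lambda>d. x (i + d)) ` {d \<in> {1..<n}. ch i d}" if v: "v \<in> nbrs G (x i) \<inter> range x" for v
    proof -
      obtain j where j: "j \<in> {i..<i + n}" "v = x j" using v window[of i] by (metis IntE imageE)
      moreover have "j \<noteq> i" using v j adj_irrefl[OF simple] by (auto simp: nbrs_def)
      ultimately show ?thesis using v by (auto simp: nbrs_def intro!: image_eqI[of _ _ "j - i"])
    qed
    then show "(\<lambda>d. x (i + d)) ` {d \<in> {1..<n}. ch i d} = nbrs G (x i) \<inter> range x"
      by (auto simp: nbrs_def)
  qed
  then show ?thesis by (simp add: bij_betw_same_card)
qed

lemma sum_row: "(\<Sum>d\<in>{1..<n}. row d) = (\<Sum>v\<in>range x. int (card (nbrs G v \<inter> range x)))"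
proof -
  have "(\<Sum>d\<in>{1..<n}. row d) = (\<Sum>d\<in>{1..<n}. \<Sum>p\<in>{0..<n}. if ch p d then 1 else 0)"
    unfolding row_def by (simp flip: sum.inter_filter del: atLeastLessThan_iff)
  also have "\<dots> = (\<Sum>p\<in>{0..<n}. \<Sum>d\<in>{1..<n}. if ch p d then 1 else 0)"
    by (rule sum.swap)
  also have "\<dots> = (\<Sum>p\<in>{0..<n}. int (card (nbrs G (x p) \<inter> range x)))"
    by (simp flip: sum.inter_filter deg_ge del: atLeastLessThan_iff)
  also have "\<dots> = (\<Sum>v\<in>range x. int (card (nbrs G v \<inter> range x)))"
    using sum.reindex[OF inj_window[of 0], of "\<lambda>v. int (card (nbrs G v \<inter> range x))"]
    unfolding range_window[of 0] by simp
  finally show ?thesis .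
qed

end

locale ham = gcyc +
  assumes verts_range: "verts G = range x"
begin

lemma n_card: "n = int (order G)"
  using card_range n3 by (simp add: order_def verts_range)

lemma sum_row_edges: "(\<Sum>d\<in>{1..<n}. row d) = 2 * int (num_edges G)"
proof -
  have "nbrs G v \<inter> range x = nbrs G v" for v
    using nbrs_subset[OF simple] verts_range by auto
  then have "(\<Sum>d\<in>{1..<n}. row d) = int (\<Sum>v\<in>verts G. deg G v)"
    unfolding sum_row by (simp add: deg_def verts_range)
  then show ?thesis using handshake[OF simple] by simp
qed

lemma deg_ch: "int (deg G (x i)) = int (card {d \<in> {1..<n}. ch i d})"
  unfolding deg_ge deg_def using nbrs_subset[OF simple] verts_range
  by (metis Int_absorb2)

end

subsection \<open>Cycles with at most two chords\<close>

lemma set_cycle_edges: "2 \<le> length xs \<Longrightarrow> set xs = \<Union> (cycle_edges xs)"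
proof
  assume l: "2 \<le> length xs"
  then show "set xs \<subseteq> \<Union> (cycle_edges xs)" using cycle_edges_cover by fast
  show "\<Union> (cycle_edges xs) \<subseteq> set xs"
    using l path_edges_subset[of _ xs] by (cases "xs = []") (auto simp: cycle_edges_def)
qed

context gcyc
begin

lemma window_mem:
  assumes "J \<subseteq> {a..<a + n}" "i \<in> {a..<a + n}"
  shows "x i \<in> x ` J \<longleftrightarrow> i \<in> J"
  using assms inj_on_image_mem_iff[OF inj_window[of a]] by blast

text \<open>Marks the last position of a kept arc. Applied to the vertex set of a constructed cycle,
  it recovers the parameters of the construction from the cycle alone.\<close>

definition bd :: "'a set \<Rightarrow> int \<Rightarrow> bool" where
  "bd C i \<longleftrightarrow> x i \<in> C \<and> x (i + 1) \<notin> C"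

text \<open>The positions \<open>J\<close> lie in one window, so the successor of the last window
  position is the first one; the last conjunct covers this wrap-around.\<close>

lemma bd_image:
  assumes J: "J \<subseteq> {a..<a + n}"
  shows "bd (x ` J) i \<longleftrightarrow>
    (\<exists>j\<in>J. x i = x j \<and> j + 1 \<notin> J \<and> \<not> (j + 1 = a + n \<and> a \<in> J))"
proof -
  obtain j where j: "j \<in> {a..<a + n}" "x i = x j" using window by blast
  have s: "x (i + 1) = x (j + 1)" using j(2) by (rule x_shift)
  have u: "j' = j" if "j' \<in> J" "x i = x j'" for j'
    using that J j x_near[of j' j] by fastforce
  have "x (j + 1) \<in> x ` J \<longleftrightarrow> j + 1 \<in> J \<or> (j + 1 = a + n \<and> a \<in> J)"
  proof (cases "j + 1 = a + n")
    case True
    have "a + n \<notin> J" using J by auto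
    then show ?thesis using True window_mem[OF J, of a] n3 periodic[of a] by simp
  next
    case False then show ?thesis using window_mem[OF J, of "j + 1"] j by simp
  qed
  then have "bd (x ` J) i \<longleftrightarrow> j \<in> J \<and> j + 1 \<notin> J \<and> \<not> (j + 1 = a + n \<and> a \<in> J)"
    unfolding bd_def s j(2) using window_mem[OF J j(1)] by blast
  also have "\<dots> \<longleftrightarrow> (\<exists>j\<in>J. x i = x j \<and> j + 1 \<notin> J \<and> \<not> (j + 1 = a + n \<and> a \<in> J))"
    using u j(2) by blast
  finally show ?thesis .
qed

lemma hm_eq: "hm i = hm j \<longleftrightarrow> x i = x j"
  using chord_eq[of i 1 j 1] n3 x_shift[of i j 1] by auto

lemma chord_not_hm: "2 \<le> d \<Longrightarrow> d \<le> n - 2 \<Longrightarrow> {x p, x (p + d)} \<noteq> hm i"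
  using chord_eq[of p d i 1] n3 by auto

lemma set_one: "set (one h p) = x ` {p + h + 1..p + n}"
  by (auto simp: one_def)

lemma set_cross: "set (cross h p d t) = x ` ({p + t..p + d} \<union> {p + d + h + 2 - t..p + n})"
  by (auto simp: cross_def)

lemma set_par: "set (par h p d g) = x ` ({p + d..p + d + g} \<union> {p + h + 2 + g..p + n})"
  by (auto simp: par_def)

lemma bd_one:
  assumes "1 \<le> h" "h + 3 \<le> n"
  shows "bd (set (one h p)) i \<longleftrightarrow> x i = x p"
proof -
  let ?J = "{p + h + 1..p + n}"
  have "bd (x ` ?J) i \<longleftrightarrow>
    (\<exists>j\<in>?J. x i = x j \<and> j + 1 \<notin> ?J \<and> \<not> (j + 1 = p + 1 + n \<and> p + 1 \<in> ?J))"
    using assms by (intro bd_image) auto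
  also have "\<dots> \<longleftrightarrow> (\<exists>j\<in>{p + n}. x i = x j)"
  proof -
    have "j \<in> ?J \<and> j + 1 \<notin> ?J \<and> \<not> (j + 1 = p + 1 + n \<and> p + 1 \<in> ?J) \<longleftrightarrow> j \<in> {p + n}" for j
      using assms by auto
    then show ?thesis by blast
  qed
  finally show ?thesis by (simp add: set_one periodic)
qed

text \<open>For \<open>t = 1\<close> the gap after \<open>x p\<close> is empty, so the only gap
  starts after \<open>x (p + d)\<close>.\<close>

lemma bd_cross1:
  assumes "1 \<le> h" "2 \<le> d" "d \<le> n - h - 2"
  shows "bd (set (cross h p d 1)) i \<longleftrightarrow> x i = x (p + d)"
proof -
  let ?J = "{p + 1..p + d} \<union> {p + d + h + 2 - 1..p + n}"
  have "bd (x ` ?J) i \<longleftrightarrow>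
    (\<exists>j\<in>?J. x i = x j \<and> j + 1 \<notin> ?J \<and> \<not> (j + 1 = p + 1 + n \<and> p + 1 \<in> ?J))"
    using assms by (intro bd_image) auto
  also have "\<dots> \<longleftrightarrow> (\<exists>j\<in>{p + d}. x i = x j)"
  proof -
    have "j \<in> ?J \<and> j + 1 \<notin> ?J \<and> \<not> (j + 1 = p + 1 + n \<and> p + 1 \<in> ?J) \<longleftrightarrow> j \<in> {p + d}" for j
      using assms by auto
    then show ?thesis by blast
  qed
  finally show ?thesis by (simp add: set_cross)
qed

text \<open>Both gaps are nonempty because \<open>2 <= d\<close> and \<open>d <= h\<close>.\<close>

lemma bd_par:
  assumes "2 \<le> d" "d \<le> h" "0 \<le> g" "g + h + 2 \<le> n"
  shows "bd (set (par h p d g)) i \<longleftrightarrow> x i = x p \<or> x i = x (p + d + g)"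
proof -
  let ?J = "{p + d..p + d + g} \<union> {p + h + 2 + g..p + n}"
  have "bd (x ` ?J) i \<longleftrightarrow>
    (\<exists>j\<in>?J. x i = x j \<and> j + 1 \<notin> ?J \<and> \<not> (j + 1 = p + 1 + n \<and> p + 1 \<in> ?J))"
    using assms by (intro bd_image) auto
  also have "\<dots> \<longleftrightarrow> (\<exists>j\<in>{p + n, p + d + g}. x i = x j)"
  proof -
    have "j \<in> ?J \<and> j + 1 \<notin> ?J \<and> \<not> (j + 1 = p + 1 + n \<and> p + 1 \<in> ?J) \<longleftrightarrow> j \<in> {p + n, p + d + g}" for j
      using assms by auto
    then show ?thesis by blast
  qed
  finally show ?thesis by (simp add: set_par periodic)
qed

text \<open>Together with \<open>par_closed\<close> this separates cycles with uncrossed chords from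
  crossing ones: the former keep every edge of the given cycle whose two ends they contain, the
  latter lose one by \<open>cross1_open\<close>.\<close>

lemma one_closed:
  assumes "1 \<le> h" "h + 3 \<le> n" "x i \<in> set (one h p)" "x (i + 1) \<in> set (one h p)"
  shows "hm i \<in> cycle_edges (one h p)"
proof -
  obtain j where j: "j \<in> {p + h + 1..p + n}" "x i = x j" using assms(3) by (auto simp: set_one)
  have "\<not> bd (set (one h p)) i" using assms(4) by (simp add: bd_def)
  then have "j \<noteq> p + n" using bd_one[of h p i] assms j periodic[of p] by auto
  then have "j \<in> {p + h + 1..<p + n}" using j by auto
  then have "hm j \<in> cycle_edges (one h p)" using one_edges[of h p] assms by auto
  moreover have "hm i = hm j" using hm_eq[of i j] j(2) by blast
  ultimately show ?thesis by (simp only:)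
qed

lemma par_closed:
  assumes "2 \<le> d" "d \<le> h" "0 \<le> g" "g + h + 2 \<le> n"
    "x i \<in> set (par h p d g)" "x (i + 1) \<in> set (par h p d g)"
  shows "hm i \<in> cycle_edges (par h p d g)"
proof -
  obtain j where j: "j \<in> {p + d..p + d + g} \<union> {p + h + 2 + g..p + n}" "x i = x j"
    using assms(5) unfolding set_par by blast
  have "\<not> bd (set (par h p d g)) i" using assms(6) by (simp add: bd_def)
  then have "j \<noteq> p + n" "j \<noteq> p + d + g"
    using bd_par[OF assms(1-4), of p i] j periodic[of p] by auto
  then have "j \<in> {p + d..<p + d + g} \<union> {p + h + 2 + g..<p + n}" using j by auto
  then have "hm j \<in> cycle_edges (par h p d g)" using par_edges[OF assms(1-4), of p] by auto
  moreover have "hm i = hm j" using hm_eq[of i j] j(2) by blast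
  ultimately show ?thesis by (simp only:)
qed

text \<open>The edge from \<open>x p\<close> to \<open>x (p + 1)\<close> is replaced by the two
  chords although both ends are kept. It is the only edge lost in this way, so \<open>p\<close> can
  be read off the cycle.\<close>

lemma cross1_open:
  assumes "1 \<le> h" "2 \<le> d" "d \<le> n - h - 2"
  shows "x p \<in> set (cross h p d 1)" "x (p + 1) \<in> set (cross h p d 1)"
    "hm p \<notin> cycle_edges (cross h p d 1)"
    "x i \<in> set (cross h p d 1) \<Longrightarrow> x (i + 1) \<in> set (cross h p d 1) \<Longrightarrow>
      hm i \<notin> cycle_edges (cross h p d 1) \<Longrightarrow> x i = x p"
proof -
  let ?C = "cross h p d 1"
  let ?J = "{p + 1..<p + d} \<union> {p + d + h + 1..<p + n}"
  have e: "cycle_edges ?C =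
    {{x p, x (p + d)}, {x (p + 1), x (p + 1 + (d + h))}} \<union> hm ` ?J"
    using assms cross_edges[of 1 h d p] by (simp add: algebra_simps)
  have "x (p + n) \<in> set ?C" "x (p + 1) \<in> set ?C"
    unfolding set_cross using assms by auto
  then show "x p \<in> set ?C" "x (p + 1) \<in> set ?C" by (simp_all only: periodic)
  have "x p \<noteq> x j" if "j \<in> ?J" for j
    using that assms x_near[of p j] by auto
  then have "hm p \<notin> hm ` ?J" using hm_eq by blast
  moreover have "{x p, x (p + d)} \<noteq> hm p" "{x (p + 1), x (p + 1 + (d + h))} \<noteq> hm p"
    using chord_not_hm[of d p p] chord_not_hm[of "d + h" "p + 1" p] assms by linarith+
  ultimately show "hm p \<notin> cycle_edges ?C" unfolding e by blast
  show "x i = x p" if i: "x i \<in> set ?C" "x (i + 1) \<in> set ?C" "hm i \<notin> cycle_edges ?C"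
  proof -
    have "p + d + h + 2 - 1 = p + d + h + 1" by simp
    then obtain j where j: "j \<in> {p + 1..p + d} \<union> {p + d + h + 1..p + n}" "x i = x j"
      using i(1) unfolding set_cross by (metis imageE)
    have "\<not> bd (set ?C) i" using i(2) by (simp add: bd_def)
    then have "j \<noteq> p + d" using bd_cross1[of h d p i] assms j by auto
    moreover have "j \<notin> ?J"
    proof
      assume "j \<in> ?J"
      then have "hm j \<in> cycle_edges ?C" unfolding e by blast
      moreover have "hm i = hm j" using hm_eq[of i j] j(2) by blast
      ultimately show False using i(3) by metis
    qed
    ultimately have "j = p + n" using j by auto
    then show ?thesis using j periodic by simp
  qed
qed

text \<open>The gaps of the two cycles start at the same two places. If they correspond in order,
  the first kept vertex after a gap gives \<open>d\<close> and the start of the other gap gives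
  \<open>g\<close>; otherwise the roles of the two gaps, and of the two arcs between them, are
  exchanged.\<close>

lemma par_decode:
  assumes "2 \<le> d" "d \<le> h" "0 \<le> g" "g + h + 2 \<le> n"
    and "2 \<le> d'" "d' \<le> h" "0 \<le> g'" "g' + h + 2 \<le> n"
    and "p \<in> {0..<n}" "p' \<in> {0..<n}" and eq: "set (par h p d g) = set (par h p' d' g')"
  shows "(p = p' \<and> d = d' \<and> g = g') \<or> (d' = h + 2 - d \<and> g' = n - h - 2 - g)"
proof -
  let ?S = "set (par h p d g)"
  have out: "x (q + j) \<notin> set (par h q d g)" if "1 \<le> j" "j < d" "2 \<le> d" "d \<le> h" "0 \<le> g" "g + h + 2 \<le> n"
    for q j d g
    unfolding set_par using that by (subst window_mem[of _ "q + 1"]) auto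
  have at: "x (q + d) \<in> set (par h q d g)" if "0 \<le> g" for q d g
    unfolding set_par using that by auto
  have out2: "x (q + d + g + j) \<notin> set (par h q d g)"
    if "1 \<le> j" "j < h + 2 - d" "2 \<le> d" "d \<le> h" "0 \<le> g" "g + h + 2 \<le> n" for q j d g
    unfolding set_par using that by (subst window_mem[of _ "q + 1"]) auto
  have at2: "x (q + d + g + (h + 2 - d)) \<in> set (par h q d g)" if "g + h + 2 \<le> n" for q d g
    unfolding set_par using that by (auto simp: algebra_simps)
  have b: "x i = x p \<or> x i = x (p + d + g) \<longleftrightarrow> x i = x p' \<or> x i = x (p' + d' + g')" for i
    using bd_par[OF assms(1-4), of p i] bd_par[OF assms(5-8), of p' i] eq by simp
  have ne: "x p \<noteq> x (p + d + g)" using x_near[of p "p + d + g"] assms by auto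
  consider "x p = x p'" | "x p = x (p' + d' + g')" "x (p + d + g) = x p'"
    using b[of p] b[of "p + d + g"] b[of p'] ne by metis
  then show ?thesis
  proof cases
    case 1
    then have p: "p = p'" using x_near[of p p'] assms by auto
    have "\<not> d < d'" using out[of d d' g' p'] at[of g p d] eq p assms by auto
    moreover have "\<not> d' < d" using out[of d' d g p] at[of g' p' d'] eq p assms by auto
    ultimately have d: "d = d'" by simp
    have "x (p + d + g) = x (p + d + g')"
      using b[of "p + d + g"] ne p d by auto
    then show ?thesis using x_near[of "p + d + g" "p + d + g'"] p d assms by auto
  next
    case 2
    have s: "x (p + j) = x (p' + d' + g' + j)" for j using x_shift[OF 2(1), of j] by simp
    have "\<not> d < h + 2 - d'" using out2[of d d' g' p'] at[of g p d] eq s[of d] assms by auto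
    moreover have "\<not> h + 2 - d' < d"
      using out[of "h + 2 - d'" d g p] at2[of g' p' d'] eq s[of "h + 2 - d'"] assms by auto
    ultimately have d: "d = h + 2 - d'" by simp
    have "x (p' + (h + 2 + g + g')) = x (p' + n)"
      using s[of "d + g"] 2(2) d periodic[of p'] by (simp add: algebra_simps)
    then have "h + 2 + g + g' = n" using x_near[of "p' + (h + 2 + g + g')" "p' + n"] assms by auto
    with d show ?thesis by auto
  qed
qed

lemma cross1_cyc:
  assumes "1 \<le> h" "h + 3 \<le> n" "2 \<le> d" "d \<le> n - h - 2" "ch p d" "ch (p + 1) (d + h)"
  shows "cyc G (cross h p d 1)" "length (cross h p d 1) = nat (n - h)"
  using cross_cyc[of h 1 d p] assms by simp_all

lemma cyc_set_edges: "cyc G xs \<Longrightarrow> set xs = \<Union> (cycle_edges xs)"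
  by (intro set_cycle_edges) (simp add: cyc_def)

text \<open>The three kinds never coincide: crossing pairs lose an edge between kept vertices, and
  the other two kinds differ in their number of gaps. Within a kind the gaps determine the
  parameters, except that parallel chords can be listed in either order; \<open>swap\<close> admits
  only one of the two listings.\<close>

lemma family_count:
  assumes h: "1 \<le> h" "h + 3 \<le> n"
    and Bs: "Bs \<subseteq> {(p, d). p \<in> {0..<n} \<and> 2 \<le> d \<and> d \<le> n - h - 2 \<and> ch p d \<and> ch (p + 1) (d + h)}"
    and Ps: "Ps \<subseteq> {(p, d, g). p \<in> {0..<n} \<and> 2 \<le> d \<and> d \<le> h \<and> 0 \<le> g \<and> g + h + 2 \<le> n
          \<and> ch p d \<and> ch (p + d + g) (h + 2 - d)}"
    and swap: "\<And>p d g p'. (p, d, g) \<in> Ps \<Longrightarrow> (p', h + 2 - d, n - h - 2 - g) \<notin> Ps"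
  shows "row (h + 1) + int (card Bs) + int (card Ps) \<le> int (num_cycles (nat (n - h)) G)"
proof -
  let ?O = "{p \<in> {0..<n}. ch p (h + 1)}"
  let ?I = "(\<lambda>p. (0 :: nat, p, 0, 0)) ` ?O \<union> (\<lambda>(p, d). (1, p, d, 0)) ` Bs
    \<union> (\<lambda>(p, d, g). (2, p, d, g)) ` Ps"
  define F where "F = (\<lambda>(k :: nat, p, d, g). if k = 0 then one h p else if k = 1 then cross h p d 1
      else par h p d g)"
  have B: "p \<in> {0..<n}" "2 \<le> d" "d \<le> n - h - 2" "ch p d" "ch (p + 1) (d + h)"
    if "(p, d) \<in> Bs" for p d using that Bs by auto
  have P: "p \<in> {0..<n}" "2 \<le> d" "d \<le> h" "0 \<le> g" "g + h + 2 \<le> n" "ch p d" "ch (p + d + g) (h + 2 - d)"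
    if "(p, d, g) \<in> Ps" for p d g using that Ps by auto
  have fin: "finite Bs" "finite Ps"
  proof -
    have "Bs \<subseteq> {0..<n} \<times> {2..n - h - 2}" using B by auto
    then show "finite Bs" by (rule finite_subset) auto
    have "Ps \<subseteq> {0..<n} \<times> {2..h} \<times> {0..n}" 
    proof
      fix y assume y: "y \<in> Ps"
      obtain p d g where [simp]: "y = (p, d, g)" by (cases y)
      show "y \<in> {0..<n} \<times> {2..h} \<times> {0..n}" using P(1-5)[of p d g] y h by simp
    qed
    then show "finite Ps" by (rule finite_subset) auto
  qed
  have "card ?I \<le> num_cycles (nat (n - h)) G"
  proof (rule num_cycles_ge[OF simple, where F = F])
    fix i assume "i \<in> ?I"
    then consider p where "i = (0, p, 0, 0)" "ch p (h + 1)" | p d where "i = (1, p, d, 0)" "(p, d) \<in> Bs"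
      | p d g where "i = (2, p, d, g)" "(p, d, g) \<in> Ps" by auto
    then show "cyc G (F i) \<and> length (F i) = nat (n - h)"
    proof cases
      case 1 then show ?thesis using one_cyc[of h p] h by (simp add: F_def)
    next
      case 2 then show ?thesis using cross1_cyc[OF h B(2-5)[OF 2(2)]] by (simp add: F_def)
    next
      case 3 then show ?thesis using par_cyc[OF h(2) P(2-7)[OF 3(2)]] by (simp add: F_def)
    qed
  next
    have ne: "set (one h p) = \<Union> (cycle_edges (one h p))" if "ch p (h + 1)" for p
      using one_cyc[of h p] that h by (intro cyc_set_edges) simp
    have neB: "set (cross h p d 1) = \<Union> (cycle_edges (cross h p d 1))" if "(p, d) \<in> Bs" for p d
      using cross1_cyc[OF h B(2-5)[OF that]] by (intro cyc_set_edges)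
    have neP: "set (par h p d g) = \<Union> (cycle_edges (par h p d g))" if "(p, d, g) \<in> Ps" for p d g
      using par_cyc[OF h(2) P(2-7)[OF that]] by (intro cyc_set_edges) simp
    have OO: "p = p'" if "ch p (h + 1)" "ch p' (h + 1)" "p \<in> {0..<n}" "p' \<in> {0..<n}"
      and e: "cycle_edges (one h p) = cycle_edges (one h p')" for p p'
    proof -
      have "set (one h p) = set (one h p')" using ne that(1,2) e by (simp only:)
      then have "x p = x p'" using bd_one[OF h, of p p] bd_one[OF h, of p' p] by metis
      then show ?thesis using x_near[of p p'] that by auto
    qed
    have OB: "cycle_edges (one h p) \<noteq> cycle_edges (cross h q d 1)" if o: "ch p (h + 1)" "(q, d) \<in> Bs" for p q d
    proof
      assume e: "cycle_edges (one h p) = cycle_edges (cross h q d 1)"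
      have s: "set (one h p) = set (cross h q d 1)" using ne[OF o(1)] neB[OF o(2)] e by (simp only:)
      show False
        using one_closed[OF h, of q p] cross1_open(1-3)[OF h(1) B(2,3)[OF o(2)], of q]
        unfolding s e by blast
    qed
    have OP: "cycle_edges (one h p) \<noteq> cycle_edges (par h q d g)" if o: "ch p (h + 1)" "(q, d, g) \<in> Ps" for p q d g
    proof
      assume e: "cycle_edges (one h p) = cycle_edges (par h q d g)"
      have s: "set (one h p) = set (par h q d g)" using ne[OF o(1)] neP[OF o(2)] e by (simp only:)
      note Q = P[OF o(2)]
      have "x q = x p" "x (q + d + g) = x p"
        using bd_one[OF h, of p] bd_par[OF Q(2-5), of q] unfolding s by blast+
      then show False using x_near[of q "q + d + g"] Q by auto
    qed
    have BB: "p = p' \<and> d = d'" if o: "(p, d) \<in> Bs" "(p', d') \<in> Bs"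
      and e: "cycle_edges (cross h p d 1) = cycle_edges (cross h p' d' 1)" for p d p' d'
    proof -
      note b = B[OF o(1)] and b' = B[OF o(2)]
      have s: "set (cross h p d 1) = set (cross h p' d' 1)"
        using neB[OF o(1)] neB[OF o(2)] e by (simp only:)
      have "x p' = x p"
        using cross1_open(4)[OF h(1) b(2,3), of p' p] cross1_open(1-3)[OF h(1) b'(2,3), of p']
        unfolding s e by blast
      then have p: "p = p'" using x_near[of p p'] b b' by auto
      have "x (p + d) = x (p' + d')"
        using bd_cross1[OF h(1) b(2,3), of p "p + d"] bd_cross1[OF h(1) b'(2,3), of p' "p + d"]
        unfolding s by blast
      then show ?thesis using p x_near[of "p + d" "p + d'"] b b' h by auto
    qed
    have BP: "cycle_edges (par h p d g) \<noteq> cycle_edges (cross h q d' 1)"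
      if o: "(p, d, g) \<in> Ps" "(q, d') \<in> Bs" for p q d d' g
    proof
      assume e: "cycle_edges (par h p d g) = cycle_edges (cross h q d' 1)"
      have s: "set (par h p d g) = set (cross h q d' 1)" using neP[OF o(1)] neB[OF o(2)] e by (simp only:)
      show False
        using par_closed[OF P(2-5)[OF o(1)], of q p] cross1_open(1-3)[OF h(1) B(2,3)[OF o(2)], of q]
        unfolding s e by blast
    qed
    have PP: "p = p' \<and> d = d' \<and> g = g'" if "(p, d, g) \<in> Ps" "(p', d', g') \<in> Ps"
      "cycle_edges (par h p d g) = cycle_edges (par h p' d' g')" for p d g p' d' g'
    proof -
      have s: "set (par h p d g) = set (par h p' d' g')"
        using neP[OF that(1)] neP[OF that(2)] that(3) by (simp only:)
      show ?thesis
        using par_decode[OF P(2-5)[OF that(1)] P(2-5)[OF that(2)] P(1)[OF that(1)] P(1)[OF that(2)] s]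
          swap[OF that(1), of p'] that(2) by auto
    qed
    show "inj_on (\<lambda>i. cycle_edges (F i)) ?I"
    proof (rule inj_onI)
      fix i j assume ij: "i \<in> ?I" "j \<in> ?I" "cycle_edges (F i) = cycle_edges (F j)"
      have *: "(\<exists>p. i = (0, p, 0, 0) \<and> ch p (h + 1) \<and> p \<in> {0..<n}) \<or> (\<exists>p d. i = (1, p, d, 0) \<and> (p, d) \<in> Bs)
        \<or> (\<exists>p d g. i = (2, p, d, g) \<and> (p, d, g) \<in> Ps)" if "i \<in> ?I" for i
        using that by auto
      from *[OF ij(1)] show "i = j"
      proof (elim disjE exE conjE)
        fix p assume i: "i = (0, p, 0, 0)" "ch p (h + 1)" "p \<in> {0..<n}"
        from *[OF ij(2)] show ?thesis
        proof (elim disjE exE conjE)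
          fix q assume "j = (0, q, 0, 0)" "ch q (h + 1)" "q \<in> {0..<n}"
          then show ?thesis using OO[of p q] i ij(3) by (simp add: F_def)
        next
          fix q d assume "j = (1, q, d, 0)" "(q, d) \<in> Bs"
          then show ?thesis using OB[of p q d] i ij(3) by (simp add: F_def)
        next
          fix q d g assume "j = (2, q, d, g)" "(q, d, g) \<in> Ps"
          then show ?thesis using OP[of p q d g] i ij(3) by (simp add: F_def)
        qed
      next
        fix p d assume i: "i = (1, p, d, 0)" "(p, d) \<in> Bs"
        from *[OF ij(2)] show ?thesis
        proof (elim disjE exE conjE)
          fix q assume "j = (0, q, 0, 0)" "ch q (h + 1)" "q \<in> {0..<n}"
          then show ?thesis using OB[of q p d] i ij(3) by (simp add: F_def)
        next
          fix q d' assume "j = (1, q, d', 0)" "(q, d') \<in> Bs"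
          then show ?thesis using BB[of p d q d'] i ij(3) by (simp add: F_def)
        next
          fix q d' g assume "j = (2, q, d', g)" "(q, d', g) \<in> Ps"
          then show ?thesis using BP[of q d' g p d] i ij(3) by (simp add: F_def)
        qed
      next
        fix p d g assume i: "i = (2, p, d, g)" "(p, d, g) \<in> Ps"
        from *[OF ij(2)] show ?thesis
        proof (elim disjE exE conjE)
          fix q assume "j = (0, q, 0, 0)" "ch q (h + 1)" "q \<in> {0..<n}"
          then show ?thesis using OP[of q p d g] i ij(3) by (simp add: F_def)
        next
          fix q d' assume "j = (1, q, d', 0)" "(q, d') \<in> Bs"
          then show ?thesis using BP[of p d g q d'] i ij(3) by (simp add: F_def)
        next
          fix q d' g' assume "j = (2, q, d', g')" "(q, d', g') \<in> Ps"
          then show ?thesis using PP[of p d g q d' g'] i ij(3) by (simp add: F_def)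
        qed
      qed
    qed
  qed
  moreover have "card ?I = card ?O + card Bs + card Ps"
  proof -
    have finO: "finite ?O" by (rule finite_subset[of _ "{0..<n}"]) auto
    have "card ?I = card ((\<lambda>p. (0 :: nat, p, 0 :: int, 0 :: int)) ` ?O \<union> (\<lambda>(p, d). (1, p, d, 0)) ` Bs)
        + card ((\<lambda>(p, d, g). (2 :: nat, p, d, g)) ` Ps)"
      by (intro card_Un_disjoint finite_UnI finite_imageI fin finO) auto
    also have "card ((\<lambda>p. (0 :: nat, p, 0 :: int, 0 :: int)) ` ?O \<union> (\<lambda>(p, d). (1, p, d, 0)) ` Bs)
      = card ((\<lambda>p. (0 :: nat, p, 0 :: int, 0 :: int)) ` ?O) + card ((\<lambda>(p, d). (1 :: nat, p, d, 0 :: int)) ` Bs)"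
      by (intro card_Un_disjoint finite_imageI fin finO) auto
    also have "card ((\<lambda>p. (0 :: nat, p, 0 :: int, 0 :: int)) ` ?O) = card ?O"
      by (rule card_image) (auto simp: inj_on_def)
    also have "card ((\<lambda>(p, d). (1 :: nat, p, d, 0 :: int)) ` Bs) = card Bs"
      by (rule card_image) (auto simp: inj_on_def)
    also have "card ((\<lambda>(p, d, g). (2 :: nat, p, d, g)) ` Ps) = card Ps"
      by (rule card_image) (auto simp: inj_on_def)
    finally show ?thesis .
  qed
  ultimately show ?thesis unfolding row_def by linarith
qed

end

section \<open>Counting pairs of chords at consecutive vertices\<close>

lemma card_pairs:
  assumes "finite A" "finite D"
  shows "int (card {(p, d). p \<in> A \<and> d \<in> D \<and> P p d}) = (\<Sum>d\<in>D. int (card {p \<in> A. P p d}))"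
proof -
  have "{(p, d). p \<in> A \<and> d \<in> D \<and> P p d} = (\<lambda>(d, p). (p, d)) ` (SIGMA d:D. {p \<in> A. P p d})"
    by force
  then have "card {(p, d). p \<in> A \<and> d \<in> D \<and> P p d} = card (SIGMA d:D. {p \<in> A. P p d})"
    by (simp add: card_image inj_on_def split_beta prod_eq_iff)
  then show ?thesis using assms by simp
qed

lemma card_of_bool: "finite A \<Longrightarrow> int (card {p \<in> A. P p}) = (\<Sum>p\<in>A. of_bool (P p))"
  by (simp add: sum_of_bool_eq Int_def)

context gcyc
begin

definition both :: "int \<Rightarrow> int \<Rightarrow> int \<Rightarrow> int" where
  "both k d d' = int (card {p \<in> {0..<n}. ch p d \<and> ch (p + k) d'})"

definition neither :: "int \<Rightarrow> int \<Rightarrow> int \<Rightarrow> int" where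
  "neither k d d' = int (card {p \<in> {0..<n}. \<not> ch p d \<and> \<not> ch (p + k) d'})"

lemma row_sum: "(\<Sum>p\<in>{0..<n}. of_bool (ch (p + k) d)) = row d"
  unfolding card_of_bool[OF finite_atLeastLessThan_int, symmetric] by (rule row_shift)

text \<open>Pointwise, \<open>[A and B] - [not A and not B] = [A] + [B] - 1\<close>. Both row sums
  are independent of the offset \<open>k\<close>.\<close>

lemma both_neither: "both k d d' - neither k d d' = row d + row d' - n"
proof -
  have "both k d d' - neither k d d' =
    (\<Sum>p\<in>{0..<n}. of_bool (ch p d \<and> ch (p + k) d') - of_bool (\<not> ch p d \<and> \<not> ch (p + k) d'))"
    unfolding both_def neither_def card_of_bool[OF finite_atLeastLessThan_int] sum_subtractf ..
  also have "\<dots> = (\<Sum>p\<in>{0..<n}. of_bool (ch (p + 0) d) + of_bool (ch (p + k) d') - 1)"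
    by (rule sum.cong) auto
  also have "\<dots> = row d + row d' - n"
    unfolding sum_subtractf sum.distrib row_sum using n3 by simp
  finally show ?thesis .
qed

lemma both_nonneg: "0 \<le> both k d d'" and neither_nonneg: "0 \<le> neither k d d'"
  by (simp_all add: both_def neither_def)

text \<open>The two chords of a pair close a cycle of length \<open>n - h\<close>: by \<open>par\<close> in the first sum and
  by \<open>cross\<close> in the second.\<close>

definition DD :: "int \<Rightarrow> int" where
  "DD h = (\<Sum>d\<in>{2..h}. both (d + 1) d (h + 2 - d)) + (\<Sum>d\<in>{2..n - h - 2}. both 1 d (d + h))"

definition ZZ :: "int \<Rightarrow> int" where
  "ZZ h = (\<Sum>d\<in>{2..h}. neither (d + 1) d (h + 2 - d)) + (\<Sum>d\<in>{2..n - h - 2}. neither 1 d (d + h))"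

text \<open>Written with rows so that it makes sense for any cycle; by \<open>Q_edges\<close> it is
  \<open>4 e - n^2\<close> when the cycle spans.\<close>

definition Q :: int where "Q = 2 * (\<Sum>d\<in>{1..<n}. row d) - n * n"

text \<open>Sorts the lengths of chords at \<open>x i\<close> by their use in the pairs: forward in
  crossing pairs, backward (length \<open>n - d\<close>) in parallel pairs, plus the two cycle edges
  and the unmatched length \<open>n - h - 1\<close>. \<open>split2\<close> does the same at
  \<open>x (i + 1)\<close>, where \<open>h + 1\<close> is unmatched.\<close>

lemma split1:
  fixes f :: "int \<Rightarrow> int"
  assumes "1 \<le> h" "h + 5 \<le> n"
  shows "(\<Sum>d\<in>{1..<n}. f d) =
    f 1 + (\<Sum>d\<in>{2..n - h - 2}. f d) + f (n - h - 1) + (\<Sum>d\<in>{2..h}. f (n - d)) + f (n - 1)"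
proof -
  have "{1..<n} = insert 1 (insert (n - h - 1) (insert (n - 1) ({2..n - h - 2} \<union> {n - h..n - 2})))"
    using assms by auto
  moreover have "(\<Sum>d\<in>{2..h}. f (n - d)) = (\<Sum>d\<in>{n - h..n - 2}. f d)"
    by (rule sum.reindex_bij_witness[of _ "\<lambda>d. n - d" "\<lambda>d. n - d"]) auto
  ultimately show ?thesis using assms by (simp add: sum.union_disjoint)
qed

lemma split2:
  fixes f :: "int \<Rightarrow> int"
  assumes "1 \<le> h" "h + 5 \<le> n"
  shows "(\<Sum>d\<in>{1..<n}. f d) =
    f 1 + (\<Sum>d\<in>{2..h}. f (h + 2 - d)) + f (h + 1) + (\<Sum>d\<in>{2..n - h - 2}. f (d + h)) + f (n - 1)"
proof -
  have "{1..<n} = insert 1 (insert (h + 1) (insert (n - 1) ({2..h} \<union> {h + 2..n - 2})))"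
    using assms by auto
  moreover have "(\<Sum>d\<in>{2..h}. f (h + 2 - d)) = (\<Sum>d\<in>{2..h}. f d)"
    by (rule sum.reindex_bij_witness[of _ "\<lambda>d. h + 2 - d" "\<lambda>d. h + 2 - d"]) auto
  moreover have "(\<Sum>d\<in>{2..n - h - 2}. f (d + h)) = (\<Sum>d\<in>{h + 2..n - 2}. f d)"
    by (rule sum.reindex_bij_witness[of _ "\<lambda>d. d - h" "\<lambda>d. d + h"]) auto
  ultimately show ?thesis using assms by (simp add: sum.union_disjoint)
qed

text \<open>Summing \<open>both_neither\<close> over the pairs uses all rows twice except those of
  the cycle edges, of size \<open>n\<close>, and the two unmatched lengths, which by symmetry cost
  \<open>2 row (h + 1)\<close>.\<close>

lemma DD_ZZ:
  assumes h: "1 \<le> h" "h + 5 \<le> n"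
  shows "DD h - ZZ h = Q - 2 * row (h + 1)"
proof -
  have r: "row (n - h - 1) = row (h + 1)" "row (n - 1) = n"
    using row_sym[of "h + 1"] row_sym[of 1] row_1 by (simp_all add: algebra_simps)
  have "DD h - ZZ h =
    (\<Sum>d\<in>{2..h}. row d + row (h + 2 - d) - n) + (\<Sum>d\<in>{2..n - h - 2}. row d + row (d + h) - n)"
  proof -
    have "(\<Sum>d\<in>{2..h}. both (d + 1) d (h + 2 - d) - neither (d + 1) d (h + 2 - d)) =
      (\<Sum>d\<in>{2..h}. row d + row (h + 2 - d) - n)"
      "(\<Sum>d\<in>{2..n - h - 2}. both 1 d (d + h) - neither 1 d (d + h)) =
      (\<Sum>d\<in>{2..n - h - 2}. row d + row (d + h) - n)"
      by (simp_all only: both_neither)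
    then show ?thesis unfolding DD_def ZZ_def sum_subtractf by linarith
  qed
  also have "\<dots> = (\<Sum>d\<in>{2..h}. row d) + (\<Sum>d\<in>{2..h}. row (h + 2 - d)) + (\<Sum>d\<in>{2..n - h - 2}. row d)
      + (\<Sum>d\<in>{2..n - h - 2}. row (d + h)) - n * (h - 1) - n * (n - h - 3)"
    using h by (simp add: sum.distrib sum_subtractf algebra_simps)
  also have "\<dots> = 2 * (\<Sum>d\<in>{1..<n}. row d) - n * n - 2 * row (h + 1)"
    using split1[OF h, of row] split2[OF h, of row] row_1 r
    by (simp add: row_sym algebra_simps)
  finally show ?thesis by (simp add: Q_def)
qed

lemma O_DD_le:
  assumes h: "1 \<le> h" "h + 5 \<le> n"
  shows "row (h + 1) + DD h \<le> int (num_cycles (nat (n - h)) G)"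
proof -
  let ?Bs = "{(p, d). p \<in> {0..<n} \<and> d \<in> {2..n - h - 2} \<and> (ch p d \<and> ch (p + 1) (d + h))}"
  let ?As = "{(p, d). p \<in> {0..<n} \<and> d \<in> {2..h} \<and> (ch p d \<and> ch (p + (d + 1)) (h + 2 - d))}"
  \<comment> \<open>With \<open>g = 1\<close> the exchanged listing would have
    \<open>g = n - h - 3\<close>, which is at least 2, so no parallel pair is listed twice.\<close>
  let ?Ps = "(\<lambda>(p, d). (p, d, 1 :: int)) ` ?As"
  have "row (h + 1) + int (card ?Bs) + int (card ?Ps) \<le> int (num_cycles (nat (n - h)) G)"
    by (rule family_count) (use h in \<open>auto simp: add.assoc\<close>)
  moreover have "card ?Ps = card ?As" by (rule card_image) (auto simp: inj_on_def)
  ultimately show ?thesis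
    unfolding DD_def both_def by (simp only: card_pairs finite_atLeastLessThan_int finite_atLeastAtMost_int)
qed

text \<open>By \<open>DD_ZZ\<close> the left side is twice \<open>DD h + row (h + 1)\<close>. So few
  cycles force nearly every pair to have exactly one of its chords, which is the source of all
  rigidity below.\<close>

lemma DD_ZZ_le:
  assumes h: "1 \<le> h" "h + 5 \<le> n"
  shows "DD h + ZZ h + Q \<le> 2 * int (num_cycles (nat (n - h)) G)"
  using DD_ZZ[OF h] O_DD_le[OF h] by linarith

lemma row_le_cycles:
  assumes h: "1 \<le> h" "h + 5 \<le> n"
  shows "row (h + 1) \<le> int (num_cycles (nat (n - h)) G)"
proof -
  have "0 \<le> DD h" unfolding DD_def by (intro add_nonneg_nonneg sum_nonneg both_nonneg)
  then show ?thesis using O_DD_le[OF h] by linarith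
qed

text \<open>All cycles that avoid the interiors of two disjoint arcs with \<open>d\<close> and \<open>h + 2 - d\<close> edges,
  for every distance of the arcs.\<close>

definition KK :: "int \<Rightarrow> int \<Rightarrow> int" where
  "KK h d = (\<Sum>g\<in>{0..n - h - 2}. both (d + g) d (h + 2 - d))"

text \<open>Two lower bounds for the number of cycles are added: one from the whole family
  \<open>KK h d\<close>, and one from \<open>DD h\<close> with the pairs of lengths \<open>d\<close>
  and \<open>h + 2 - d\<close> traded for \<open>KK h d\<close>. \<open>DD_ZZ\<close> converts
  \<open>DD h\<close> into absent pairs, and the traded pairs combine with their absent counterparts
  by \<open>both_neither\<close>.\<close>

lemma KK_bound:
  assumes h: "1 \<le> h" "h + 5 \<le> n" and d: "2 \<le> d" "d \<le> h" "d \<noteq> h + 2 - d"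
  shows "2 * KK h d + Q \<le> 2 * int (num_cycles (nat (n - h)) G) + 2 * (row d + row (h + 2 - d) - n)"
proof -
  let ?e = "h + 2 - d"
  let ?c = "int (num_cycles (nat (n - h)) G)"
  let ?Ks = "{(p, g). p \<in> {0..<n} \<and> g \<in> {0..n - h - 2} \<and> (ch p d \<and> ch (p + (d + g)) ?e)}"
  let ?Ks' = "(\<lambda>(p, g). (p, d, g)) ` ?Ks"
  have cK: "int (card ?Ks') = KK h d"
  proof -
    have "card ?Ks' = card ?Ks" by (rule card_image) (auto simp: inj_on_def)
    then show ?thesis
      unfolding KK_def both_def by (simp only: card_pairs finite_atLeastLessThan_int finite_atLeastAtMost_int)
  qed
  have 1: "row (h + 1) + int (card ({} :: (int \<times> int) set)) + int (card ?Ks') \<le> ?c"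
    by (rule family_count) (use h d in \<open>auto simp: add.assoc\<close>)
  let ?Bs = "{(p, d). p \<in> {0..<n} \<and> d \<in> {2..n - h - 2} \<and> (ch p d \<and> ch (p + 1) (d + h))}"
  \<comment> \<open>These two lengths are left out because their cycles already occur in
    \<open>?Ks\<close>, those of length \<open>?e\<close> in exchanged listing.\<close>
  let ?R = "{2..h} - {d, ?e}"
  let ?As = "{(p, d). p \<in> {0..<n} \<and> d \<in> ?R \<and> (ch p d \<and> ch (p + (d + 1)) (h + 2 - d))}"
  let ?As' = "(\<lambda>(p, d). (p, d, 1 :: int)) ` ?As"
  have 2: "row (h + 1) + int (card ?Bs) + int (card (?As' \<union> ?Ks')) \<le> ?c"
    by (rule family_count) (use h d in \<open>auto simp: add.assoc\<close>)
  have fin: "finite ?As'" "finite ?Ks'"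
  proof -
    have "?As \<subseteq> {0..<n} \<times> {2..h}" "?Ks \<subseteq> {0..<n} \<times> {0..n}" using h by auto
    then have "finite ?As" "finite ?Ks" by (auto intro: finite_subset)
    then show "finite ?As'" "finite ?Ks'" by auto
  qed
  have "card (?As' \<union> ?Ks') = card ?As' + card ?Ks'"
    using fin by (intro card_Un_disjoint) auto
  moreover have "card ?As' = card ?As" by (rule card_image) (auto simp: inj_on_def)
  moreover have "int (card ?As) = (\<Sum>d\<in>?R. both (d + 1) d (h + 2 - d))"
    unfolding both_def by (subst card_pairs) simp_all
  moreover have "int (card ?Bs) = (\<Sum>d\<in>{2..n - h - 2}. both 1 d (d + h))"
    unfolding both_def by (subst card_pairs) simp_all
  moreover have sp: "(\<Sum>j\<in>{2..h}. f j) = f d + f ?e + (\<Sum>j\<in>?R. f j)" for f :: "int \<Rightarrow> int"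
  proof -
    have "{2..h} = insert d (insert ?e ?R)" using d by auto
    then show ?thesis using d by (smt (verit) Diff_iff finite_Diff finite_atLeastAtMost_int finite_insert insert_iff sum.insert)
  qed
  ultimately have "row (h + 1) + DD h - both (d + 1) d ?e - both (?e + 1) ?e (h + 2 - ?e) + KK h d \<le> ?c"
    using 2 cK unfolding DD_def sp[of "\<lambda>d. both (d + 1) d (h + 2 - d)"] by linarith
  moreover have "neither (d + 1) d ?e + neither (?e + 1) ?e (h + 2 - ?e) \<le> ZZ h"
    unfolding ZZ_def sp[of "\<lambda>d. neither (d + 1) d (h + 2 - d)"]
    using sum_nonneg[of ?R "\<lambda>d. neither (d + 1) d (h + 2 - d)"]
      sum_nonneg[of "{2..n - h - 2}" "\<lambda>d. neither 1 d (d + h)"] neither_nonneg by (smt (verit))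
  moreover have "row (h + 1) + KK h d \<le> ?c" using 1 cK by simp
  ultimately show ?thesis
    using DD_ZZ[OF h] both_neither[of "d + 1" d ?e] both_neither[of "?e + 1" ?e "h + 2 - ?e"]
    by simp
qed

end

context ham
begin

lemma deg_sum: "int (deg G (x i)) = (\<Sum>d\<in>{1..<n}. of_bool (ch i d))"
  by (simp only: deg_ch card_of_bool[OF finite_atLeastLessThan_int])

lemma Q_edges: "Q = 4 * int (num_edges G) - n * n"
  by (simp add: Q_def sum_row_edges)

text \<open>Pigeonhole at each edge of the Hamilton cycle: besides the cycle edges and two unmatched
  chords, the possible chords at its ends form \<open>(h - 1) + (n - h - 3) = n - 4\<close> pairs.
  Degree sum beyond \<open>n\<close> is therefore paid by complete pairs or unmatched
  chords.\<close>

lemma degree_excess: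
  assumes h: "1 \<le> h" "h + 5 \<le> n"
  shows "(\<Sum>i\<in>{0..<n}. max 0 (int (deg G (x i)) + int (deg G (x (i + 1))) - n))
    \<le> 2 * int (num_cycles (nat (n - h)) G)"
proof -
  let ?A = "{2..h}" and ?B = "{2..n - h - 2}"
  define o1 where "o1 = (\<lambda>i. of_bool (ch (i + 1) (h + 1)) :: int)"
  define o2 where "o2 = (\<lambda>i. of_bool (ch (i + 0) (n - h - 1)) :: int)"
  define bA where "bA = (\<lambda>i. \<Sum>d\<in>?A. of_bool (ch (i - d) d \<and> ch (i + 1) (h + 2 - d)) :: int)"
  define bB where "bB = (\<lambda>i. \<Sum>d\<in>?B. of_bool (ch i d \<and> ch (i + 1) (d + h)) :: int)"
  have loc: "int (deg G (x i)) + int (deg G (x (i + 1))) - n \<le> o1 i + o2 i + bA i + bB i" for i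
  proof -
    have 1: "int (deg G (x i)) = 2 + (\<Sum>d\<in>?B. of_bool (ch i d)) + o2 i + (\<Sum>d\<in>?A. of_bool (ch (i - d) d))"
      unfolding deg_sum split1[OF h] o2_def
      using hm_adj[of i] ch_sym[of i "1"] ch_sym[of "i - d" d for d] hm_adj[of "i - 1"] periodic[of "i - 1"]
      by (auto simp: adj_sym algebra_simps intro!: sum.cong)
    have 2: "int (deg G (x (i + 1))) = 2 + (\<Sum>d\<in>?A. of_bool (ch (i + 1) (h + 2 - d))) + o1 i
        + (\<Sum>d\<in>?B. of_bool (ch (i + 1) (d + h)))"
      unfolding deg_sum split2[OF h] o1_def
      using hm_adj[of "i + 1"] hm_adj[of i] periodic[of i] by (simp add: adj_sym algebra_simps)
    have "(\<Sum>d\<in>?A. of_bool (ch (i - d) d)) + (\<Sum>d\<in>?A. of_bool (ch (i + 1) (h + 2 - d))) \<le> (h - 1) + bA i"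
    proof -
      have "(\<Sum>d\<in>?A. of_bool (ch (i - d) d) + of_bool (ch (i + 1) (h + 2 - d))) \<le>
        (\<Sum>d\<in>?A. 1 + of_bool (ch (i - d) d \<and> ch (i + 1) (h + 2 - d)) :: int)"
        by (rule sum_mono) auto
      then show ?thesis using h by (simp add: sum.distrib bA_def)
    qed
    moreover have "(\<Sum>d\<in>?B. of_bool (ch i d)) + (\<Sum>d\<in>?B. of_bool (ch (i + 1) (d + h))) \<le> (n - h - 3) + bB i"
    proof -
      have "(\<Sum>d\<in>?B. of_bool (ch i d) + of_bool (ch (i + 1) (d + h))) \<le>
        (\<Sum>d\<in>?B. 1 + of_bool (ch i d \<and> ch (i + 1) (d + h)) :: int)"
        by (rule sum_mono) auto
      then show ?thesis using h by (simp add: sum.distrib bB_def)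
    qed
    ultimately show ?thesis using 1 2 by linarith
  qed
  have nn: "0 \<le> o1 i + o2 i + bA i + bB i" for i
    by (simp add: o1_def o2_def bA_def bB_def sum_nonneg)
  have "(\<Sum>i\<in>{0..<n}. max 0 (int (deg G (x i)) + int (deg G (x (i + 1))) - n))
      \<le> (\<Sum>i\<in>{0..<n}. o1 i + o2 i + bA i + bB i)"
    by (rule sum_mono) (use loc nn in \<open>auto simp: max_def\<close>)
  also have "\<dots> = row (h + 1) + row (n - h - 1) + (\<Sum>i\<in>{0..<n}. bA i) + (\<Sum>i\<in>{0..<n}. bB i)"
    unfolding sum.distrib o1_def o2_def row_sum ..
  also have "row (n - h - 1) = row (h + 1)" using row_sym[of "h + 1"] by (simp add: algebra_simps)
  also have "(\<Sum>i\<in>{0..<n}. bA i) = (\<Sum>d\<in>?A. both (d + 1) d (h + 2 - d))"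
  proof -
    have "(\<Sum>i\<in>{0..<n}. of_bool (ch (i - d) d \<and> ch (i + 1) (h + 2 - d))) = both (d + 1) d (h + 2 - d)" for d
    proof -
      have "(\<Sum>i\<in>{0..<n}. of_bool (ch (i - d) d \<and> ch (i + 1) (h + 2 - d))) =
        int (card {i \<in> {0..<n}. ch (i + - d) d \<and> ch (i + - d + (d + 1)) (h + 2 - d)})"
        by (simp only: card_of_bool[OF finite_atLeastLessThan_int]) (simp add: algebra_simps)
      also have "\<dots> = both (d + 1) d (h + 2 - d)"
        unfolding both_def
        by (subst card_shift[of "\<lambda>i. ch i d \<and> ch (i + (d + 1)) (h + 2 - d)"])
          (use ch_periodic[of _ d] ch_periodic[of "_ + (d + 1)" "h + 2 - d"] in \<open>auto simp: algebra_simps\<close>)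
      finally show ?thesis .
    qed
    then show ?thesis unfolding bA_def by (subst sum.swap) simp
  qed
  also have "(\<Sum>i\<in>{0..<n}. bB i) = (\<Sum>d\<in>?B. both 1 d (d + h))"
    unfolding bB_def by (subst sum.swap) (simp only: both_def card_of_bool[OF finite_atLeastLessThan_int])
  finally show ?thesis using O_DD_le[OF h] row_le_cycles[OF h] unfolding DD_def by linarith
qed

end

subsection \<open>Lengths above two thirds of the order\<close>

lemma parity_class:
  fixes A :: "int set"
  assumes "finite A" "2 * k - 1 \<le> card A"
  shows "\<exists>B\<subseteq>A. card B = k \<and> (\<forall>s\<in>B. \<forall>t\<in>B. even (s - t))"
proof -
  let ?E = "{t \<in> A. even t}" and ?O = "{t \<in> A. odd t}"
  have "card (?E \<union> ?O) = card ?E + card ?O"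
    using assms(1) by (intro card_Un_disjoint) auto
  moreover have "?E \<union> ?O = A" by auto
  ultimately have "card A = card ?E + card ?O" by simp
  then consider "k \<le> card ?E" | "k \<le> card ?O" using assms(2) by linarith
  then show ?thesis
  proof cases
    case 1
    then obtain B where "B \<subseteq> ?E" "card B = k" using obtain_subset_with_card_n by blast
    then show ?thesis by (intro exI[of _ B]) auto
  next
    case 2
    then obtain B where "B \<subseteq> ?O" "card B = k" using obtain_subset_with_card_n by blast
    then show ?thesis by (intro exI[of _ B]) auto
  qed
qed

lemma mem_not_image: "e \<in> A \<union> f ` S \<Longrightarrow> (\<And>i. e \<noteq> f i) \<Longrightarrow> e \<in> A"
  by blast

context gcyc
begin

text \<open>A position can be skipped when a chord joins its two neighbours, and non-consecutive
  skips do not interfere. The induction on the end of the path advances by one or by two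
  positions.\<close>

lemma skip_path:
  assumes "\<And>t. t \<in> K \<Longrightarrow> ch (t - 1) 2" "\<And>t. t \<in> K \<Longrightarrow> t - 1 \<notin> K" "0 \<notin> K" "int b \<notin> K"
  shows "path_edges (map x (filter (\<lambda>i. i \<notin> K) [0..int b])) \<subseteq> edges G \<and>
    filter (\<lambda>i. i \<notin> K) [0..int b] \<noteq> [] \<and> last (filter (\<lambda>i. i \<notin> K) [0..int b]) = int b"
  using assms(4)
proof (induction b rule: less_induct)
  case (less b)
  have extend: ?case
    if c: "c < b" "int c \<notin> K" and f: "filter (\<lambda>i. i \<notin> K) [0..int b] = filter (\<lambda>i. i \<notin> K) [0..int c] @ [int b]"
      and e: "{x (int c), x (int b)} \<in> edges G" for c
  proof -
    let ?A = "filter (\<lambda>i. i \<notin> K) [0..int c]"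
    have A: "path_edges (map x ?A) \<subseteq> edges G" "?A \<noteq> []" "last ?A = int c"
      using less.IH[OF c] by blast+
    then have "path_edges (map x ?A @ [x (int b)]) \<subseteq> edges G"
      using e by (subst path_edges_append) (simp_all only: last_map map_is_Nil_conv path_edges.simps list.sel
          Un_empty_right insert_subset not_Cons_self2 simp_thms list.distinct)
    then show ?thesis unfolding f by simp
  qed
  show ?case
  proof (cases b)
    case 0 then show ?thesis using assms(3) by simp
  next
    case (Suc c)
    have e: "[0..int b] = [0..int c] @ [int b]"
      using upto_rec2[of 0 "int b"] Suc by simp
    show ?thesis
    proof (cases "int c \<in> K")
      case False
      have i: "int b = int c + 1" using Suc by simp
      show ?thesis
      proof (rule extend[of c])
        show "{x (int c), x (int b)} \<in> edges G" unfolding i by (rule ham_edge)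
        show "filter (\<lambda>i. i \<notin> K) [0..int b] = filter (\<lambda>i. i \<notin> K) [0..int c] @ [int b]"
          unfolding e filter_append using less.prems by simp
      qed (use Suc False in auto)
    next
      case True
      have "c \<noteq> 0" using True assms(3) by (cases c) auto
      then obtain a where a: "c = Suc a" by (cases c) auto
      have e': "[0..int c] = [0..int a] @ [int c]"
        using upto_rec2[of 0 "int c"] a by simp
      have aK: "int a \<notin> K" using assms(2)[OF True] a by simp
      have i: "int c - 1 = int a" "int a + 2 = int b" using a Suc by simp_all
      show ?thesis
      proof (rule extend[of a])
        show "{x (int a), x (int b)} \<in> edges G" using assms(1)[OF True] unfolding i adj_def .
        show "filter (\<lambda>i. i \<notin> K) [0..int b] = filter (\<lambda>i. i \<notin> K) [0..int a] @ [int b]"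
          unfolding e e' filter_append using less.prems True by simp
      qed (use Suc a aK in auto)
    qed
  qed
qed

text \<open>Among \<open>h + 2\<close> skippable positions of equal parity, hence pairwise
  non-consecutive, any \<open>h\<close> may be skipped. This gives \<open>h + 2\<close> choose 2
  cycles, told apart by their vertex sets.\<close>

lemma skip_cycles:
  assumes h: "1 \<le> h" "h + 3 \<le> n" and r: "2 * h + 4 \<le> row 2"
  shows "h + 2 \<le> int (num_cycles (nat (n - h)) G)"
proof -
  let ?A = "{t \<in> {1..n - 1}. ch (t - 1) 2}"
  have finA: "finite ?A" by (rule finite_subset[of _ "{1..n - 1}"]) auto
  \<comment> \<open>Position 0 is kept as the start, which costs at most one of the
    \<open>2 h + 4\<close> skippable positions; \<open>2 (h + 2) - 1\<close> suffice for
    \<open>h + 2\<close> of one parity.\<close>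
  have big: "2 * nat (h + 2) - 1 \<le> card ?A"
  proof -
    have "{p \<in> {0..<n}. ch (p + -1) 2} \<subseteq> insert 0 ?A" by auto
    then have "card {p \<in> {0..<n}. ch (p + -1) 2} \<le> card (insert 0 ?A)"
      by (intro card_mono) (use finA in auto)
    also have "\<dots> \<le> Suc (card ?A)" by (rule card_insert_le_m1) auto
    finally show ?thesis using row_shift[of "-1" 2] r h by linarith
  qed
  obtain T where T: "T \<subseteq> ?A" "card T = nat (h + 2)" "\<And>s t. s \<in> T \<Longrightarrow> t \<in> T \<Longrightarrow> even (s - t)"
    using parity_class[OF finA big] by blast
  have finT: "finite T" using T(1) finA by (rule finite_subset)
  define F where "F = (\<lambda>K. map x (filter (\<lambda>i. i \<notin> K) [1..n]))"
  let ?I = "{K. K \<subseteq> T \<and> card K = nat h}"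
  have sub: "K \<subseteq> {1..n - 1}" if "K \<in> ?I" for K using that T(1) by blast
  have setF: "set (F K) = range x - x ` K" if "K \<in> ?I" for K
  proof -
    have "set (F K) = x ` ({1..n} - K)" by (auto simp: F_def)
    also have "\<dots> = x ` {1..n} - x ` K"
      using sub[OF that] inj_window[of 1] by (intro inj_on_image_set_diff[of x "{1..<1 + n}"]) auto
    also have "{1..n} = {1..<1 + n}" by auto
    also have "x ` {1..<1 + n} = range x" by (rule range_window[symmetric])
    finally show ?thesis .
  qed
  have cyc: "cyc G (F K) \<and> length (F K) = nat (n - h)" if K: "K \<in> ?I" for K
  proof -
    let ?L = "filter (\<lambda>i. i \<notin> K) [1..n]"
    have KT: "K \<subseteq> T" "card K = nat h" using K by auto
    have finK: "finite K" using KT finT finite_subset by blast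
    have 0: "0 \<notin> K" "n \<notin> K" using sub[OF K] by auto
    have e: "filter (\<lambda>i. i \<notin> K) [0..n] = 0 # ?L" using n3 0 by (simp add: upto_rec1[of 0])
    have p: "path_edges (map x (filter (\<lambda>i. i \<notin> K) [0..int (nat n)])) \<subseteq> edges G \<and>
      filter (\<lambda>i. i \<notin> K) [0..int (nat n)] \<noteq> [] \<and> last (filter (\<lambda>i. i \<notin> K) [0..int (nat n)]) = int (nat n)"
    proof (rule skip_path)
      fix t assume t: "t \<in> K"
      show "ch (t - 1) 2" using t KT T(1) by blast
      show "t - 1 \<notin> K" using T(3)[of t "t - 1"] t KT by auto
    qed (use 0 n3 in auto)
    have ne: "?L \<noteq> []" using 0 n3 by (auto simp: filter_empty_conv)
    have last: "last ?L = n" using p n3 e ne by simp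
    have "cycle_edges (F K) = path_edges (map x (0 # ?L))"
    proof -
      have "path_edges ([x 0] @ map x ?L) = insert {x 0, x (hd ?L)} (path_edges (map x ?L))"
        using ne by (subst path_edges_append) (auto simp: hd_map)
      moreover have "x n = x 0" using periodic[of 0] by simp
      ultimately show ?thesis
        using ne last unfolding cycle_edges_def F_def by (simp add: last_map hd_map)
    qed
    then have ce: "cycle_edges (F K) \<subseteq> edges G" using p n3 e by simp
    have d: "distinct (F K)" unfolding F_def by (rule distinct_map_x[of _ 1]) auto
    have "length (F K) = card ({1..n} - K)"
    proof -
      have "set ?L = {1..n} - K" by auto
      moreover have "length ?L = card (set ?L)" by (rule distinct_card[symmetric]) simp
      ultimately show ?thesis unfolding F_def length_map by simp
    qed
    also have "\<dots> = nat n - nat h" using sub[OF K] finK KT(2) by (subst card_Diff_subset) auto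
    finally have "length (F K) = nat (n - h)" using h by simp
    then show ?thesis using ce d h by (simp add: cyc_def)
  qed
  have "card ?I \<le> num_cycles (nat (n - h)) G"
  proof (rule num_cycles_ge[OF simple, where F = F])
    show "inj_on (\<lambda>i. cycle_edges (F i)) ?I"
    proof (rule inj_onI)
      fix K K' assume K: "K \<in> ?I" "K' \<in> ?I" and e: "cycle_edges (F K) = cycle_edges (F K')"
      have "set (F K) = set (F K')"
        using cyc_set_edges[of "F K"] cyc_set_edges[of "F K'"] cyc[OF K(1)] cyc[OF K(2)] e by simp
      then have "x ` K = x ` K'" using setF[OF K(1)] setF[OF K(2)] by blast
      then show "K = K'"
      proof -
        have "K \<subseteq> {1..<1 + n}" "K' \<subseteq> {1..<1 + n}" using sub[OF K(1)] sub[OF K(2)] by auto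
        then show ?thesis using inj_on_image_eq_iff[OF inj_window[of 1]] \<open>x ` K = x ` K'\<close> by blast
      qed
    qed
  qed (use cyc in auto)
  moreover have "card ?I = nat (h + 2) choose nat h" using n_subsets[OF finT] T(2) by simp
  moreover have "nat (h + 2) choose nat h = Suc (Suc (nat h)) choose 2"
    using binomial_symmetric[of "nat h" "Suc (Suc (nat h))"] h
    by (simp add: nat_add_distrib numeral_2_eq_2)
  moreover have "Suc (Suc (nat h)) \<le> Suc (Suc (nat h)) choose 2"
  proof -
    have "Suc (Suc (nat h)) * 2 \<le> Suc (Suc (nat h)) * Suc (nat h)" using h by (intro mult_le_mono2) simp
    then have "Suc (Suc (nat h)) * 2 div 2 \<le> Suc (Suc (nat h)) * Suc (nat h) div 2" by (rule div_le_mono)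
    then show ?thesis by (simp add: choose_two)
  qed
  ultimately show ?thesis using h by linarith
qed

lemma row_rev_sum: "(\<Sum>g\<in>{0..<n}. of_bool (ch (q - g) d)) = row d"
proof -
  have "(\<Sum>g\<in>{0..<n}. of_bool (ch (q - g) d)) = (\<Sum>g\<in>{0..<n}. of_bool (ch (g + (q - n + 1)) d) :: int)"
    by (rule sum.reindex_bij_witness[of _ "\<lambda>g. n - 1 - g" "\<lambda>g. n - 1 - g"]) (auto simp: algebra_simps)
  then show ?thesis by (simp only: row_sum)
qed

lemma window_split:
  assumes "0 \<le> h" "h + 2 \<le> n"
  shows "(\<Sum>g\<in>{0..<n}. of_bool (P g)) \<le> (\<Sum>g\<in>{0..n - h - 2}. of_bool (P g)) + (h + 1 :: int)"
proof -
  have "{0..<n} = {0..n - h - 2} \<union> {n - h - 1..<n}" using assms by auto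
  moreover have "(\<Sum>g\<in>{0..n - h - 2} \<union> {n - h - 1..<n}. of_bool (P g)) =
      (\<Sum>g\<in>{0..n - h - 2}. of_bool (P g)) + (\<Sum>g\<in>{n - h - 1..<n}. of_bool (P g) :: int)"
    by (rule sum.union_disjoint) auto
  moreover have "(\<Sum>g\<in>{n - h - 1..<n}. of_bool (P g) :: int) \<le> (\<Sum>g\<in>{n - h - 1..<n}. 1)"
    by (rule sum_mono) auto
  ultimately show ?thesis using assms by (simp del: sum_of_bool_eq)
qed

text \<open>For a fixed first chord all but \<open>h + 1\<close> starting positions place the second
  arc disjoint from the first.\<close>

lemma KK_ge1:
  assumes "0 \<le> h" "h + 2 \<le> n"
  shows "row d * (row (h + 2 - d) - h - 1) \<le> KK h d"
proof -
  have "KK h d = (\<Sum>g\<in>{0..n - h - 2}. \<Sum>p\<in>{0..<n}. of_bool (ch p d \<and> ch (p + (d + g)) (h + 2 - d)))"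
    unfolding KK_def both_def by (simp only: card_of_bool[OF finite_atLeastLessThan_int])
  also have "\<dots> = (\<Sum>p\<in>{0..<n}. \<Sum>g\<in>{0..n - h - 2}. of_bool (ch p d) * of_bool (ch (p + (d + g)) (h + 2 - d)))"
    by (subst sum.swap) (simp only: of_bool_conj)
  also have "\<dots> = (\<Sum>p\<in>{0..<n}. of_bool (ch p d) * (\<Sum>g\<in>{0..n - h - 2}. of_bool (ch (p + (d + g)) (h + 2 - d))))"
    by (simp only: sum_distrib_left)
  also have "\<dots> \<ge> (\<Sum>p\<in>{0..<n}. of_bool (ch (p + 0) d) * (row (h + 2 - d) - h - 1))"
  proof (rule sum_mono)
    fix p
    have "(\<Sum>g\<in>{0..<n}. of_bool (ch (p + (d + g)) (h + 2 - d))) = row (h + 2 - d)"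
      using row_sum[of "p + d" "h + 2 - d"] by (simp add: algebra_simps)
    then show "of_bool (ch (p + 0) d) * (row (h + 2 - d) - h - 1) \<le>
        of_bool (ch p d) * (\<Sum>g\<in>{0..n - h - 2}. of_bool (ch (p + (d + g)) (h + 2 - d)))"
      using window_split[OF assms, of "\<lambda>g. ch (p + (d + g)) (h + 2 - d)"] by auto
  qed
  ultimately show ?thesis
    unfolding sum_distrib_right[symmetric] row_sum by linarith
qed

text \<open>Seen from the second chord: only \<open>h + 1\<close> positions of the first are
  excluded, too few to contain all chords of length \<open>d\<close>, so every chord of the
  complementary length has a partner.\<close>

lemma KK_ge2:
  assumes h: "0 \<le> h" "h + 2 \<le> n" and a: "h + 1 < row d"
  shows "row (h + 2 - d) \<le> KK h d"
proof -
  let ?e = "h + 2 - d"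
  have b: "both (d + g) d ?e = (\<Sum>q\<in>{0..<n}. of_bool (ch (q - d - g) d \<and> ch q ?e))" for g
  proof -
    have "both (d + g) d ?e = int (card {p \<in> {0..<n}. ch (p + - (d + g)) d \<and> ch (p + - (d + g) + (d + g)) ?e})"
      unfolding both_def
      by (subst card_shift[of "\<lambda>p. ch p d \<and> ch (p + (d + g)) ?e" "- (d + g)"])
        (use ch_periodic[of _ d] ch_periodic[of "_ + (d + g)" ?e] in \<open>auto simp: algebra_simps\<close>)
    then show ?thesis
      by (simp only: card_of_bool[OF finite_atLeastLessThan_int]) (simp add: algebra_simps)
  qed
  have "KK h d = (\<Sum>q\<in>{0..<n}. of_bool (ch q ?e) * (\<Sum>g\<in>{0..n - h - 2}. of_bool (ch (q - d - g) d)))"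
    unfolding KK_def b by (subst sum.swap) (simp only: of_bool_conj sum_distrib_left mult.commute)
  also have "\<dots> \<ge> (\<Sum>q\<in>{0..<n}. of_bool (ch (q + 0) ?e))"
  proof (rule sum_mono)
    fix q
    show "of_bool (ch (q + 0) ?e) \<le> of_bool (ch q ?e) * (\<Sum>g\<in>{0..n - h - 2}. of_bool (ch (q - d - g) d) :: int)"
      using window_split[OF h, of "\<lambda>g. ch (q - d - g) d"] row_rev_sum[of "q - d" d] a by auto
  qed
  ultimately show ?thesis unfolding row_sum by linarith
qed

lemma KK_nonneg: "0 \<le> KK h d"
  unfolding KK_def by (intro sum_nonneg both_nonneg)

lemma cross_mem:
  assumes "1 \<le> t" "t \<le> h + 1" "t < d" "d + h + 2 - t < n" "2 \<le> k" "k \<le> n - 2"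
    and "{x a, x (a + k)} \<in> cycle_edges (cross h p d t)"
  shows "{x a, x (a + k)} = {x p, x (p + d)} \<or>
    {x a, x (a + k)} = {x (p + t), x (p + t + (d + h + 2 - 2 * t))}"
proof -
  have e: "p + t + (d + h + 2 - 2 * t) = p + d + h + 2 - t" by simp
  have "{x a, x (a + k)} \<in> {{x p, x (p + d)}, {x (p + t), x (p + d + h + 2 - t)}}"
    using assms(7) unfolding cross_edges[OF assms(1-4)]
    by (rule mem_not_image) (rule chord_not_hm[OF assms(5,6)])
  then show ?thesis unfolding e insert_iff empty_iff by blast
qed

lemma cross_chords:
  assumes "1 \<le> t" "t \<le> h + 1" "t < d" "d + h + 2 - t < n"
  shows "{x p, x (p + d)} \<in> cycle_edges (cross h p d t)"
    "{x (p + t), x (p + t + (d + h + 2 - 2 * t))} \<in> cycle_edges (cross h p d t)"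
proof -
  have e: "p + t + (d + h + 2 - 2 * t) = p + d + h + 2 - t" by simp
  show "{x p, x (p + d)} \<in> cycle_edges (cross h p d t)"
    "{x (p + t), x (p + t + (d + h + 2 - 2 * t))} \<in> cycle_edges (cross h p d t)"
    unfolding cross_edges[OF assms] e by blast+
qed

lemma one_mem:
  assumes "1 \<le> h" "h + 3 \<le> n" "2 \<le> k" "k \<le> n - 2" "{x a, x (a + k)} \<in> cycle_edges (one h p)"
  shows "{x a, x (a + k)} = {x p, x (p + h + 1)}"
proof -
  have "cycle_edges (one h p) = {{x p, x (p + h + 1)}} \<union> hm ` {p + h + 1..<p + n}"
    using assms(1,2) by (subst one_edges) simp_all
  then have "{x a, x (a + k)} \<in> {{x p, x (p + h + 1)}} \<union> hm ` {p + h + 1..<p + n}"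
    using assms(5) by (rule subst)
  then have "{x a, x (a + k)} \<in> {{x p, x (p + h + 1)}}"
    by (rule mem_not_image) (rule chord_not_hm[OF assms(3,4)])
  then show ?thesis by (simp only: singleton_iff)
qed

text \<open>A crossing cycle has only its two chords off the given cycle. The length conditions
  exclude reversed readings, and a genuine exchange of roles between \<open>p\<close> and
  \<open>q\<close> would give \<open>x p = x (p + 2 * t)\<close>, impossible for
  \<open>0 < 2 t < n\<close>.\<close>

lemma cross_row_count:
  assumes h: "1 \<le> h" "h + 3 \<le> n" and t: "1 \<le> t" "t \<le> h + 1" "t < d" "d + h + 2 - t < n"
    and d: "2 \<le> d" "2 * d < n" "d + (d + h + 2 - 2 * t) \<noteq> n" "2 * t < n"
  shows "both t d (d + h + 2 - 2 * t) \<le> int (num_cycles (nat (n - h)) G)"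
proof -
  let ?e = "d + h + 2 - 2 * t"
  let ?I = "{p \<in> {0..<n}. ch p d \<and> ch (p + t) ?e}"
  have "card ?I \<le> num_cycles (nat (n - h)) G"
  proof (rule num_cycles_ge[OF simple, where F = "\<lambda>p. cross h p d t"])
    fix p assume "p \<in> ?I"
    then show "cyc G (cross h p d t) \<and> length (cross h p d t) = nat (n - h)"
      using cross_cyc[of h t d p] h t by auto
  next
    have m: "{x p, x (p + d)} \<in> cycle_edges (cross h p d t)" for p
      by (rule cross_chords[OF t])
    have k: "x p = x q \<or> x p = x (q + t)"
      if "cycle_edges (cross h p d t) = cycle_edges (cross h q d t)" for p q
    proof -
      have "{x p, x (p + d)} = {x q, x (q + d)} \<or> {x p, x (p + d)} = {x (q + t), x (q + t + ?e)}"
        using m[of p] d unfolding that by (intro cross_mem[OF t]) simp_all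
      then show ?thesis
      proof
        assume "{x p, x (p + d)} = {x q, x (q + d)}"
        from chord_eq[OF this] show ?thesis using d by auto
      next
        assume "{x p, x (p + d)} = {x (q + t), x (q + t + ?e)}"
        from chord_eq[OF this] show ?thesis using d t by auto
      qed
    qed
    show "inj_on (\<lambda>p. cycle_edges (cross h p d t)) ?I"
    proof (rule inj_onI)
      fix p q assume pq: "p \<in> ?I" "q \<in> ?I" and e: "cycle_edges (cross h p d t) = cycle_edges (cross h q d t)"
      have "x p = x q"
      proof (rule ccontr)
        assume ne: "x p \<noteq> x q"
        then have "x p = x (q + t)" "x q = x (p + t)" using k[OF e] k[OF e[symmetric]] by auto
        then have "x p = x (p + 2 * t)" using x_shift[of q "p + t" t] by (simp add: algebra_simps)
        then show False using x_near[of p "p + 2 * t"] d t by auto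
      qed
      then show "p = q" using x_near[of p q] pq by auto
    qed
  qed
  then show ?thesis by (simp add: both_def)
qed

end

section \<open>Rigidity of the rows when long cycles are few\<close>

locale arcs = gcyc +
  fixes h :: int
  assumes h3: "3 \<le> h" "3 * h + 3 \<le> n" and Q7: "7 \<le> Q"
    and few: "int (num_cycles (nat (n - h)) G) \<le> h + 1"
begin

lemma h5: "1 \<le> h" "h + 5 \<le> n" using h3 by auto

text \<open>\<open>KK_bound\<close> leaves \<open>h + 1 - Q / 2\<close>, which is at most
  \<open>h - 3\<close> by \<open>Q >= 7\<close> and integrality.\<close>

lemma KK_upper:
  assumes "2 \<le> d" "d \<le> h" "d \<noteq> h + 2 - d"
  shows "KK h d + n \<le> row d + row (h + 2 - d) + h - 3"
  using KK_bound[OF h5 assms] Q7 few by (smt (verit))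

lemma row_zero_or_large:
  assumes d: "2 \<le> d" "d \<le> h" "d \<noteq> h + 2 - d" and r: "row d \<noteq> 0"
  shows "n - h + 3 \<le> row d"
proof (cases "h + 1 < row d")
  case True
  have "row (h + 2 - d) \<le> KK h d" by (rule KK_ge2) (use True h5 in auto)
  then show ?thesis using KK_upper[OF d] by linarith
next
  case False
  let ?a = "row d" and ?b = "row (h + 2 - d)"
  have a: "1 \<le> ?a" using r row_nonneg[of d] by linarith
  have "?a * (?b - h - 1) \<le> KK h d" using h5 by (intro KK_ge1) auto
  \<comment> \<open>Against \<open>KK_upper\<close> this identity yields
    \<open>(?a - 1) * (?b - h - 2) <= 2 h - 1 - n\<close>, which is negative, while both factors are
    nonnegative.\<close>
  moreover have "?a * (?b - h - 1) = (?a - 1) * (?b - h - 2) + (?b - h - 2) + ?a"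
    by (simp add: algebra_simps)
  moreover have "h + 2 \<le> ?b" using KK_upper[OF d] KK_nonneg[of h d] False h3 by linarith
  then have "0 \<le> (?a - 1) * (?b - h - 2)" using a by (intro mult_nonneg_nonneg) auto
  ultimately show ?thesis using KK_upper[OF d] h3 by linarith
qed

lemma row_complement_large: "2 \<le> d \<Longrightarrow> d \<le> h \<Longrightarrow> d \<noteq> h + 2 - d \<Longrightarrow> row d = 0 \<Longrightarrow> n - h + 3 \<le> row (h + 2 - d)"
  using KK_upper[of d] KK_nonneg[of h d] by linarith

text \<open>A nonempty row 2 has at least \<open>n - h + 3 >= 2 h + 6\<close> chords, and
  \<open>skip_cycles\<close> applies.\<close>

lemma row_2: "row 2 = 0"
proof (rule ccontr)
  assume "row 2 \<noteq> 0"
  then have "n - h + 3 \<le> row 2" using row_zero_or_large[of 2] h3 by simp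
  then have "h + 2 \<le> int (num_cycles (nat (n - h)) G)"
    using h3 by (intro skip_cycles) auto
  then show False using few by simp
qed

lemma row_h: "n - h + 3 \<le> row h"
  using row_complement_large[of 2] row_2 h3 by simp

text \<open>For \<open>h = 2 k\<close> and \<open>t = k + 1\<close> both chords of a crossing pair
  have length \<open>h\<close>, and row \<open>h\<close> is nearly full.\<close>

lemma odd_h: "odd h"
proof
  assume "even h"
  then obtain k where k: "h = 2 * k" by blast
  have "both (k + 1) h (h + h + 2 - 2 * (k + 1)) \<le> int (num_cycles (nat (n - h)) G)"
    by (rule cross_row_count) (use h3 k in auto)
  moreover have "row h + row h - n \<le> both (k + 1) h (h + h + 2 - 2 * (k + 1))"
    using both_neither[of "k + 1" h h] neither_nonneg[of "k + 1" h h] k by simp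
  ultimately show False using row_h few h3 by linarith
qed

lemma row_even:
  assumes "even d" "2 \<le> d" "d \<le> h"
  shows "row d = 0"
proof (rule ccontr)
  assume r: "row d \<noteq> 0"
  have "d \<noteq> 2" using r row_2 by metis
  then have d: "4 \<le> d" "d \<le> h - 1" using assms odd_h by presburger+
  have "d \<noteq> h + 2 - d" using odd_h by presburger
  then have full: "n - h + 3 \<le> row d" using row_zero_or_large r assms by auto
  obtain k where k: "d = 2 * k" using assms(1) by blast
  \<comment> \<open>The shift \<open>t = h + 1 - k\<close> is chosen so that the partner of a chord
    of length \<open>h\<close> has length \<open>d\<close>; two nearly full rows then meet too
    often.\<close>
  have e: "h + h + 2 - 2 * (h + 1 - k) = d" using k by simp
  have "both (h + 1 - k) h (h + h + 2 - 2 * (h + 1 - k)) \<le> int (num_cycles (nat (n - h)) G)"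
    by (rule cross_row_count) (use h3 k d in auto)
  moreover have "row h + row d - n \<le> both (h + 1 - k) h (h + h + 2 - 2 * (h + 1 - k))"
    using both_neither[of "h + 1 - k" h d] neither_nonneg[of "h + 1 - k" h d] unfolding e by simp
  ultimately show False using row_h full few h3 by linarith
qed

lemma row_odd:
  assumes "odd d" "3 \<le> d" "d \<le> h"
  shows "n - h + 3 \<le> row d"
proof -
  have "row (h + 2 - d) = 0" using assms odd_h by (intro row_even) auto
  moreover have "d \<noteq> h + 2 - d" using odd_h by presburger
  ultimately show ?thesis using row_complement_large[of "h + 2 - d"] assms by simp
qed

text \<open>Crossing pairs with \<open>t = 1\<close> make \<open>row d + row (d + h)\<close> equal
  to \<open>n\<close> up to \<open>err d\<close>, with total error at most \<open>2 h - 5\<close>.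
  Starting from \<open>row 2 = 0\<close>, the rows at \<open>2, 2 + h, 2 + 2 h, ...\<close> are
  alternately nearly empty and nearly full. For odd \<open>n\<close> the reflection \<open>d\<close>
  to \<open>n - d\<close> at the end of this progression meets a short row of the wrong
  parity.\<close>

lemma even_n: "even n"
proof (rule ccontr)
  assume n: "odd n"
  define err where "err = (\<lambda>d. both 1 d (d + h) + neither 1 d (d + h))"
  have err0: "0 \<le> err d" for d
    using both_nonneg[of 1 d "d + h"] neither_nonneg[of 1 d "d + h"] unfolding err_def by linarith
  have step: "row (d + h) \<le> n - row d + err d" "n - row d - err d \<le> row (d + h)" for d
    using both_neither[of 1 d "d + h"] both_nonneg[of 1 d "d + h"] neither_nonneg[of 1 d "d + h"]
    unfolding err_def by linarith+
  have total: "(\<Sum>d\<in>{2..n - h - 2}. err d) \<le> 2 * h - 5"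
  proof -
    have "0 \<le> (\<Sum>d\<in>{2..h}. both (d + 1) d (h + 2 - d))"
      "0 \<le> (\<Sum>d\<in>{2..h}. neither (d + 1) d (h + 2 - d))"
      by (intro sum_nonneg both_nonneg neither_nonneg)+
    then have "(\<Sum>d\<in>{2..n - h - 2}. err d) \<le> DD h + ZZ h"
      unfolding DD_def ZZ_def err_def sum.distrib by linarith
    then show ?thesis using DD_ZZ_le[OF h5] Q7 few by linarith
  qed
  have part: "(\<Sum>i<j. err (2 + int i * h)) \<le> 2 * h - 5" if j: "2 + int j * h \<le> n - 2" for j
  proof -
    have inj: "inj_on (\<lambda>i. 2 + int i * h) {..<j}" using h3 by (auto simp: inj_on_def)
    have "(\<lambda>i. 2 + int i * h) ` {..<j} \<subseteq> {2..n - h - 2}"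
    proof
      fix d assume "d \<in> (\<lambda>i. 2 + int i * h) ` {..<j}"
      then obtain i where i: "i < j" "d = 2 + int i * h" by auto
      have "(int i + 1) * h \<le> int j * h" using i(1) h3 by (intro mult_right_mono) auto
      then show "d \<in> {2..n - h - 2}" using i(2) j h3 by (auto simp: algebra_simps)
    qed
    then have "(\<Sum>d\<in>(\<lambda>i. 2 + int i * h) ` {..<j}. err d) \<le> (\<Sum>d\<in>{2..n - h - 2}. err d)"
      by (intro sum_mono2) (auto simp: err0)
    then show ?thesis using total by (simp add: sum.reindex[OF inj])
  qed
  have chain: "(even j \<longrightarrow> row (2 + int j * h) \<le> (\<Sum>i<j. err (2 + int i * h))) \<and>
      (odd j \<longrightarrow> n - (\<Sum>i<j. err (2 + int i * h)) \<le> row (2 + int j * h))" for j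
  proof (induction j)
    case 0 then show ?case using row_2 by simp
  next
    case (Suc j)
    have e: "2 + int (Suc j) * h = 2 + int j * h + h" by (simp add: algebra_simps)
    have s: "(\<Sum>i<Suc j. err (2 + int i * h)) = (\<Sum>i<j. err (2 + int i * h)) + err (2 + int j * h)"
      by simp
    show ?case unfolding e s
    proof (intro conjI impI)
      assume "even (Suc j)"
      then have "n - (\<Sum>i<j. err (2 + int i * h)) \<le> row (2 + int j * h)" using Suc by simp
      then show "row (2 + int j * h + h) \<le> (\<Sum>i<j. err (2 + int i * h)) + err (2 + int j * h)"
        using step[of "2 + int j * h"] by linarith
    next
      assume "odd (Suc j)"
      then have "row (2 + int j * h) \<le> (\<Sum>i<j. err (2 + int i * h))" using Suc by simp
      then show "n - ((\<Sum>i<j. err (2 + int i * h)) + err (2 + int j * h)) \<le> row (2 + int j * h + h)"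
        using step[of "2 + int j * h"] by linarith
    qed
  qed
  \<comment> \<open>The last step of the progression not beyond \<open>n - 2\<close>, so that
    \<open>n - m\<close> lies between 2 and \<open>h + 1\<close>, where the rows are already known
    or bounded.\<close>
  define j where "j = nat ((n - 4) div h)"
  define m where "m = 2 + int j * h"
  have jm: "int j = (n - 4) div h" using h3 by (simp add: j_def pos_imp_zdiv_nonneg_iff)
  have m: "m \<le> n - 2" "n - h - 2 < m"
  proof -
    have "n - 4 = (n - 4) div h * h + (n - 4) mod h" by simp
    moreover have "0 \<le> (n - 4) mod h" "(n - 4) mod h < h" using h3 by auto
    ultimately show "m \<le> n - 2" "n - h - 2 < m" unfolding m_def jm by linarith+
  qed
  have sym: "row m = row (n - m)" using row_sym[of m] by simp
  have p: "(\<Sum>i<j. err (2 + int i * h)) \<le> 2 * h - 5" using part m(1) unfolding m_def by blast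
  show False
  proof (cases "even j")
    case True
    then have "row m \<le> 2 * h - 5" using chain[of j] p unfolding m_def by linarith
    moreover have "odd (n - m)" using n True unfolding m_def by auto
    then have "n - h + 3 \<le> row (n - m)"
      using m odd_h by (intro row_odd) (presburger+)
    ultimately show False using sym h3 by linarith
  next
    case False
    then have "n - (2 * h - 5) \<le> row m" using chain[of j] p unfolding m_def by linarith
    moreover have "even (n - m)" using n False odd_h unfolding m_def by auto
    then have "row (n - m) \<le> h + 1"
    proof (cases "n - m = h + 1")
      case True then show ?thesis using row_le_cycles[OF h5] few by simp
    next
      case F: False
      have "row (n - m) = 0" using \<open>even (n - m)\<close> m F by (intro row_even) auto
      then show ?thesis using h3 by simp
    qed
    ultimately show False using sym h3 by linarith
  qed
qed

text \<open>Since \<open>h\<close> is odd, a crossing pair with an even first chord has an odd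
  second chord. For each of the \<open>h + 1\<close> values of \<open>t\<close> the number of such
  pairs is, up to boundary terms, at least the number of even chords minus that of absent odd ones,
  namely \<open>Q / 2\<close>. Each cycle comes from at most two pairs.\<close>

lemma few_cycles_contradiction: False
proof -
  let ?Ev = "{d \<in> {1..<n}. even d}" and ?Od = "{d \<in> {1..<n}. odd d}"
  define D where "D = (\<lambda>t. {d \<in> {h + 1..n - h - 1}. even d \<and> t < d \<and> d + h + 2 - t < n})"
  define T where "T = (SIGMA t:{1..h + 1}. SIGMA d:D t. {p \<in> {0..<n}. ch p d \<and> ch (p + t) (d + h + 2 - 2 * t)})"
  have finD: "finite (D t)" for t unfolding D_def by (rule finite_subset[of _ "{h + 1..n - h - 1}"]) auto
  have finT: "finite T"
    unfolding T_def using finD by (intro finite_SigmaI finite_subset[of "{p \<in> {0..<n}. _ p}" "{0..<n}"]) auto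
  define valid where "valid = (\<lambda>t d. 1 \<le> t \<and> t \<le> h + 1 \<and> t < d \<and> d + h + 2 - t < n \<and> even d
    \<and> h + 1 \<le> d \<and> d \<le> n - h - 1)"
  have TV: "valid t d \<and> p \<in> {0..<n} \<and> ch p d \<and> ch (p + t) (d + h + 2 - 2 * t)" if "(t, d, p) \<in> T" for t d p
    using that by (auto simp: T_def D_def valid_def)
  have val: "2 \<le> d" "d \<le> n - 2" "2 \<le> d + h + 2 - 2 * t" "d + h + 2 - 2 * t \<le> n - 2"
    "odd (d + h + 2 - 2 * t)" "1 \<le> t" "t \<le> h + 1" "t < d" "d + h + 2 - t < n" "even d" if "valid t d" for t d
    using that h3 odd_h unfolding valid_def by (auto; presburger)+
  define F where "F = (\<lambda>i. case i of Inl p \<Rightarrow> one h p | Inr (t, d, p) \<Rightarrow> cross h p d t)"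
  let ?O = "{p \<in> {0..<n}. ch p (h + 1)}"
  have ne1: "cycle_edges (one h p) \<noteq> cycle_edges (cross h q d t)" if v: "valid t d" for p q d t
  proof
    note V = val[OF v]
    let ?e = "d + h + 2 - 2 * t"
    assume e: "cycle_edges (one h p) = cycle_edges (cross h q d t)"
    have "{x q, x (q + d)} = {x p, x (p + h + 1)}" "{x (q + t), x (q + t + ?e)} = {x p, x (p + h + 1)}"
      using cross_chords[OF V(6-9), of q] h3 V unfolding e[symmetric] by (intro one_mem; simp)+
    then have c: "{x q, x (q + d)} = {x (q + t), x (q + t + ?e)}" by (simp only:)
    then have "x q = x (q + t) \<or> d + ?e = n"
      using V chord_eq[OF c] by auto
    then show False using x_near[of q "q + t"] V even_n odd_h by (auto; presburger)
  qed
  \<comment> \<open>As \<open>n\<close> is even, parity tells the two chords of a cycle apart. The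
    even one gives \<open>p\<close> and \<open>d\<close> unless it is read from its other end, as
    \<open>n - d\<close>; \<open>norev\<close> excludes this.\<close>
  have count: "row (h + 1) + int (card I) \<le> int (num_cycles (nat (n - h)) G)"
    if I: "I \<subseteq> T" and norev: "\<And>t d p t' d' p'. (t, d, p) \<in> I \<Longrightarrow> (t', d', p') \<in> I \<Longrightarrow> d + d' = n \<Longrightarrow> x p \<noteq> x (p' + d')" for I
  proof -
    let ?J = "Inl ` ?O \<union> Inr ` I"
    have "card ?J \<le> num_cycles (nat (n - h)) G"
    proof (rule num_cycles_ge[OF simple, where F = F])
      fix i assume "i \<in> ?J"
      then consider p where "i = Inl p" "ch p (h + 1)" | t d p where "i = Inr (t, d, p)" "(t, d, p) \<in> T"
        using I by auto
      then show "cyc G (F i) \<and> length (F i) = nat (n - h)"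
      proof cases
        case 1 then show ?thesis using one_cyc[of h p] h3 by (simp add: F_def)
      next
        case 2
        have "cyc G (cross h p d t) \<and> length (cross h p d t) = nat (n - h)"
          using TV[OF 2(2)] val[of t d] h3 by (intro cross_cyc) auto
        then show ?thesis using 2 by (simp add: F_def)
      qed
    next
      have OO: "p = q" if "p \<in> ?O" "q \<in> ?O" and e: "cycle_edges (one h p) = cycle_edges (one h q)" for p q
      proof -
        have "set (one h p) = set (one h q)"
          using cyc_set_edges[of "one h p"] cyc_set_edges[of "one h q"] one_cyc[of h p] one_cyc[of h q] that h3 by simp
        then have "x p = x q" using bd_one[of h p p] bd_one[of h q p] h3 by auto
        then show ?thesis using x_near[of p q] that by auto
      qed
      have TT: "t = t' \<and> d = d' \<and> p = p'" if m: "(t, d, p) \<in> I" "(t', d', p') \<in> I"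
        and e: "cycle_edges (cross h p d t) = cycle_edges (cross h p' d' t')" for t d p t' d' p'
      proof -
        have v: "valid t d" "valid t' d'" "p \<in> {0..<n}" "p' \<in> {0..<n}" using TV m I by blast+
        note V = val[OF v(1)] and V' = val[OF v(2)]
        let ?e = "d + h + 2 - 2 * t" and ?e' = "d' + h + 2 - 2 * t'"
        have "{x p, x (p + d)} \<in> cycle_edges (cross h p' d' t')"
          using cross_chords(1)[OF V(6-9), of p] unfolding e .
        then consider "{x p, x (p + d)} = {x p', x (p' + d')}" | "{x p, x (p + d)} = {x (p' + t'), x (p' + t' + ?e')}"
          using cross_mem[OF V'(6-9) V(1,2)] by blast
        then have pd: "p = p'" "d = d'"
        proof (atomize(full), cases)
          case 1
          then have "x p = x p' \<and> d = d'" using chord_eq[OF 1] V V' norev[OF m] by auto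
          then show "p = p' \<and> d = d'" using x_near[of p p'] v by auto
        next
          case 2
          then have "d = ?e' \<or> d + ?e' = n" using chord_eq[OF 2] V V' by auto
          then show "p = p' \<and> d = d'" using V(10) V'(5) even_n by presburger
        qed
        have "{x (p + t), x (p + t + ?e)} \<in> cycle_edges (cross h p' d' t')"
          using cross_chords(2)[OF V(6-9), of p] unfolding e .
        then consider "{x (p + t), x (p + t + ?e)} = {x p', x (p' + d')}"
          | "{x (p + t), x (p + t + ?e)} = {x (p' + t'), x (p' + t' + ?e')}"
          using cross_mem[OF V'(6-9) V(3,4)] by blast
        then have "t = t'"
        proof cases
          case 1
          then have "?e = d' \<or> ?e + d' = n" using chord_eq[OF 1] V V' by auto
          then show ?thesis using V(5) V'(10) even_n by presburger
        next
          case 2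
          then have "x (p + t) = x (p + t') \<or> x (p + t) = x (p + (t' + ?e'))"
            using chord_eq[OF 2] V V' pd by (auto simp: add.assoc)
          then show ?thesis
            using x_near[of "p + t" "p + t'"] x_near[of "p + t" "p + (t' + ?e')"] V V' pd by auto
        qed
        then show ?thesis using pd by simp
      qed
      show "inj_on (\<lambda>i. cycle_edges (F i)) ?J"
      proof (rule inj_onI)
        fix i j assume ij: "i \<in> ?J" "j \<in> ?J" and e: "cycle_edges (F i) = cycle_edges (F j)"
        show "i = j"
        proof (cases i; cases j)
          fix p q assume "i = Inl p" "j = Inl q" then show ?thesis using OO[of p q] ij e by (auto simp: F_def)
        next
          fix p y assume a: "i = Inl p" "j = Inr y"
          obtain t d q where y: "y = (t, d, q)" by (cases y)
          then have "valid t d" using TV[of t d q] a ij(2) I by auto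
          then show ?thesis using ne1[of t d p q] a y e by (simp add: F_def)
        next
          fix y p assume a: "i = Inr y" "j = Inl p"
          obtain t d q where y: "y = (t, d, q)" by (cases y)
          then have "valid t d" using TV[of t d q] a ij(1) I by auto
          then show ?thesis using ne1[of t d p q] a y e by (simp add: F_def)
        next
          fix y y' assume a: "i = Inr y" "j = Inr y'"
          obtain t d q where y: "y = (t, d, q)" by (cases y)
          obtain t' d' q' where y': "y' = (t', d', q')" by (cases y')
          show ?thesis using TT[of t d q t' d' q'] a y y' ij e by (auto simp: F_def)
        qed
      qed
    qed
    moreover have "card ?J = card ?O + card I"
    proof -
      have "finite ?O" by (rule finite_subset[of _ "{0..<n}"]) auto
      moreover have "finite I" using I finT by (rule finite_subset)
      ultimately have "card (?O <+> I) = card ?O + card I" by (rule card_Plus)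
      then show ?thesis by (simp only: Plus_def)
    qed
    ultimately show ?thesis unfolding row_def by linarith
  qed
  \<comment> \<open>Reading a chord from its other end exchanges the conditions
    \<open>p + d < n\<close> and \<open>n <= p + d\<close>, so each class contains one orientation
    only.\<close>
  let ?I1 = "{(t, d, p) \<in> T. p + d < n}" and ?I2 = "{(t, d, p) \<in> T. n \<le> p + d}"
  have R: "p \<in> {0..<n} \<and> 0 < d \<and> d < n" if "(t, d, p) \<in> T" for t d p
    using TV[OF that] val[of t d] by auto
  have "row (h + 1) + int (card ?I1) \<le> int (num_cycles (nat (n - h)) G)"
  proof (rule count)
    fix t d p t' d' p' assume a: "(t, d, p) \<in> ?I1" "(t', d', p') \<in> ?I1" "d + d' = n"
    then have "p + d < n" "p' + d' < n" "p \<in> {0..<n}" "p' \<in> {0..<n}" "0 < d'" using R by auto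
    then show "x p \<noteq> x (p' + d')" using x_near[of p "p' + d'"] a(3) by auto
  qed auto
  moreover have "row (h + 1) + int (card ?I2) \<le> int (num_cycles (nat (n - h)) G)"
  proof (rule count)
    fix t d p t' d' p' assume a: "(t, d, p) \<in> ?I2" "(t', d', p') \<in> ?I2" "d + d' = n"
    then have "n \<le> p + d" "n \<le> p' + d'" "p \<in> {0..<n}" "p' \<in> {0..<n}" "d' < n" using R by auto
    then show "x p \<noteq> x (p' + d')"
      using x_near[of p "p' + d' - n"] periodic[of "p' + d' - n"] a(3) by auto
  qed auto
  moreover have "int (card T) = int (card ?I1) + int (card ?I2)"
  proof -
    have "finite ?I1" by (rule finite_subset[OF _ finT]) auto
    moreover have "finite ?I2" by (rule finite_subset[OF _ finT]) auto
    moreover have "?I1 \<inter> ?I2 = {}" by auto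
    ultimately have "card (?I1 \<union> ?I2) = card ?I1 + card ?I2" by (rule card_Un_disjoint)
    moreover have "?I1 \<union> ?I2 = T" by auto
    ultimately show ?thesis by (simp only: of_nat_add)
  qed
  ultimately have upper: "2 * row (h + 1) + int (card T) \<le> 2 * (h + 1)"
    using few by (smt (verit))
  define S where "S = (\<Sum>d\<in>?Ev. row d)"
  define M where "M = (\<Sum>d\<in>?Od. n - row d)"
  have finE: "finite ?Ev" and finO: "finite ?Od"
    by (rule finite_subset[of _ "{1..<n}"]; auto)+
  \<comment> \<open>There are \<open>n / 2\<close> odd lengths, so full odd rows and empty even rows
    would have total \<open>n * n / 2\<close>; \<open>S\<close> and \<open>M\<close> are the
    deviations.\<close>
  have SM: "2 * (S - M) = Q"
  proof -
    obtain m where m: "n = 2 * m" using even_n by (rule evenE)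
    have "(\<Sum>d\<in>?Ev \<union> ?Od. row d) = (\<Sum>d\<in>?Ev. row d) + (\<Sum>d\<in>?Od. row d)"
      by (rule sum.union_disjoint[OF finE finO]) auto
    moreover have "?Ev \<union> ?Od = {1..<n}" by auto
    ultimately have 1: "(\<Sum>d\<in>{1..<n}. row d) = S + (\<Sum>d\<in>?Od. row d)"
      unfolding S_def by (simp only:)
    have "?Od = (\<lambda>k. 2 * k + 1) ` {0..<m}"
    proof (intro equalityI subsetI)
      fix d assume "d \<in> ?Od"
      then have d: "odd d" "1 \<le> d" "d < 2 * m" using m by auto
      have "d = 2 * (d div 2) + 1" using d by presburger
      moreover have "d div 2 \<in> {0..<m}" using d by auto
      ultimately show "d \<in> (\<lambda>k. 2 * k + 1) ` {0..<m}" by (rule image_eqI)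
    qed (use m in auto)
    moreover have "card ((\<lambda>k. 2 * k + 1) ` {0..<m}) = card {0..<m}"
      by (rule card_image) (simp add: inj_on_def)
    ultimately have "int (card ?Od) = m" using m n3 by (simp del: atLeastLessThan_iff)
    then have "M = n * m - (\<Sum>d\<in>?Od. row d)"
      unfolding M_def sum_subtractf sum_constant by (simp only: mult.commute of_nat_eq_iff)
    moreover have "n * n = 2 * (n * m)" using m by simp
    moreover have "2 * (S - M) = 2 * (S + s) - b" if "M = a - s" "b = 2 * a" for a b s
      using that by simp
    ultimately show ?thesis unfolding Q_def 1 by blast
  qed
  have lower: "(h + 1) * (S - M) - 2 * row (h + 1) \<le> int (card T)"
  proof -
    have zero: "row d = 0" if "d \<in> ?Ev" "d \<notin> {h + 1..n - h - 1}" for d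
    proof (cases "d \<le> h")
      case True then show ?thesis using that row_even[of d] by auto
    next
      case False
      have d: "d < n" "even d" using that by auto
      then have "2 \<le> n - d" "even (n - d)" using even_n by (presburger, simp)
      moreover have "n - d \<le> h" using that False by auto
      ultimately have "row (n - d) = 0" by (intro row_even)
      then show ?thesis using row_sym[of d] by simp
    qed
    have rs: "row (n - h - 1) = row (h + 1)" using row_sym[of "h + 1"] by (simp add: algebra_simps)
    \<comment> \<open>\<open>D t\<close> loses length \<open>h + 1\<close> for
      \<open>t = h + 1\<close> and length \<open>n - h - 1\<close> for \<open>t = 1\<close>, where
      one of the kept arcs degenerates. All other missing even rows are empty by
      \<open>zero\<close>.\<close>
    have a: "S - of_bool (t = h + 1) * row (h + 1) - of_bool (t = 1) * row (h + 1) \<le> (\<Sum>d\<in>D t. row d)"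
      if t: "t \<in> {1..h + 1}" for t
    proof -
      have "S = (\<Sum>d\<in>{d \<in> {h + 1..n - h - 1}. even d}. row d)"
        unfolding S_def using zero h3
        by (intro sum.mono_neutral_right) (auto intro: finite_subset[of _ "{1..<n}"])
      also have "\<dots> \<le> (\<Sum>d\<in>D t \<union> ((if t = h + 1 then {h + 1} else {}) \<union> (if t = 1 then {n - h - 1} else {})). row d)"
      proof (rule sum_mono2)
        show "{d \<in> {h + 1..n - h - 1}. even d} \<subseteq> D t \<union> ((if t = h + 1 then {h + 1} else {}) \<union> (if t = 1 then {n - h - 1} else {}))"
          using t h3 by (auto simp: D_def)
      qed (use finD row_nonneg in auto)
      also have "\<dots> \<le> (\<Sum>d\<in>D t. row d) + (\<Sum>d\<in>(if t = h + 1 then {h + 1} else {}) \<union> (if t = 1 then {n - h - 1} else {}). row d)"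
        using sum.union_inter[OF finD[of t], of "(if t = h + 1 then {h + 1} else {}) \<union> (if t = 1 then {n - h - 1} else {})" row]
          sum_nonneg[of "D t \<inter> ((if t = h + 1 then {h + 1} else {}) \<union> (if t = 1 then {n - h - 1} else {}))" row] row_nonneg
        by auto
      finally show ?thesis using rs t h3 by auto
    qed
    \<comment> \<open>For fixed \<open>t\<close> the odd partner lengths are distinct, so each
      absent odd chord is charged at most once.\<close>
    have b: "(\<Sum>d\<in>D t. n - row (d + h + 2 - 2 * t)) \<le> M" if t: "t \<in> {1..h + 1}" for t
    proof -
      have i: "inj_on (\<lambda>d. d + h + 2 - 2 * t) (D t)" by (auto simp: inj_on_def)
      have "(\<Sum>d\<in>D t. n - row (d + h + 2 - 2 * t)) = (\<Sum>d\<in>(\<lambda>d. d + h + 2 - 2 * t) ` D t. n - row d)"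
        by (simp add: sum.reindex[OF i])
      also have "\<dots> \<le> M"
        unfolding M_def
      proof (rule sum_mono2)
        show "(\<lambda>d. d + h + 2 - 2 * t) ` D t \<subseteq> ?Od"
        proof (rule image_subsetI)
          fix d assume "d \<in> D t"
          then have "valid t d" using t by (simp add: D_def valid_def)
          from val(3-5)[OF this] show "d + h + 2 - 2 * t \<in> ?Od" by simp
        qed
      qed (use row_le finO in \<open>simp_all only: diff_ge_0_iff_ge\<close>)
      finally show ?thesis .
    qed
    have "int (card T) = (\<Sum>t\<in>{1..h + 1}. \<Sum>d\<in>D t. both t d (d + h + 2 - 2 * t))"
    proof -
      let ?X = "\<lambda>t d. {p \<in> {0..<n}. ch p d \<and> ch (p + t) (d + h + 2 - 2 * t)}"
      have finX: "finite (?X t d)" for t d by (rule finite_subset[of _ "{0..<n}"]) auto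
      have "card (SIGMA d:D t. ?X t d) = (\<Sum>d\<in>D t. card (?X t d))" for t
        using finD finX by (intro card_SigmaI) blast+
      moreover have "card T = (\<Sum>t\<in>{1..h + 1}. card (SIGMA d:D t. ?X t d))"
        unfolding T_def using finD finX by (intro card_SigmaI) blast+
      ultimately show ?thesis unfolding both_def by (simp only: of_nat_sum)
    qed
    also have "\<dots> \<ge> (\<Sum>t\<in>{1..h + 1}. (S - M) - of_bool (t = h + 1) * row (h + 1) - of_bool (t = 1) * row (h + 1))"
    proof (rule sum_mono)
      fix t assume t: "t \<in> {1..h + 1}"
      have "(\<Sum>d\<in>D t. row d - (n - row (d + h + 2 - 2 * t))) \<le> (\<Sum>d\<in>D t. both t d (d + h + 2 - 2 * t))"
      proof (rule sum_mono)
        fix d show "row d - (n - row (d + h + 2 - 2 * t)) \<le> both t d (d + h + 2 - 2 * t)"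
          using both_neither[of t d "d + h + 2 - 2 * t"] neither_nonneg[of t d "d + h + 2 - 2 * t"] by linarith
      qed
      then show "(S - M) - of_bool (t = h + 1) * row (h + 1) - of_bool (t = 1) * row (h + 1)
          \<le> (\<Sum>d\<in>D t. both t d (d + h + 2 - 2 * t))"
        using a[OF t] b[OF t] unfolding sum_subtractf by linarith
    qed
    also have "(\<Sum>t\<in>{1..h + 1}. (S - M) - of_bool (t = h + 1) * row (h + 1) - of_bool (t = 1) * row (h + 1))
        = (h + 1) * (S - M) - 2 * row (h + 1)"
    proof -
      have "(\<Sum>t\<in>{1..h + 1}. of_bool (t = h + 1) * row (h + 1)) = row (h + 1)"
        "(\<Sum>t\<in>{1..h + 1}. of_bool (t = 1) * row (h + 1)) = row (h + 1)"
        using h3 by (simp_all add: of_bool_def if_distrib[of "\<lambda>u. u * _"] sum.delta cong: if_cong)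
      then show ?thesis using h3 unfolding sum_subtractf by (simp add: right_diff_distrib)
    qed
    finally show ?thesis .
  qed
  \<comment> \<open>The bounds combine to \<open>7 (h + 1) / 2 <= (h + 1) (S - M) <= card T + 2 row
    (h + 1) <= 2 (h + 1)\<close>.\<close>
  have "(h + 1) * 7 \<le> (h + 1) * (2 * (S - M))" using SM Q7 h3 by (intro mult_left_mono) auto
  then have "(h + 1) * 7 \<le> 2 * ((h + 1) * (S - M))" by (simp only: mult.left_commute)
  moreover have False if "(h + 1) * 7 \<le> 2 * X" "X - 2 * row (h + 1) \<le> int (card T)" for X
    using that upper h3 by (smt (verit))
  ultimately show False using lower by blast
qed

end

subsection \<open>A second Hamilton cycle\<close>

lemma even_card_involution:
  assumes "finite S" "\<And>x. x \<in> S \<Longrightarrow> f x \<in> S" "\<And>x. x \<in> S \<Longrightarrow> f (f x) = x" "\<And>x. x \<in> S \<Longrightarrow> f x \<noteq> x"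
  shows "even (card S)"
  using assms
proof (induction "card S" arbitrary: S rule: less_induct)
  case less
  show ?case
  proof (cases "S = {}")
    case False
    then obtain a where a: "a \<in> S" by blast
    let ?T = "S - {a, f a}"
    have sub: "{a, f a} \<subseteq> S" using a less.prems(2) by blast
    have "card {a, f a} = 2" using less.prems(4)[OF a] by auto
    then have c: "card S = card ?T + 2"
      using sub less.prems(1) card_Diff_subset[of "{a, f a}" S] card_mono[OF less.prems(1) sub] by simp
    have "even (card ?T)"
    proof (rule less.hyps)
      show "card ?T < card S" using c by simp
      show "finite ?T" using less.prems(1) by simp
      fix y assume y: "y \<in> ?T"
      then have yS: "y \<in> S" by blast
      show "f (f y) = y" "f y \<noteq> y" using less.prems(3,4) yS by blast+
      have "f y \<noteq> a" using less.prems(3)[OF yS] y by auto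
      moreover have "f y \<noteq> f a" using less.prems(3)[OF yS] less.prems(3)[OF a] y by auto
      ultimately show "f y \<in> ?T" using less.prems(2)[OF yS] by blast
    qed
    then show ?thesis using c by simp
  qed simp
qed

text \<open>Thomason's lollipop argument: rotating the end of Hamilton paths that start with a fixed edge
  is an involution on pairs of such a path and a chord at its last vertex. If every vertex has
  exactly two neighbours besides its predecessor on the path, the paths whose last vertex is
  adjacent to the first one, that is the Hamilton cycles through the fixed edge, are even in number.\<close>

lemma lollipop:
  fixes E :: "'a set set" and V :: "'a set"
  assumes fin: "finite V" and cubic: "\<And>v. v \<in> V \<Longrightarrow> card {w \<in> V. {v, w} \<in> E} = 3"
    and loop: "\<And>v. {v} \<notin> E" and ab: "a \<in> V" "b \<in> V" "a \<noteq> b"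
  defines "P \<equiv> {xs. distinct xs \<and> set xs = V \<and> 3 \<le> length xs \<and> path_edges xs \<subseteq> E \<and> xs ! 0 = a \<and> xs ! 1 = b}"
  shows "even (card {xs \<in> P. {last xs, a} \<in> E})"
proof -
  \<comment> \<open>Excluding \<open>w = a\<close> protects the first edge under rotation. An end
    vertex has two admissible chords, or one if it is adjacent to \<open>a\<close>; so
    \<open>S\<close> has the same parity as the number sought.\<close>
  define S where "S = (SIGMA xs:P. {w \<in> V. {last xs, w} \<in> E \<and> w \<noteq> last (butlast xs) \<and> w \<noteq> a})"
  define pos where "pos = (\<lambda>xs w. LEAST k. xs ! k = (w :: 'a))"
  \<comment> \<open>The chord at the end replaces the path edge leaving \<open>w\<close>, and
    everything after \<open>w\<close> is reversed. Keeping \<open>w\<close> in the pair makes the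
    move its own inverse.\<close>
  define rot where "rot = (\<lambda>(xs, w). (take (Suc (pos xs w)) xs @ rev (drop (Suc (pos xs w)) xs), w :: 'a))"
  have finP: "finite P"
  proof -
    have "P \<subseteq> {xs. set xs \<subseteq> V \<and> length xs \<le> card V}"
      by (auto simp: P_def distinct_card[symmetric])
    then show ?thesis using finite_lists_length_le[OF fin] finite_subset by blast
  qed
  have finS: "finite S" unfolding S_def using finP fin by auto
  have key: "rot (xs, w) \<in> S \<and> rot (rot (xs, w)) = (xs, w) \<and> rot (xs, w) \<noteq> (xs, w)" if m: "(xs, w) \<in> S" for xs w
  proof -
    have xs: "distinct xs" "set xs = V" "3 \<le> length xs" "path_edges xs \<subseteq> E" "xs ! 0 = a" "xs ! 1 = b"
      and w: "w \<in> V" "{last xs, w} \<in> E" "w \<noteq> last (butlast xs)" "w \<noteq> a"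
      using m by (auto simp: S_def P_def)
    obtain k where k: "k < length xs" "xs ! k = w" using w(1) xs(2) by (metis in_set_conv_nth)
    have pos: "pos ys w = j" if "distinct ys" "j < length ys" "ys ! j = w" for ys j
      unfolding pos_def
    proof (rule Least_equality)
      fix i assume i: "ys ! i = w"
      show "j \<le> i"
      proof (rule ccontr)
        assume "\<not> j \<le> i"
        then show False using i that nth_eq_iff_index_eq[of ys i j] by auto
      qed
    qed (rule that)
    have l: "last xs = xs ! (length xs - 1)" using xs(3) by (intro last_conv_nth) auto
    have l2: "last (butlast xs) = xs ! (length xs - 2)"
    proof -
      have "butlast xs \<noteq> []" using xs(3) by (cases xs rule: rev_cases) auto
      then have "last (butlast xs) = butlast xs ! (length xs - 2)"
        by (simp add: last_conv_nth numeral_2_eq_2)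
      then show ?thesis using xs(3) by (simp add: nth_butlast)
    qed
    have k0: "0 < k" using k w xs by (cases k) auto
    have k1: "k \<noteq> length xs - 1" using w(2) loop[of w] k l by auto
    have k2: "k \<noteq> length xs - 2" using w(3) k l2 by auto
    define A where "A = take (Suc k) xs"
    define B where "B = drop (Suc k) xs"
    have AB: "xs = A @ B" by (simp add: A_def B_def)
    have lA: "length A = Suc k" using k by (simp add: A_def)
    have lB: "2 \<le> length B" using k k1 k2 xs(3) by (simp add: B_def)
    have ne: "A \<noteq> []" "B \<noteq> []" using lA lB by auto
    have lastA: "last A = w" using k by (simp add: A_def last_conv_nth take_Suc_conv_app_nth)
    let ?ys = "A @ rev B"
    have r: "rot (xs, w) = (?ys, w)"
      using pos[OF xs(1) k] by (simp add: rot_def A_def B_def)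
    have dys: "distinct ?ys" using xs(1) AB by auto
    have wy: "k < length ?ys" "?ys ! k = w"
      using lA lastA ne by (simp_all add: nth_append last_conv_nth)
    have r2: "rot (?ys, w) = (xs, w)"
      using pos[OF dys wy] lA by (simp add: rot_def AB)
    have "B \<noteq> rev B"
    proof
      assume "B = rev B"
      then have "hd B = last B" using ne(2) by (metis hd_rev)
      moreover have "hd B = B ! 0" "last B = B ! (length B - 1)" using ne(2) by (simp_all add: hd_conv_nth last_conv_nth)
      moreover have "distinct B" using xs(1) AB by auto
      ultimately have "B ! 0 = B ! (length B - 1)" "distinct B" by simp_all
      moreover have "0 < length B" "length B - 1 < length B" using lB by auto
      ultimately have "0 = length B - 1" by (simp only: nth_eq_iff_index_eq)
      then show False using lB by linarith
    qed
    then have ne_xs: "?ys \<noteq> xs" using AB by auto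
    have pe: "path_edges xs = insert {w, hd B} (path_edges A \<union> path_edges B)"
      unfolding AB using ne lastA by (simp add: path_edges_append)
    have pe': "path_edges ?ys = insert {w, last B} (path_edges A \<union> path_edges B)"
      using ne lastA by (simp add: path_edges_append hd_rev)
    have lx: "last xs = last B" using AB ne by simp
    have yP: "?ys \<in> P"
    proof -
      have "path_edges ?ys \<subseteq> E" using pe pe' xs(4) w(2) lx by (auto simp: insert_commute)
      moreover have "?ys ! 0 = a" "?ys ! 1 = b"
        using xs(5,6) lA k0 AB by (auto simp: nth_append)
      moreover have "set ?ys = V" "3 \<le> length ?ys" using xs(2,3) AB by auto
      ultimately show ?thesis using dys by (simp add: P_def)
    qed
    have "{last ?ys, w} \<in> E" using pe xs(4) ne by (auto simp: last_rev insert_commute)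
    moreover have "w \<noteq> last (butlast ?ys)"
    proof -
      obtain b1 b2 B' where B: "B = b1 # b2 # B'" using lB by (cases B; cases "tl B") auto
      then have "last (butlast ?ys) = b2" by (simp add: butlast_append)
      then show ?thesis using xs(1) AB B lastA ne(1) by (auto dest: last_in_set)
    qed
    ultimately have "(?ys, w) \<in> S" using yP w by (simp add: S_def)
    then show ?thesis using r r2 ne_xs by simp
  qed
  have even: "even (card S)"
    using finS by (rule even_card_involution[where f = rot]) (use key in auto)
  have "card S = (\<Sum>xs\<in>P. card {w \<in> V. {last xs, w} \<in> E \<and> w \<noteq> last (butlast xs) \<and> w \<noteq> a})"
    unfolding S_def using finP fin by simp
  also have "\<dots> = (\<Sum>xs\<in>P. 2 - of_bool ({last xs, a} \<in> E))"
  proof (rule sum.cong[OF refl])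
    fix xs assume "xs \<in> P"
    then have xs: "distinct xs" "set xs = V" "3 \<le> length xs" "path_edges xs \<subseteq> E" "xs ! 0 = a" by (auto simp: P_def)
    obtain ys y z where ys1: "xs = ys @ [y, z]"
      using xs(3) by (cases xs rule: rev_cases; cases "butlast xs" rule: rev_cases) auto
    moreover have "ys \<noteq> []" using ys1 xs(3) by (cases ys) auto
    ultimately have ys: "xs = ys @ [y, z]" "ys \<noteq> []" by blast+
    have lz: "last xs = z" "last (butlast xs) = y" using ys by (simp_all add: butlast_append)
    have "{y, z} \<in> E" using xs(4) ys by (auto simp: path_edges_append)
    have za: "z \<in> V" "y \<in> V" "y \<noteq> a" using xs(1,2,5) ys by (auto simp: nth_append hd_conv_nth)
    let ?N = "{w \<in> V. {z, w} \<in> E}"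
    have N: "card ?N = 3" "finite ?N" "y \<in> ?N" using cubic[OF za(1)] fin za \<open>{y, z} \<in> E\<close> by (auto simp: insert_commute)
    have "{w \<in> V. {z, w} \<in> E \<and> w \<noteq> y \<and> w \<noteq> a} = ?N - {y} - {a}" by auto
    moreover have "card (?N - {y}) = 2" using N by simp
    moreover have "a \<in> ?N - {y} \<longleftrightarrow> {z, a} \<in> E" using ab za by auto
    ultimately show "card {w \<in> V. {last xs, w} \<in> E \<and> w \<noteq> last (butlast xs) \<and> w \<noteq> a} = 2 - of_bool ({last xs, a} \<in> E)"
      unfolding lz by (simp add: card_Diff_singleton_if)
  qed
  finally have cS: "card S = (\<Sum>xs\<in>P. 2 - of_bool ({last xs, a} \<in> E))" .
  have "card {xs \<in> P. {last xs, a} \<in> E} = (\<Sum>xs\<in>P. of_bool ({last xs, a} \<in> E))"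
    using finP by (simp add: sum_of_bool_eq Int_def)
  then have "card S + card {xs \<in> P. {last xs, a} \<in> E} =
      (\<Sum>xs\<in>P. (2 - of_bool ({last xs, a} \<in> E)) + of_bool ({last xs, a} \<in> E))"
    using cS by (simp only: sum.distrib)
  also have "\<dots> = (\<Sum>xs\<in>P. 2)" by (rule sum.cong) auto
  finally have "even (card S + card {xs \<in> P. {last xs, a} \<in> E})" by simp
  then show ?thesis using even by simp
qed

context gcyc
begin

text \<open>With \<open>h = 0\<close> and \<open>t = 1\<close> a crossing pair omits no vertex, so
  it would close a second cycle of full length.\<close>

lemma rows_independent:
  assumes "num_cycles (nat n) G \<le> 1" "2 \<le> d" "d \<le> n - 2" "ch p d"
  shows "\<not> ch (p + 1) d"
proof
  assume c: "ch (p + 1) d"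
  let ?H = "map x [1..n]"
  have "x n = x 0" using periodic[of 0] by simp
  then have eH: "cycle_edges ?H = hm ` {0..<n}"
  proof -
    assume x0: "x n = x 0"
    have "cycle_edges ?H = insert (hm 0) (hm ` {1..<n})"
      unfolding cycle_edges_def using n3 x0 by (simp add: path_edges_int hd_upto last_upto)
    also have "\<dots> = hm ` (insert 0 {1..<n})" by (simp only: image_insert)
    also have "insert 0 {1..<n} = {0..<n}" using n3 by auto
    finally show ?thesis .
  qed
  have "distinct ?H" by (rule distinct_map_x[of _ 1]) auto
  then have H: "cyc G ?H" "length ?H = nat n"
    using n3 ham_edge unfolding cyc_def eH by auto
  have C: "cyc G (cross 0 p d 1)" "length (cross 0 p d 1) = nat n"
    using cross_cyc[of 0 1 d p] assms c n3 by auto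
  have ne: "cycle_edges ?H \<noteq> cycle_edges (cross 0 p d 1)"
  proof -
    have "{x p, x (p + d)} \<notin> hm ` {0..<n}" using chord_not_hm[OF assms(2,3), of p] by blast
    moreover have "{x p, x (p + d)} \<in> cycle_edges (cross 0 p d 1)"
      using assms by (intro cross_chords) auto
    ultimately show ?thesis unfolding eH by metis
  qed
  have "card (UNIV :: bool set) \<le> num_cycles (nat n) G"
    by (rule num_cycles_ge[OF simple, where F = "\<lambda>b. if b then ?H else cross 0 p d 1"])
      (use H C ne in \<open>auto simp: inj_on_def\<close>)
  then show False using assms(1) by simp
qed

lemma row_half:
  assumes "num_cycles (nat n) G \<le> 1" "2 \<le> d" "d \<le> n - 2"
  shows "2 * row d \<le> n"
proof -
  have "2 * row d = (\<Sum>p\<in>{0..<n}. of_bool (ch (p + 0) d) + of_bool (ch (p + 1) d))"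
    unfolding sum.distrib row_sum by simp
  also have "\<dots> \<le> (\<Sum>p\<in>{0..<n}. 1)"
    by (rule sum_mono) (use rows_independent[OF assms] in auto)
  also have "\<dots> = n" using n3 by simp
  finally show ?thesis .
qed

text \<open>Equality in the average behind \<open>row_half\<close> forces exactly one chord in each
  consecutive pair.\<close>

lemma row_alternating:
  assumes "num_cycles (nat n) G \<le> 1" "2 \<le> d" "d \<le> n - 2" "2 * row d = n"
  shows "ch (p + 1) d \<longleftrightarrow> \<not> ch p d"
proof -
  have s: "(\<Sum>p\<in>{0..<n}. 1 - (of_bool (ch (p + 0) d) + of_bool (ch (p + 1) d)) :: int) = 0"
    unfolding sum_subtractf sum.distrib row_sum using assms(4) n3 by simp
  have nn: "0 \<le> 1 - (of_bool (ch (q + 0) d) + of_bool (ch (q + 1) d) :: int)" for q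
    using rows_independent[OF assms(1-3), of q] by auto
  have z: "\<forall>q\<in>{0..<n}. 1 - (of_bool (ch (q + 0) d) + of_bool (ch (q + 1) d) :: int) = 0"
    using s nn by (subst (asm) sum_nonneg_eq_0_iff) auto
  obtain q where q: "q \<in> {0..<0 + n}" "x p = x q" using window by blast
  then have "1 - (of_bool (ch (q + 0) d) + of_bool (ch (q + 1) d) :: int) = 0" using z by simp
  moreover have "ch q d \<longleftrightarrow> ch p d" "ch (q + 1) d \<longleftrightarrow> ch (p + 1) d"
    using q(2) x_shift[OF q(2), of d] x_shift[OF q(2), of 1] x_shift[OF q(2), of "1 + d"]
    by (simp_all add: add.assoc)
  ultimately show ?thesis by (auto split: if_splits)
qed

text \<open>An alternating row of odd length is a perfect matching: \<open>x i\<close> starts a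
  chord or ends the one starting at position \<open>i - d\<close>. Adding it to the cycle gives a
  cubic graph, and the even number from \<open>lollipop\<close> includes the given cycle.\<close>

lemma two_ham_cycles_matching:
  assumes n: "even n" and d: "odd d" "3 \<le> d" "d \<le> n - 3"
    and alt: "\<And>p. ch (p + 1) d \<longleftrightarrow> \<not> ch p d"
  shows "2 \<le> num_cycles (nat n) G"
proof -
  have alt2: "ch (p + k) d \<longleftrightarrow> (if even k then ch p d else \<not> ch p d)" for p k
  proof (induction k rule: int_induct[where k = 0])
    case (step1 k) then show ?case using alt[of "p + k"] by (simp add: add.assoc)
  next
    case (step2 k)
    have "even (k - 1) \<longleftrightarrow> odd k" by presburger
    then show ?case using alt[of "p + (k - 1)"] step2 by (auto simp: add.assoc split: if_splits)
  qed simp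
  define E where "E = range hm \<union> {{x p, x (p + d)} | p. ch p d}"
  let ?V = "range x"
  have EG: "E \<subseteq> edges G" using ham_edge by (auto simp: E_def adj_def)
  have nb: "card {w \<in> ?V. {v, w} \<in> E} = 3" if vV: "v \<in> ?V" for v
  proof -
    obtain i where v: "v = x i" using vV by blast
    define m where "m = (if ch i d then i + d else i - d)"
    have "{w \<in> ?V. {v, w} \<in> E} = {x (i + 1), x (i - 1), x m}"
    proof (intro equalityI subsetI)
      fix w assume "w \<in> {w \<in> ?V. {v, w} \<in> E}"
      then consider j where "{x i, w} = hm j" | j where "{x i, w} = {x j, x (j + d)}" "ch j d"
        unfolding E_def v by blast
      then show "w \<in> {x (i + 1), x (i - 1), x m}"
      proof cases
        case 1
        then consider "x i = x j" "w = x (j + 1)" | "x i = x (j + 1)" "w = x j" by (auto simp: doubleton_eq_iff)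
        then show ?thesis
        proof cases
          case 1 then show ?thesis using x_shift[of i j 1] by simp
        next
          case 2 then show ?thesis using x_shift[of i "j + 1" "-1"] by simp
        qed
      next
        case 2
        then consider "x i = x j" "w = x (j + d)" | "x i = x (j + d)" "w = x j" by (auto simp: doubleton_eq_iff)
        then show ?thesis
        proof cases
          case 1
          then have "w = x (i + d)" using x_shift[of i j d] by simp
          moreover have "ch i d" using 2(2) 1 x_shift[of i j d] by simp
          ultimately show ?thesis by (simp add: m_def)
        next
          case b: 2
          then have w: "x (i - d) = x j" "w = x (i - d)" using x_shift[of i "j + d" "-d"] by simp_all
          have "ch (j + d) d \<longleftrightarrow> \<not> ch j d" using alt2[of j d] d(1) by simp
          then have "\<not> ch i d" using 2(2) b(1) x_shift[OF b(1), of d] by simp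
          then show ?thesis using w by (simp add: m_def)
        qed
      qed
    next
      fix w assume "w \<in> {x (i + 1), x (i - 1), x m}"
      moreover have "{v, x (i + 1)} \<in> E" unfolding E_def v by blast
      moreover have "{v, x (i - 1)} = hm (i - 1)" unfolding v by auto
      then have "{v, x (i - 1)} \<in> E" unfolding E_def by blast
      moreover have "{v, x m} \<in> E"
      proof (cases "ch i d")
        case True then show ?thesis unfolding E_def v m_def by auto
      next
        case False
        then have "ch (i - d) d" using alt2[of "i - d" d] d(1) by simp
        moreover have "{v, x m} = {x (i - d), x (i - d + d)}" using False unfolding v m_def by auto
        ultimately show ?thesis unfolding E_def by blast
      qed
      ultimately show "w \<in> {w \<in> ?V. {v, w} \<in> E}" unfolding m_def by auto
    qed
    moreover have "x (i + 1) \<noteq> x (i - 1)" using x_near[of "i + 1" "i - 1"] d by auto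
    moreover have "x (i + 1) \<noteq> x m" "x (i - 1) \<noteq> x m"
      using x_near[of "i + 1" "i + d"] x_near[of "i - 1" "i + d"] x_near[of "i + 1" "i - d"] x_near[of "i - 1" "i - d"] d
      unfolding m_def by auto
    ultimately show ?thesis by (auto simp: card_insert_if)
  qed
  have loop: "{v} \<notin> E" for v
    using EG simple by (auto simp: finite_simple_graph_def dest!: subsetD)
  define P where "P = {xs. distinct xs \<and> set xs = ?V \<and> 3 \<le> length xs \<and> path_edges xs \<subseteq> E \<and> xs ! 0 = x 0 \<and> xs ! 1 = x 1}"
  have ne01: "x 0 \<noteq> x 1" using x_near[of 0 1] n3 by auto
  let ?C = "{xs \<in> P. {last xs, x 0} \<in> E}"
  have ev: "even (card ?C)"
    unfolding P_def by (rule lollipop[OF finite_range nb loop]) (use ne01 in auto)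
  have finC: "finite ?C"
  proof -
    have "?C \<subseteq> {xs. set xs \<subseteq> ?V \<and> length xs \<le> card ?V}"
      by (auto simp: P_def distinct_card[symmetric])
    then show ?thesis using finite_lists_length_le[OF finite_range] finite_subset by blast
  qed
  have "map x [0..n - 1] \<in> ?C"
  proof -
    have "set (map x [0..n - 1]) = ?V"
      unfolding range_window[of 0] by (simp add: atLeastLessThanPlusOne_atLeastAtMost_int[symmetric])
    moreover have "distinct (map x [0..n - 1])" by (rule distinct_map_x[of _ 0]) auto
    moreover have "path_edges (map x [0..n - 1]) \<subseteq> E" unfolding path_edges_int E_def by blast
    moreover have "{last (map x [0..n - 1]), x 0} = hm (n - 1)"
      using n3 periodic[of 0] by (simp add: last_upto)
    then have "{last (map x [0..n - 1]), x 0} \<in> E" unfolding E_def by blast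
    moreover have "map x [0..n - 1] ! 0 = x 0" "map x [0..n - 1] ! 1 = x 1" "3 \<le> length (map x [0..n - 1])"
      using n3 by simp_all
    ultimately show ?thesis by (simp add: P_def)
  qed
  then have "card ?C \<noteq> 0" using finC by auto
  then have "2 \<le> card ?C" using ev by presburger
  also have "card ?C \<le> num_cycles (nat n) G"
  proof (rule num_cycles_ge[OF simple, where F = "\<lambda>xs. xs"])
    fix xs assume "xs \<in> ?C"
    then have xs: "distinct xs" "set xs = ?V" "3 \<le> length xs" "path_edges xs \<subseteq> E" "xs ! 0 = x 0" "{last xs, x 0} \<in> E"
      by (auto simp: P_def)
    then have "hd xs = x 0" by (cases xs) auto
    then have "cyc G xs" using xs EG by (auto simp: cyc_def cycle_edges_def)
    moreover have "length xs = nat n" using distinct_card[OF xs(1)] xs(2) card_range by simp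
    ultimately show "cyc G xs \<and> length xs = nat n" by simp
  next
    show "inj_on cycle_edges ?C"
    proof (rule inj_onI)
      fix xs ys assume xy: "xs \<in> ?C" "ys \<in> ?C" and e: "cycle_edges xs = cycle_edges ys"
      have "length xs = length ys"
        using xy distinct_card[of xs] distinct_card[of ys] unfolding P_def by simp
      then show "xs = ys" using xy e by (intro cycle_edges_unique) (auto simp: P_def)
    qed
  qed
  finally show ?thesis .
qed

text \<open>\<open>row_half\<close> alone allows \<open>Q\<close> up to \<open>n\<close>. For odd
  \<open>n\<close> integrality lowers this to 3; for even \<open>n\<close> the matching argument
  excludes equality at every odd length and lowers it to 4.\<close>

theorem two_ham_cycles:
  assumes Q: "7 \<le> Q" and n6: "6 \<le> n"
  shows "2 \<le> num_cycles (nat n) G"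
proof (rule ccontr)
  assume "\<not> 2 \<le> num_cycles (nat n) G"
  then have one: "num_cycles (nat n) G \<le> 1" by simp
  have S: "(\<Sum>d\<in>{1..<n}. row d) = 2 * n + (\<Sum>d\<in>{2..n - 2}. row d)"
  proof -
    have "{1..<n} = insert 1 (insert (n - 1) {2..n - 2})" using n6 by auto
    then show ?thesis using n6 row_1 row_sym[of 1] by simp
  qed
  show False
  proof (cases "even n")
    case False
    have "(\<Sum>d\<in>{2..n - 2}. 2 * row d) \<le> (\<Sum>d\<in>{2..n - 2}. n - 1)"
    proof (rule sum_mono)
      fix d assume "d \<in> {2..n - 2}"
      then have "2 * row d \<le> n" using row_half[OF one, of d] by simp
      then show "2 * row d \<le> n - 1" using False by presburger
    qed
    also have "\<dots> = (n - 3) * (n - 1)" using n6 by simp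
    finally have "2 * (\<Sum>d\<in>{2..n - 2}. row d) \<le> (n - 3) * (n - 1)"
      by (simp only: sum_distrib_left)
    also have "\<dots> = n * n - 4 * n + 3" by (simp add: algebra_simps)
    finally have "2 * (\<Sum>d\<in>{2..n - 2}. row d) \<le> n * n - 4 * n + 3" .
    then show False using S Q unfolding Q_def by linarith
  next
    case True
    have no: "2 * row d \<le> n - 2" if d: "odd d" "3 \<le> d" "d \<le> n - 3" for d
    proof (rule ccontr)
      assume "\<not> 2 * row d \<le> n - 2"
      then have "2 * row d = n" using row_half[OF one, of d] d True by presburger
      then have "2 \<le> num_cycles (nat n) G"
        using d row_alternating[OF one] by (intro two_ham_cycles_matching[OF True d]) auto
      then show False using one by simp
    qed
    have "(\<Sum>d\<in>{2..n - 2}. 2 * row d) \<le> (\<Sum>d\<in>{2..n - 2}. n - 2 * of_bool (odd d))"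
    proof (rule sum_mono)
      fix d assume d: "d \<in> {2..n - 2}"
      show "2 * row d \<le> n - 2 * of_bool (odd d)"
      proof (cases "odd d")
        case o: True
        then have "3 \<le> d \<and> d \<le> n - 3" using d True by (simp; presburger)
        then show ?thesis using no[OF o] o by simp
      next
        case False then show ?thesis using row_half[OF one, of d] d by simp
      qed
    qed
    also have "\<dots> = (n - 3) * n - 2 * int (card {d \<in> {2..n - 2}. odd d})"
      unfolding sum_subtractf using n6
      by (simp only: sum_distrib_left[symmetric] card_of_bool[OF finite_atLeastAtMost_int]) simp
    also have "int (card {d \<in> {2..n - 2}. odd d}) = n div 2 - 2"
    proof -
      obtain m where m: "n = 2 * m" using True by (rule evenE)
      have "{d \<in> {2..n - 2}. odd d} = (\<lambda>k. 2 * k + 1) ` {1..<m - 1}"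
      proof (intro equalityI subsetI)
        fix d assume "d \<in> {d \<in> {2..n - 2}. odd d}"
        then have d: "odd d" "2 \<le> d" "d \<le> 2 * m - 2" using m by auto
        have "d = 2 * (d div 2) + 1" using d by presburger
        moreover have "d div 2 \<in> {1..<m - 1}" using d by (simp; presburger)
        ultimately show "d \<in> (\<lambda>k. 2 * k + 1) ` {1..<m - 1}" by (rule image_eqI)
      qed (use m in auto)
      moreover have "card ((\<lambda>k. 2 * k + 1) ` {1..<m - 1}) = card {1..<m - 1}"
        by (rule card_image) (simp add: inj_on_def)
      ultimately show ?thesis using m n6 by (simp del: atLeastLessThan_iff atLeastAtMost_iff)
    qed
    finally have "2 * (\<Sum>d\<in>{2..n - 2}. row d) \<le> (n - 3) * n - 2 * (n div 2 - 2)"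
      by (simp only: sum_distrib_left)
    also have "2 * (n div 2 - 2) = n - 4" using True by (simp add: algebra_simps)
    also have "(n - 3) * n - (n - 4) = n * n - 4 * n + 4" by (simp add: algebra_simps)
    finally have "2 * (\<Sum>d\<in>{2..n - 2}. row d) \<le> n * n - 4 * n + 4" .
    then show False using S Q unfolding Q_def by linarith
  qed
qed

end

subsection \<open>Triangles\<close>

definition triangles :: "'a ugraph \<Rightarrow> 'a set set" where
  "triangles G = {T. \<exists>a b c. T = {a, b, c} \<and> adj G a b \<and> adj G b c \<and> adj G a c}"

definition codeg :: "'a ugraph \<Rightarrow> 'a \<Rightarrow> 'a \<Rightarrow> nat" where
  "codeg G u v = card (nbrs G u \<inter> nbrs G v)"

lemma adj_neq: "finite_simple_graph G \<Longrightarrow> adj G a b \<Longrightarrow> a \<noteq> b"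
  using adj_irrefl by metis

lemma triangles_finite: "finite_simple_graph G \<Longrightarrow> finite (triangles G)"
proof (rule finite_subset)
  assume "finite_simple_graph G"
  then show "triangles G \<subseteq> Pow (verts G)" "finite (Pow (verts G))"
    using adj_verts[of G] verts_finite[of G] by (auto simp: triangles_def)
qed

lemma triangle_through:
  assumes "T \<in> triangles G" "v \<in> T"
  shows "\<exists>a b. T = {v, a, b} \<and> adj G v a \<and> adj G v b \<and> adj G a b"
proof -
  obtain a b c where T: "T = {a, b, c}" "adj G a b" "adj G b c" "adj G a c"
    using assms(1) by (auto simp: triangles_def)
  consider "v = a" | "v = b" | "v = c" using assms(2) T(1) by auto
  then show ?thesis
  proof cases
    case 1 then show ?thesis using T by blast
  next
    case 2
    have "T = {b, a, c}" using T(1) by auto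
    then show ?thesis using T 2 adj_sym[of G a b] by blast
  next
    case 3
    have "T = {c, a, b}" using T(1) by auto
    then show ?thesis using T 3 adj_sym[of G a c] adj_sym[of G b c] by blast
  qed
qed

lemma num_cycles_triangles:
  assumes G: "finite_simple_graph G"
  shows "card (triangles G) \<le> num_cycles 3 G"
proof -
  define F where "F T = (SOME xs. cyc G xs \<and> length xs = 3 \<and> set xs = T)" for T
  have F: "cyc G (F T) \<and> length (F T) = 3 \<and> set (F T) = T" if T: "T \<in> triangles G" for T
  proof -
    obtain a b c where "T = {a, b, c}" "adj G a b" "adj G b c" "adj G a c"
      using T by (auto simp: triangles_def)
    then have "cyc G [a, b, c] \<and> length [a, b, c] = 3 \<and> set [a, b, c] = T"
      using adj_neq[OF G, of a b] adj_neq[OF G, of b c] adj_neq[OF G, of a c]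
      by (auto simp: cyc_def cycle_edges_def adj_def insert_commute)
    then show ?thesis unfolding F_def by (rule someI)
  qed
  show ?thesis
  proof (rule num_cycles_ge[OF G, where F = F])
    show "inj_on (\<lambda>T. cycle_edges (F T)) (triangles G)"
    proof (rule inj_onI)
      fix S T assume a: "S \<in> triangles G" "T \<in> triangles G" "cycle_edges (F S) = cycle_edges (F T)"
      have "set xs = \<Union> (cycle_edges xs)" if "cyc G xs" for xs
        using that set_cycle_edges[of xs] by (simp add: cyc_def)
      then have "set (F S) = set (F T)" using F a by metis
      then show "S = T" using F a by metis
    qed
  qed (use F in blast)
qed

lemma card_fibers:
  assumes "finite A" "finite B" "f ` A \<subseteq> B" "\<And>y. y \<in> B \<Longrightarrow> card {x \<in> A. f x = y} \<le> k"
  shows "card A \<le> k * card B"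
proof -
  have "card A = (\<Sum>y\<in>B. card {x \<in> A. f x = y})"
    using sum.group[OF assms(1-3), of "\<lambda>_. 1 :: nat"] by simp
  also have "\<dots> \<le> (\<Sum>y\<in>B. k)" by (rule sum_mono) (use assms(4) in auto)
  finally show ?thesis by (simp add: mult.commute)
qed

definition tri_at :: "'a ugraph \<Rightarrow> 'a \<Rightarrow> nat" where
  "tri_at G v = card {T \<in> triangles G. v \<in> T}"

lemma triangle_card:
  assumes "finite_simple_graph G" "T \<in> triangles G"
  shows "card T = 3" "T \<subseteq> verts G"
  using assms adj_neq[OF assms(1)] adj_verts[OF assms(1)] by (auto simp: triangles_def)

lemma triangleI: "adj G a b \<Longrightarrow> adj G b c \<Longrightarrow> adj G a c \<Longrightarrow> {a, b, c} \<in> triangles G"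
  unfolding triangles_def by blast

text \<open>Each triangle at \<open>u\<close> is met by the two orders of its other
  vertices.\<close>

lemma sum_codeg_nbrs:
  assumes G: "finite_simple_graph G"
  shows "(\<Sum>v\<in>nbrs G u. codeg G u v) \<le> 2 * tri_at G u"
proof -
  let ?S = "SIGMA v:nbrs G u. nbrs G u \<inter> nbrs G v"
  have fin: "finite (nbrs G v)" for v using nbrs_finite[OF G] by auto
  have "(\<Sum>v\<in>nbrs G u. codeg G u v) = card ?S" using fin by (simp add: codeg_def)
  also have "card ?S \<le> 2 * card {T \<in> triangles G. u \<in> T}"
  proof (rule card_fibers[where f = "\<lambda>p. {u, fst p, snd p}"])
    show "finite ?S" using fin by (intro finite_SigmaI) auto
    show "finite {T \<in> triangles G. u \<in> T}" using triangles_finite[OF G] by simp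
    show "(\<lambda>p. {u, fst p, snd p}) ` ?S \<subseteq> {T \<in> triangles G. u \<in> T}"
      by (auto simp: nbrs_def intro: triangleI)
    fix T assume "T \<in> {T \<in> triangles G. u \<in> T}"
    then obtain a b where T: "T = {u, a, b}" "adj G u a" "adj G u b" "adj G a b"
      using triangle_through[of T G u] by auto
    have "{x \<in> ?S. {u, fst x, snd x} = T} \<subseteq> {(a, b), (b, a)}"
    proof
      fix x assume "x \<in> {x \<in> ?S. {u, fst x, snd x} = T}"
      then obtain v w where x: "x = (v, w)" "adj G u v" "adj G u w" "adj G v w" "{u, v, w} = T"
        by (auto simp: nbrs_def)
      then have "v \<noteq> u" "w \<noteq> u" "v \<noteq> w" using adj_neq[OF G] by metis+
      moreover have "v \<in> {u, a, b}" "w \<in> {u, a, b}" using x(5) T(1) by blast+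
      ultimately show "x \<in> {(a, b), (b, a)}" using x(1) by auto
    qed
    then have "card {x \<in> ?S. {u, fst x, snd x} = T} \<le> card {(a, b), (b, a)}"
      by (rule card_mono[rotated]) (rule finite.insertI[OF finite.insertI[OF finite.emptyI]])
    moreover have "card {(a, b), (b, a)} \<le> 2" using card_length[of "[(a, b), (b, a)]"] by simp
    ultimately show "card {x \<in> ?S. {u, fst x, snd x} = T} \<le> 2" by (rule le_trans)
  qed
  finally show ?thesis by (simp add: tri_at_def)
qed

lemma sum_tri_at:
  assumes G: "finite_simple_graph G"
  shows "(\<Sum>v\<in>verts G. tri_at G v) = 3 * card (triangles G)"
proof -
  have fin: "finite (verts G)" "finite (triangles G)"
    using verts_finite[OF G] triangles_finite[OF G] by auto
  have "(\<Sum>v\<in>verts G. tri_at G v) = (\<Sum>v\<in>verts G. \<Sum>T\<in>triangles G. if v \<in> T then 1 else 0)"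
    unfolding tri_at_def using fin by (simp flip: sum.inter_filter)
  also have "\<dots> = (\<Sum>T\<in>triangles G. \<Sum>v\<in>verts G. if v \<in> T then 1 else 0)"
    by (rule sum.swap)
  also have "\<dots> = (\<Sum>T\<in>triangles G. 3)"
  proof (rule sum.cong[OF refl])
    fix T assume "T \<in> triangles G"
    then have "card T = 3" "{v \<in> verts G. v \<in> T} = T" using triangle_card[OF G, of T] by auto
    then show "(\<Sum>v\<in>verts G. if v \<in> T then 1 else 0) = (3 :: nat)"
      using fin by (simp flip: sum.inter_filter)
  qed
  finally show ?thesis by simp
qed

lemma codeg_ge:
  assumes G: "finite_simple_graph G"
  shows "int (deg G u) + int (deg G v) - int (order G) \<le> int (codeg G u v)"
proof -
  have fin: "finite (nbrs G v)" for v using nbrs_finite[OF G] by auto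
  have "card (nbrs G u \<union> nbrs G v) \<le> order G"
    unfolding order_def using nbrs_subset[OF G] verts_finite[OF G] by (intro card_mono) auto
  then show ?thesis using card_Un_Int[OF fin fin, of u v] unfolding deg_def codeg_def by linarith
qed

lemma sum_deg_nbrs:
  fixes f :: "'a \<Rightarrow> int"
  assumes G: "finite_simple_graph G"
  shows "(\<Sum>u\<in>verts G. \<Sum>v\<in>nbrs G u. f v) = (\<Sum>v\<in>verts G. int (deg G v) * f v)"
proof -
  have n: "nbrs G u = {v \<in> verts G. adj G u v}" for u using nbrs_subset[OF G] by (auto simp: nbrs_def)
  have "(\<Sum>u\<in>verts G. \<Sum>v\<in>nbrs G u. f v) = (\<Sum>v\<in>verts G. \<Sum>u\<in>nbrs G v. f v)"
    unfolding n using verts_finite[OF G]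
    by (subst sum.swap_restrict) (auto simp: adj_sym intro!: sum.cong)
  then show ?thesis by (simp add: deg_def)
qed

text \<open>Sum \<open>codeg_ge\<close> over ordered adjacent pairs; a triangle is counted six
  times.\<close>

lemma triangles_ge:
  assumes G: "finite_simple_graph G"
  shows "2 * (\<Sum>v\<in>verts G. int (deg G v) * int (deg G v)) - 2 * int (order G) * int (num_edges G)
    \<le> 6 * int (card (triangles G))"
proof -
  have d: "(\<Sum>v\<in>verts G. int (deg G v)) = 2 * int (num_edges G)"
    using handshake[OF G] by (metis of_nat_sum of_nat_mult of_nat_numeral)
  have "(\<Sum>u\<in>verts G. \<Sum>v\<in>nbrs G u. int (deg G u) + int (deg G v) - int (order G))
      \<le> (\<Sum>u\<in>verts G. \<Sum>v\<in>nbrs G u. int (codeg G u v))"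
    by (intro sum_mono codeg_ge[OF G])
  also have "\<dots> = int (\<Sum>u\<in>verts G. \<Sum>v\<in>nbrs G u. codeg G u v)" by simp
  also have "\<dots> \<le> int (\<Sum>u\<in>verts G. 2 * tri_at G u)"
    by (intro sum_mono sum_codeg_nbrs[OF G] iffD2[OF of_nat_le_iff])
  also have "\<dots> = 6 * int (card (triangles G))"
    using sum_tri_at[OF G] by (simp flip: sum_distrib_left of_nat_sum)
  also have "(\<Sum>u\<in>verts G. \<Sum>v\<in>nbrs G u. int (deg G u) + int (deg G v) - int (order G))
      = 2 * (\<Sum>v\<in>verts G. int (deg G v) * int (deg G v)) - int (order G) * (\<Sum>v\<in>verts G. int (deg G v))"
    unfolding sum_subtractf sum.distrib sum_deg_nbrs[OF G]
    by (simp add: deg_def mult.commute sum_distrib_left)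
  finally show ?thesis unfolding d by (simp add: algebra_simps)
qed

text \<open>The squares of the degrees are bounded linearly by
  \<open>(y - a) (y - a - 1) >= 0\<close>, true for integers. Near the average degree this beats
  Cauchy-Schwarz, and the small orders need that rounding gain.\<close>

lemma goodman:
  fixes a :: int
  assumes G: "finite_simple_graph G"
  shows "2 * (2 * a + 1) * int (num_edges G) - a * (a + 1) * int (order G) - int (order G) * int (num_edges G)
    \<le> 3 * int (card (triangles G))"
proof -
  have d: "(\<Sum>v\<in>verts G. int (deg G v)) = 2 * int (num_edges G)"
    using handshake[OF G] by (metis of_nat_sum of_nat_mult of_nat_numeral)
  have sq: "(2 * a + 1) * y - a * (a + 1) \<le> y * y" for y :: int
  proof -
    have "0 \<le> (y - a) * (y - a - 1)"
      by (cases "y \<le> a") (auto intro: mult_nonneg_nonneg mult_nonpos_nonpos)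
    then show ?thesis by (simp add: algebra_simps)
  qed
  have "(\<Sum>v\<in>verts G. (2 * a + 1) * int (deg G v) - a * (a + 1))
      \<le> (\<Sum>v\<in>verts G. int (deg G v) * int (deg G v))"
    by (rule sum_mono) (rule sq)
  then have "(2 * a + 1) * (2 * int (num_edges G)) - int (order G) * (a * (a + 1))
      \<le> (\<Sum>v\<in>verts G. int (deg G v) * int (deg G v))"
    unfolding sum_subtractf sum_distrib_left[symmetric] d by (simp add: order_def algebra_simps)
  then show ?thesis using triangles_ge[OF G] by (simp add: algebra_simps)
qed

definition del :: "'a ugraph \<Rightarrow> 'a set \<Rightarrow> 'a ugraph" where
  "del G X = induced G (verts G - X)"

lemma del_simple: "finite_simple_graph G \<Longrightarrow> finite_simple_graph (del G X)"
  unfolding del_def by (rule induced_simple) auto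

lemma del_verts [simp]: "verts (del G X) = verts G - X"
  by (simp add: del_def)

lemma del_adj: "finite_simple_graph G \<Longrightarrow> adj (del G X) a b \<longleftrightarrow> adj G a b \<and> a \<notin> X \<and> b \<notin> X"
  unfolding del_def adj_induced using adj_verts[of G a b] by auto

lemma del_del: "finite_simple_graph G \<Longrightarrow> del (del G X) Y = del G (X \<union> Y)"
  unfolding del_def induced_def edges_def verts_def by auto

lemma del_order:
  assumes "finite_simple_graph G" "X \<subseteq> verts G"
  shows "order (del G X) = order G - card X"
  using finite_subset[OF assms(2) verts_finite[OF assms(1)]] assms(2)
  by (simp add: order_def card_Diff_subset)

lemma del_edges:
  assumes G: "finite_simple_graph G"
  shows "num_edges (del G {v}) + deg G v = num_edges G"
proof -
  have "edges G = edges (del G {v}) \<union> {e \<in> edges G. v \<in> e}"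
    using G by (auto simp: del_def edges_induced finite_simple_graph_def)
  moreover have "edges (del G {v}) \<inter> {e \<in> edges G. v \<in> e} = {}" by (auto simp: del_def edges_induced)
  moreover have "finite (edges G)" by (rule edges_finite[OF G])
  ultimately show ?thesis
    unfolding num_edges_def deg_card_edges[OF G] by (metis card_Un_disjoint finite_Un)
qed

lemma del_deg:
  assumes G: "finite_simple_graph G" and "adj G u v"
  shows "deg (del G {u}) v + 1 = deg G v"
proof -
  have "nbrs G v = insert u (nbrs (del G {u}) v)" "u \<notin> nbrs (del G {u}) v"
    using assms(2) adj_sym[of G u v] adj_neq[OF G assms(2)] by (auto simp: nbrs_def del_adj[OF G])
  then show ?thesis using nbrs_finite[OF del_simple[OF G]] by (simp add: deg_def)
qed

lemma del_edges_pair: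
  assumes G: "finite_simple_graph G" and uv: "adj G u v"
  shows "num_edges (del G {u, v}) + deg G u + deg G v = num_edges G + 1"
  using del_edges[OF G, of u] del_edges[OF del_simple[OF G], of "{u}" v] del_deg[OF G uv]
    del_del[OF G, of "{u}" "{v}"] by (simp add: insert_commute)

lemma del_triangles:
  assumes G: "finite_simple_graph G"
  shows "card (triangles G) = card (triangles (del G X)) + card {T \<in> triangles G. T \<inter> X \<noteq> {}}"
proof -
  have "triangles (del G X) = {T \<in> triangles G. T \<inter> X = {}}"
    unfolding triangles_def del_adj[OF G] by auto
  then have "triangles G = triangles (del G X) \<union> {T \<in> triangles G. T \<inter> X \<noteq> {}}"
    "triangles (del G X) \<inter> {T \<in> triangles G. T \<inter> X \<noteq> {}} = {}" by auto
  then show ?thesis using triangles_finite[OF G] by (metis card_Un_disjoint finite_Un)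
qed

lemma del_triangles_vertex:
  "finite_simple_graph G \<Longrightarrow> card (triangles G) = card (triangles (del G {v})) + tri_at G v"
  using del_triangles[of G "{v}"] by (simp add: tri_at_def)

lemma edges_across:
  assumes G: "finite_simple_graph G" and V: "verts G = A \<union> B"
  shows "num_edges G \<le> card {(a, b). a \<in> A \<and> b \<in> B \<and> adj G a b} + card {e \<in> edges G. e \<subseteq> A \<or> e \<subseteq> B}"
proof -
  let ?P = "{(a, b). a \<in> A \<and> b \<in> B \<and> adj G a b}" and ?I = "{e \<in> edges G. e \<subseteq> A \<or> e \<subseteq> B}"
  have "finite A" "finite B" using verts_finite[OF G] V by auto
  then have fP: "finite ?P" by (auto intro: finite_subset[of _ "A \<times> B"])
  have fI: "finite ?I" using edges_finite[OF G] by simp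
  have "edges G \<subseteq> (\<lambda>(a, b). {a, b}) ` ?P \<union> ?I"
  proof
    fix e assume e: "e \<in> edges G"
    then have "card e = 2" "e \<subseteq> A \<union> B" using G V by (auto simp: finite_simple_graph_def)
    then obtain a b where ab: "e = {a, b}" "a \<in> A \<union> B" "b \<in> A \<union> B" by (auto simp: card_2_iff)
    have "adj G a b" "adj G b a" using e ab by (auto simp: adj_def insert_commute)
    moreover have "e = {b, a}" using ab by auto
    ultimately show "e \<in> (\<lambda>(a, b). {a, b}) ` ?P \<union> ?I"
      using e ab by (cases "a \<in> A"; cases "b \<in> B") force+
  qed
  then have "num_edges G \<le> card ((\<lambda>(a, b). {a, b}) ` ?P \<union> ?I)"
    unfolding num_edges_def using fP fI by (intro card_mono) auto
  also have "\<dots> \<le> card ((\<lambda>(a, b). {a, b}) ` ?P) + card ?I" by (rule card_Un_le)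
  also have "card ((\<lambda>(a, b). {a, b}) ` ?P) \<le> card ?P" by (rule card_image_le[OF fP])
  finally show ?thesis by simp
qed

lemma mult_le_square:
  assumes "a + b \<le> 2 * p"
  shows "a * b \<le> p * (p :: nat)"
proof -
  have "4 * (int a * int b) \<le> (int a + int b) * (int a + int b)"
    using zero_le_square[of "int a - int b"] by (simp add: algebra_simps)
  also have "\<dots> \<le> (2 * int p) * (2 * int p)" using assms by (intro mult_mono) auto
  finally have "int (a * b) \<le> int (p * p)" by simp
  then show ?thesis by (simp only: of_nat_le_iff)
qed

text \<open>The allowance \<open>x\<close> of edges beyond the threshold is carried through the
  induction: a deletion that removes few edges is credited with extra triangles in the
  remainder.\<close>

definition surplus :: "nat \<Rightarrow> nat \<Rightarrow> 'a ugraph \<Rightarrow> bool" where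
  "surplus m x H \<longleftrightarrow> finite_simple_graph H \<and> order H = m \<and> m * m div 4 + 2 + x \<le> num_edges H"

text \<open>Parts of sizes \<open>a\<close>, \<open>b\<close> with \<open>m\<close> edges across,
  and a vertex with \<open>\<alpha>\<close> and \<open>\<beta>\<close> neighbours in them; each
  missing edge spoils at most one of the \<open>\<alpha> * \<beta>\<close> candidate triangles. With
  \<open>s = p * p - a * b\<close> one gets \<open>\<alpha> + \<beta> >= s + 2\<close>, while
  \<open>s\<close> is at least \<open>a\<close>, \<open>b\<close> and \<open>p\<close>. So both
  \<open>\<alpha>\<close> and \<open>\<beta>\<close> are at least 2, the product is at least
  \<open>2 (\<alpha> + \<beta>) - 4\<close>, and
  \<open>t >= \<alpha> + \<beta> - 2 + s >= 2 s\<close>.\<close>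

lemma bipartite_plus_vertex:
  fixes a b \<alpha> \<beta> p m e t :: int
  assumes "0 \<le> \<alpha>" "\<alpha> \<le> a" "0 \<le> \<beta>" "\<beta> \<le> b" "a + b = 2 * p - 1" "0 \<le> p"
    and "m \<le> a * b" "p * p + 2 - (\<alpha> + \<beta>) \<le> m" "\<alpha> * \<beta> - (a * b - m) \<le> t"
  shows "2 * p \<le> t"
proof -
  define s where "s = p * p - a * b"
  have b: "b = 2 * p - 1 - a" and a: "a = 2 * p - 1 - b" using assms(5) by auto
  have s1: "s = (p - a) * (p - a) + a" unfolding s_def b by (simp add: algebra_simps)
  have s2: "s = (p - b) * (p - b) + b" unfolding s_def a by (simp add: algebra_simps)
  have sab: "\<alpha> + \<beta> \<ge> s + 2" using assms(7,8) unfolding s_def by linarith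
  have sq: "\<bar>y\<bar> \<le> y * y" for y :: int
  proof -
    have "\<bar>y\<bar> * 1 \<le> \<bar>y\<bar> * \<bar>y\<bar>"
    proof (cases "y = 0")
      case False then show ?thesis by (intro mult_left_mono) auto
    qed simp
    then show ?thesis by (simp only: mult_1_right abs_mult_self_eq)
  qed
  have sp: "p \<le> s" using sq[of "p - a"] unfolding s1 by linarith
  have "b \<le> s" "a \<le> s" using zero_le_square[of "p - b"] zero_le_square[of "p - a"] s1 s2 by linarith+
  then have "2 \<le> \<alpha>" "2 \<le> \<beta>" using sab assms(2,4) by linarith+
  then have "0 \<le> (\<alpha> - 2) * (\<beta> - 2)" by simp
  then have "\<alpha> * \<beta> \<ge> 2 * (\<alpha> + \<beta>) - 4" by (simp add: algebra_simps)
  moreover have "2 * p \<le> t" if "2 * (\<alpha> + \<beta>) - 4 \<le> X" "Z - Y = s" "Z + 2 - (\<alpha> + \<beta>) \<le> m"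
    "X - (Y - m) \<le> t" for X Y Z
    using that sab sp by presburger
  ultimately show ?thesis using assms(8,9) s_def by blast
qed

lemma triangles_pair:
  assumes G: "finite_simple_graph G" and n: "order G = 2 * p" and p: "4 \<le> p"
    and e: "num_edges G = p * p + 2"
    and IH: "\<And>m x H :: 'a ugraph. m < 2 * p \<Longrightarrow> surplus m x H \<Longrightarrow> 2 * (m div 2) + x \<le> card (triangles H)"
    and uv: "adj G u v" and d: "deg G u + deg G v \<le> 2 * p"
  shows "2 * p \<le> card (triangles (G :: 'a ugraph))"
proof -
  define i where "i = 2 * p - (deg G u + deg G v)"
  define TT where "TT = {T \<in> triangles G. T \<inter> {u, v} \<noteq> {}}"
  have fT: "finite TT" using triangles_finite[OF G] by (simp add: TT_def)
  have uvV: "u \<in> verts G" "v \<in> verts G" "u \<noteq> v" using adj_verts[OF G uv] adj_neq[OF G uv] by auto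
  have tri: "card (triangles G) = card (triangles (del G {u, v})) + card TT"
    unfolding TT_def by (rule del_triangles[OF G])
  obtain q where q: "p = Suc q" using p by (cases p) auto
  have "surplus (2 * p - 2) i (del G {u, v})"
  proof -
    have "num_edges (del G {u, v}) + (2 * p - i) = p * p + 3" and "i \<le> 2 * p"
      using del_edges_pair[OF G uv] e d by (auto simp: i_def)
    moreover have "(2 * p - 2) * (2 * p - 2) div 4 = q * q" unfolding q by simp
    moreover have "p * p = q * q + 2 * q + 1" unfolding q by simp
    ultimately show ?thesis unfolding surplus_def using del_simple[OF G] uvV n
      by (auto simp: del_order[OF G] q)
  qed
  from IH[OF _ this] have t1: "2 * (p - 1) + i \<le> card (triangles (del G {u, v}))"
    using p by (simp add: q)
  show ?thesis
  proof (rule ccontr)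
    assume small: "\<not> ?thesis"
    then have iT: "i + card TT \<le> 1" using t1 tri p by linarith
    define A where "A = nbrs G v"
    define B where "B = nbrs G u"
    have fAB: "finite A" "finite B" "A \<subseteq> verts G" "B \<subseteq> verts G"
      using nbrs_finite[OF G] nbrs_subset[OF G] by (auto simp: A_def B_def)
    have cAB: "card A + card B = 2 * p - i" using d by (simp add: A_def B_def deg_def i_def)
    have notAB: "v \<notin> A" "u \<notin> B" using adj_irrefl[OF G] by (auto simp: A_def B_def nbrs_def)
    have one: "S = T" if "S \<in> TT" "T \<in> TT" for S T
    proof -
      have "card TT \<le> 1" using iT by simp
      then show ?thesis using that fT by (metis card_le_Suc0_iff_eq One_nat_def)
    qed
    have triv: "{v, a, b} \<in> TT" if "a \<in> A" "b \<in> A" "adj G a b" for a b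
      using that by (auto simp: TT_def A_def nbrs_def intro: triangleI)
    have triu: "{u, a, b} \<in> TT" if "a \<in> B" "b \<in> B" "adj G a b" for a b
      using that by (auto simp: TT_def B_def nbrs_def intro: triangleI)
    show False
    proof (cases "A \<inter> B = {}")
      \<comment> \<open>A common neighbour \<open>w\<close> forms the only triangle meeting
        \<open>u\<close> or \<open>v\<close>, so \<open>w\<close> has at most one further neighbour,
        outside both neighbourhoods. Deleting \<open>w\<close> leaves surplus
        \<open>p - 3\<close>.\<close>
      case False
      then obtain w where w: "w \<in> A" "w \<in> B" by blast
      have uA: "u \<in> A" "v \<in> B" using uv adj_sym[of G u v] by (auto simp: A_def B_def nbrs_def)
      have wadj: "adj G w u" "adj G w v" "adj G u w" "adj G v w"
        using w adj_sym[of G] by (auto simp: A_def B_def nbrs_def)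
      have wne: "w \<noteq> u" "w \<noteq> v" using w notAB by auto
      have tw: "{v, u, w} \<in> TT" using triv[OF uA(1) w(1)] wadj by simp
      then have i0: "i = 0" using iT fT by (cases "TT = {}") (auto simp: card_gt_0_iff dest: card_0_eq)
      have AB1: "A \<inter> B = {w}"
      proof -
        have "w' = w" if "w' \<in> A" "w' \<in> B" for w'
        proof -
          have "adj G u w'" using that by (simp add: B_def nbrs_def)
          then have "{v, u, w'} = {v, u, w}" using one[OF triv[OF uA(1) that(1)] tw] by simp
          moreover have "w' \<noteq> u" "w' \<noteq> v" using that notAB by auto
          ultimately show "w' = w" by blast
        qed
        then show ?thesis using w by blast
      qed
      then have "card (A \<union> B) + 1 = 2 * p" using card_Un_Int[OF fAB(1,2)] cAB i0 by simp
      then have L: "card (verts G - (A \<union> B)) = 1"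
        using n fAB by (simp add: order_def card_Diff_subset)
      have "nbrs G w \<subseteq> {u, v} \<union> (verts G - (A \<union> B))"
      proof
        fix a assume "a \<in> nbrs G w"
        then have a: "adj G w a" "a \<in> verts G" "a \<noteq> w"
          using adj_verts[OF G] adj_neq[OF G] by (auto simp: nbrs_def)
        have "a \<in> {u, v}" if "a \<in> A \<union> B"
        proof (cases "a \<in> A")
          case True
          then have "{v, w, a} = {v, u, w}" using one[OF triv[OF w(1) True a(1)] tw] by simp
          then show ?thesis using a by blast
        next
          case False
          then have "{u, w, a} = {v, u, w}" using that one[OF triu[OF w(2) _ a(1)] tw] by simp
          then show ?thesis using a by blast
        qed
        then show "a \<in> {u, v} \<union> (verts G - (A \<union> B))" using a by blast
      qed
      then have "deg G w \<le> card ({u, v} \<union> (verts G - (A \<union> B)))"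
        unfolding deg_def using verts_finite[OF G] by (intro card_mono) auto
      also have "\<dots> \<le> card {u, v} + 1" using card_Un_le[of "{u, v}" "verts G - (A \<union> B)"] L by simp
      finally have dw: "deg G w \<le> 3" using uvV by simp
      have "surplus (2 * p - 1) (p - 3) (del G {w})"
      proof -
        have "w \<in> verts G" using w fAB by blast
        then have "order (del G {w}) = 2 * p - 1" using n by (simp add: del_order[OF G])
        moreover have "(2 * p - 1) * (2 * p - 1) div 4 = q * q + q" unfolding q by (simp add: algebra_simps)
        moreover have "p * p = q * q + 2 * q + 1" unfolding q by simp
        moreover have "num_edges (del G {w}) + deg G w = p * p + 2" using del_edges[OF G] e by simp
        ultimately show ?thesis unfolding surplus_def using del_simple[OF G] dw p q by auto
      qed
      from IH[OF _ this] have "2 * (p - 1) + (p - 3) \<le> card (triangles (del G {w}))"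
        using p by (simp add: q)
      moreover have "1 \<le> tri_at G w"
      proof -
        have "{v, u, w} \<in> {T \<in> triangles G. w \<in> T}" using tw by (simp add: TT_def)
        moreover have "finite {T \<in> triangles G. w \<in> T}" using triangles_finite[OF G] by simp
        ultimately show ?thesis unfolding tri_at_def by (metis One_nat_def Suc_leI card_gt_0_iff empty_iff)
      qed
      ultimately show False using del_triangles_vertex[OF G, of w] small p by linarith
    next
      case True
      \<comment> \<open>An edge inside \<open>A\<close> spans a triangle with \<open>v\<close>, one
        inside \<open>B\<close> with \<open>u\<close>; disjointness keeps \<open>u\<close> and
        \<open>v\<close> off these edges, so the map to \<open>TT\<close> is injective.\<close>
      let ?I = "{e \<in> edges G. e \<subseteq> A \<or> e \<subseteq> B}"
      have I: "card ?I \<le> card TT"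
      proof (rule card_inj_on_le[where f = "\<lambda>e. if e \<subseteq> A then insert v e else insert u e"])
        have e2: "\<exists>a b. f = {a, b} \<and> adj G a b" if "f \<in> ?I" for f
        proof -
          have "f \<in> edges G" "card f = 2" using that G by (auto simp: finite_simple_graph_def)
          then show ?thesis unfolding card_2_iff adj_def by metis
        qed
        have ne: "u \<notin> f \<and> v \<notin> f" if f: "f \<in> ?I" for f
        proof -
          obtain a b where ab: "f = {a, b}" "adj G a b" "adj G b a" using e2[OF f] adj_sym[of G] by blast
          have s: "{a, b} \<subseteq> A \<or> {a, b} \<subseteq> B" using f ab(1) by simp
          have uv': "adj G v u" using uv adj_sym[of G] by blast
          have "u \<noteq> a \<and> u \<noteq> b \<and> v \<noteq> a \<and> v \<noteq> b"
            using True s ab(2,3) notAB uv uv' unfolding A_def B_def nbrs_def by blast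
          then show ?thesis using ab(1) by simp
        qed
        show "inj_on (\<lambda>e. if e \<subseteq> A then insert v e else insert u e) ?I"
          by (rule inj_on_inverseI[where g = "\<lambda>T. T - {u, v}"]) (use ne in auto)
        show "(\<lambda>e. if e \<subseteq> A then insert v e else insert u e) ` ?I \<subseteq> TT"
        proof (rule image_subsetI)
          fix f assume f: "f \<in> ?I"
          obtain a b where ab: "f = {a, b}" "adj G a b" using e2[OF f] by blast
          show "(if f \<subseteq> A then insert v f else insert u f) \<in> TT"
            using f triv[of a b] triu[of a b] ab by auto
        qed
      qed (rule fT)
      have AB: "card (A \<union> B) = 2 * p - i" using True cAB fAB by (simp add: card_Un_disjoint)
      show False
      proof (cases "i = 0")
        \<comment> \<open>The two sides exhaust the graph: at most \<open>p * p\<close> edges across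
          and one inside, fewer than \<open>p * p + 2\<close>.\<close>
        case i0: True
        have V: "verts G = A \<union> B"
          using card_subset_eq[of "verts G" "A \<union> B"] fAB AB i0 n verts_finite[OF G] by (simp add: order_def)
        have "{(a, b). a \<in> A \<and> b \<in> B \<and> adj G a b} \<subseteq> A \<times> B" by auto
        then have "card {(a, b). a \<in> A \<and> b \<in> B \<and> adj G a b} \<le> card (A \<times> B)"
          using fAB by (intro card_mono) auto
        also have "\<dots> \<le> p * p" using mult_le_square[of "card A" "card B" p] cAB i0 by (simp add: card_cartesian_product)
        finally show False using edges_across[OF G V] I iT e by linarith
      next
        case False
        \<comment> \<open>Now both sides are independent and exactly one vertex lies outside
          them.\<close>
        then have i1: "i = 1" and "card TT = 0" using iT by auto
        then have T0: "TT = {}" using fT by simp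
        have "card (verts G - (A \<union> B)) = 1"
          using n fAB AB i1 p by (simp add: order_def card_Diff_subset)
        then obtain w where w: "verts G - (A \<union> B) = {w}" by (auto simp: card_1_singleton_iff)
        define H where "H = del G {w}"
        have H: "finite_simple_graph H" "verts H = A \<union> B"
          using del_simple[OF G] w fAB by (auto simp: H_def)
        let ?P = "{(a, b). a \<in> A \<and> b \<in> B \<and> adj H a b}"
        have "{e \<in> edges H. e \<subseteq> A \<or> e \<subseteq> B} \<subseteq> ?I" by (auto simp: H_def del_def edges_induced)
        then have "{e \<in> edges H. e \<subseteq> A \<or> e \<subseteq> B} = {}"
          using I T0 edges_finite[OF G] by (auto simp: card_eq_0_iff)
        then have m1: "num_edges H \<le> card ?P" using edges_across[OF H] by (simp only: card.empty add_0_right)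
        have PAB: "?P \<subseteq> A \<times> B" by auto
        then have m2: "card ?P \<le> card A * card B"
          using card_mono[OF _ PAB] fAB by (simp add: card_cartesian_product)
        define \<alpha> where "\<alpha> = card (A \<inter> nbrs G w)"
        define \<beta> where "\<beta> = card (B \<inter> nbrs G w)"
        have "nbrs G w = (A \<inter> nbrs G w) \<union> (B \<inter> nbrs G w)"
          using nbrs_subset[OF G, of w] w adj_irrefl[OF G, of w] by (auto simp: nbrs_def)
        then have dw: "deg G w = \<alpha> + \<beta>"
          unfolding deg_def \<alpha>_def \<beta>_def using True fAB
          by (metis card_Un_disjoint finite_Int inf_commute inf_left_commute inf_bot_right)
        have eH: "num_edges H + (\<alpha> + \<beta>) = p * p + 2" using del_edges[OF G, of w] e dw by (simp add: H_def)
        let ?N = "(A \<inter> nbrs G w) \<times> (B \<inter> nbrs G w)"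
        have "card (?N \<inter> ?P) \<le> card (triangles G)"
        proof (rule card_inj_on_le[where f = "\<lambda>(a, b). {w, a, b}"])
          have wAB: "w \<notin> A" "w \<notin> B" using w by auto
          show "inj_on (\<lambda>(a, b). {w, a, b}) (?N \<inter> ?P)"
          proof (rule inj_onI)
            fix y z assume y: "y \<in> ?N \<inter> ?P" and z: "z \<in> ?N \<inter> ?P"
              and eq: "(case y of (a, b) \<Rightarrow> {w, a, b}) = (case z of (a, b) \<Rightarrow> {w, a, b})"
            obtain a b c d where yz: "y = (a, b)" "z = (c, d)" by (cases y; cases z) auto
            have m: "a \<in> A" "b \<in> B" "c \<in> A" "d \<in> B" using y z yz by auto
            have "{w, a, b} = {w, c, d}" using eq yz by simp
            then have "a \<in> {w, c, d}" "b \<in> {w, c, d}" by blast+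
            then show "y = z" using m True wAB yz by auto
          qed
          show "(\<lambda>(a, b). {w, a, b}) ` (?N \<inter> ?P) \<subseteq> triangles G"
            by (auto simp: nbrs_def H_def del_adj[OF G] intro: triangleI)
        qed (rule triangles_finite[OF G])
        moreover have "int \<alpha> * int \<beta> - (int (card A) * int (card B) - int (card ?P)) \<le> int (card (?N \<inter> ?P))"
        proof -
          have fN: "finite ?N" "finite ?P" using fAB finite_subset[OF PAB] by auto
          have "card (?N \<union> ?P) \<le> card (A \<times> B)" using fAB PAB by (intro card_mono) auto
          then have "card (?N \<union> ?P) \<le> card A * card B" by (simp add: card_cartesian_product)
          moreover have "card ?N + card ?P = card (?N \<union> ?P) + card (?N \<inter> ?P)" by (rule card_Un_Int[OF fN])
          moreover have "card ?N = \<alpha> * \<beta>" by (simp add: card_cartesian_product \<alpha>_def \<beta>_def)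
          ultimately have "\<alpha> * \<beta> + card ?P \<le> card A * card B + card (?N \<inter> ?P)" by linarith
          then have "int (\<alpha> * \<beta> + card ?P) \<le> int (card A * card B + card (?N \<inter> ?P))"
            by (simp only: of_nat_le_iff)
          then show ?thesis unfolding of_nat_add of_nat_mult by linarith
        qed
        ultimately have "int \<alpha> * int \<beta> - (int (card A) * int (card B) - int (card ?P)) \<le> int (card (triangles G))"
          by linarith
        moreover have "\<alpha> \<le> card A" "\<beta> \<le> card B" using fAB by (auto simp: \<alpha>_def \<beta>_def intro: card_mono)
        moreover have "int p * int p + 2 - (int \<alpha> + int \<beta>) \<le> int (card ?P)"
        proof -
          have "p * p + 2 \<le> card ?P + (\<alpha> + \<beta>)" using m1 eH by linarith
          then have "int (p * p + 2) \<le> int (card ?P + (\<alpha> + \<beta>))" by (simp only: of_nat_le_iff)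
          then show ?thesis by simp
        qed
        moreover have "int (card A) + int (card B) = 2 * int p - 1" using cAB i1 p by linarith
        moreover have "int (card ?P) \<le> int (card A) * int (card B)"
          using m2 unfolding of_nat_mult[symmetric] of_nat_le_iff .
        ultimately have "2 * int p \<le> int (card (triangles G))"
          by (intro bipartite_plus_vertex[of "int \<alpha>" "int (card A)" "int \<beta>" "int (card B)" "int p" "int (card ?P)"])
            (simp_all del: of_nat_mult)
        then show False using small by linarith
      qed
    qed
  qed
qed


lemma sum_deg_int:
  "finite_simple_graph G \<Longrightarrow> (\<Sum>v\<in>verts G. int (deg G v)) = 2 * int (num_edges G)"
  using handshake[of G] by (metis of_nat_sum of_nat_mult of_nat_numeral)

lemma low_degree_vertex:
  assumes G: "finite_simple_graph G" and e: "2 * num_edges G < order G * k"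
  obtains v where "v \<in> verts G" "deg G v < k"
proof -
  have "\<exists>v\<in>verts G. deg G v < k"
  proof (rule ccontr)
    assume "\<not> ?thesis"
    then have "(\<Sum>v\<in>verts G. k) \<le> (\<Sum>v\<in>verts G. deg G v)" by (intro sum_mono) (auto simp: not_less)
    then show False using e handshake[OF G] by (simp add: order_def)
  qed
  then show thesis using that by blast
qed

text \<open>From order 4 on, \<open>a\<close> is chosen so that \<open>a\<close> and
  \<open>a + 1\<close> enclose the average degree.\<close>

lemma triangles_base:
  assumes G: "finite_simple_graph G" and n: "order G = n" "n \<le> 6"
    and e: "num_edges G = n * n div 4 + 2"
  shows "2 * (n div 2) \<le> card (triangles G)"
proof -
  note g = goodman[OF G, unfolded n(1) e]
  consider "n = 0" | "n = 1" | "n = 2" | "n = 3" | "n = 4" | "n = 5" | "n = 6" using n(2) by linarith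
  then show ?thesis
  proof cases
    case 3 then show ?thesis using g[of 1] by simp
  next
    case 4 then show ?thesis using g[of 1] by simp
  next
    case 5 then show ?thesis using g[of 2] by simp
  next
    case 6 then show ?thesis using g[of 3] by simp
  next
    case 7 then show ?thesis using g[of 3] by simp
  qed auto
qed

text \<open>The graph is 4-regular. \<open>goodman\<close> yields only 5 triangles, but
  \<open>3 * 5 > 7 * 2\<close> puts some vertex in three of them, and deleting it leaves 6 vertices
  and 10 edges, hence 3 more.\<close>

lemma triangles_seven:
  assumes G: "finite_simple_graph G" and n: "order G = 7" and e: "num_edges G = 14"
    and d: "\<And>v. v \<in> verts G \<Longrightarrow> 4 \<le> deg G v"
  shows "6 \<le> card (triangles G)"
proof -
  have fin: "finite (verts G)" "card (verts G) = 7" using verts_finite[OF G] n by (auto simp: order_def)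
  have "5 \<le> card (triangles G)" using goodman[OF G, of 4] n e by simp
  then have "card (verts G) * 2 < (\<Sum>v\<in>verts G. tri_at G v)" using sum_tri_at[OF G] fin by simp
  then obtain v where v: "v \<in> verts G" "3 \<le> tri_at G v"
    using sum_bounded_above[of "verts G" "tri_at G" 2] by (force simp: not_less_eq_eq[symmetric] numeral_3_eq_3)
  have "(\<Sum>w\<in>verts G. int (deg G w) - 4) = 0"
    unfolding sum_subtractf sum_deg_int[OF G] using e fin by simp
  then have "int (deg G v) - 4 = 0"
    using sum_nonneg_eq_0_iff[of "verts G" "\<lambda>w. int (deg G w) - 4"] fin d v by auto
  then have "num_edges (del G {v}) = 10" using del_edges[OF G, of v] e by simp
  moreover have "order (del G {v}) = 6" using n v by (simp add: del_order[OF G])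
  ultimately have "3 \<le> card (triangles (del G {v}))"
    using goodman[OF del_simple[OF G, of "{v}"], of 3] by simp
  then show ?thesis using del_triangles_vertex[OF G, of v] v by linarith
qed

text \<open>For order \<open>2 q + 3\<close>, deleting a vertex lowers the threshold by
  \<open>q + 1\<close> and not the target; if all degrees exceed \<open>q + 1\<close>, the degree
  sum leaves only order 7. For order \<open>2 q + 2\<close>, either \<open>triangles_pair\<close>
  applies or every edge lies in a triangle, and then a vertex of degree below \<open>q + 2\<close>
  supplies, with its surplus, the two triangles by which the target drops.\<close>

lemma triangles_step:
  fixes G :: "'a ugraph"
  assumes G: "finite_simple_graph G" and n: "order G = n"
    and e: "num_edges G = n * n div 4 + 2"
    and IH: "\<And>m x H :: 'a ugraph. m < n \<Longrightarrow> surplus m x H \<Longrightarrow> 2 * (m div 2) + x \<le> card (triangles H)"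
  shows "2 * (n div 2) \<le> card (triangles G)"
proof -
  consider "n \<le> 6" | q where "n = 2 * q + 3" "2 \<le> q" | q where "n = 2 * q + 2" "3 \<le> q"
  proof -
    have "n \<le> 6 \<or> n = 2 * (n div 2 - 1) + 3 \<and> 2 \<le> n div 2 - 1 \<or> n = 2 * (n div 2 - 1) + 2 \<and> 3 \<le> n div 2 - 1"
      by presburger
    then show thesis using that by blast
  qed
  then show ?thesis
  proof cases
    case 1 then show ?thesis using triangles_base[OF G n] e by simp
  next
    case (2 q)
    have e2: "num_edges G = q * q + 3 * q + 4" using e by (simp add: 2 algebra_simps)
    show ?thesis
    proof (cases "\<exists>v\<in>verts G. deg G v \<le> q + 1")
      case True
      then obtain v where v: "v \<in> verts G" "deg G v \<le> q + 1" by blast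
      have "surplus (2 * q + 2) 0 (del G {v})"
        unfolding surplus_def using del_simple[OF G] v n 2 del_edges[OF G, of v] e2
        by (simp add: del_order[OF G] algebra_simps)
      from IH[OF _ this] show ?thesis using del_triangles_vertex[OF G, of v] by (simp add: 2)
    next
      case False
      then have d: "q + 2 \<le> deg G v" if "v \<in> verts G" for v using that by force
      then have "(\<Sum>v\<in>verts G. q + 2) \<le> (\<Sum>v\<in>verts G. deg G v)" by (intro sum_mono)
      then have "(2 * q + 3) * (q + 2) \<le> 2 * (q * q + 3 * q + 4)"
        unfolding handshake[OF G] e2 using n by (simp add: order_def 2)
      then have "q = 2" using 2 by (simp add: algebra_simps)
      then show ?thesis using triangles_seven[OF G] n 2 e2 d by simp
    qed
  next
    case (3 q)
    have e3: "num_edges G = (q + 1) * (q + 1) + 2" using e by (simp add: 3 algebra_simps)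
    show ?thesis
    proof (cases "\<exists>u v. adj G u v \<and> deg G u + deg G v \<le> 2 * (q + 1)")
      case True
      then obtain u v where uv: "adj G u v" "deg G u + deg G v \<le> 2 * (q + 1)" by blast
      have "2 * (q + 1) \<le> card (triangles G)"
        by (rule triangles_pair[OF G _ _ e3 IH uv]) (use n 3 in auto)
      then show ?thesis by (simp add: 3)
    next
      case False
      then have big: "2 * q + 3 \<le> deg G u + deg G v" if "adj G u v" for u v using that by force
      obtain v where v: "v \<in> verts G" "deg G v < q + 2"
        using low_degree_vertex[OF G, of "q + 2"] n e3 3 by (auto simp: algebra_simps)
      have "deg G v \<le> 2 * tri_at G v"
      proof -
        have "1 \<le> codeg G v u" if "u \<in> nbrs G v" for u
          using big[of v u] codeg_ge[OF G, of v u] n 3 that by (simp add: nbrs_def)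
        then have "(\<Sum>u\<in>nbrs G v. 1) \<le> (\<Sum>u\<in>nbrs G v. codeg G v u)" by (intro sum_mono)
        then show ?thesis using sum_codeg_nbrs[OF G, of v] by (simp add: deg_def)
      qed
      then have t: "2 \<le> (q + 1 - deg G v) + tri_at G v" using 3 by linarith
      have "surplus (2 * q + 1) (q + 1 - deg G v) (del G {v})"
        unfolding surplus_def using del_simple[OF G] v n 3 del_edges[OF G, of v] e3
        by (simp add: del_order[OF G] algebra_simps)
      from IH[OF _ this] have "2 * q + (q + 1 - deg G v) \<le> card (triangles (del G {v}))"
        by (simp add: 3)
      then show ?thesis using del_triangles_vertex[OF G, of v] t by (simp add: 3)
    qed
  qed
qed

lemma remove_edge:
  fixes G :: "'a ugraph"
  assumes G: "finite_simple_graph G" and ab: "adj G a b"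
  obtains H :: "'a ugraph" where "finite_simple_graph H" "order H = order G"
    "num_edges H + 1 = num_edges G" "triangles H \<subseteq> triangles G" "\<And>c. {a, b, c} \<notin> triangles H"
proof -
  define H where "H = (verts G, edges G - {{a, b}})"
  have e: "{a, b} \<in> edges G" using ab by (simp add: adj_def)
  have V: "verts H = verts G" "edges H = edges G - {{a, b}}" by (simp_all add: H_def verts_def edges_def)
  have adjH: "adj H x y \<longleftrightarrow> adj G x y \<and> {x, y} \<noteq> {a, b}" for x y by (simp add: adj_def V)
  have "triangles H \<subseteq> triangles G" by (auto simp: triangles_def adjH)
  moreover have "{a, b, c} \<notin> triangles H" for c
  proof
    assume "{a, b, c} \<in> triangles H"
    then obtain x y where xy: "{a, b, c} = {a, x, y}" "adj H a x" "adj H a y" "adj H x y"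
      using triangle_through[of "{a, b, c}" H a] by auto
    have "b \<noteq> a" using adj_neq[OF G ab] by simp
    moreover have "b \<in> {a, x, y}" using xy(1) by blast
    ultimately have "b = x \<or> b = y" by blast
    then show False using xy(2,3) by (auto simp: adjH)
  qed
  moreover have "finite_simple_graph H" using G by (auto simp: finite_simple_graph_def V)
  moreover have "num_edges H + 1 = num_edges G"
    using card_Suc_Diff1[OF edges_finite[OF G] e] by (simp add: num_edges_def V)
  ultimately show thesis using that[of H] by (simp add: order_def V)
qed

text \<open>Removing an edge of a triangle costs one edge and at least one triangle, so every extra
  edge pays for one. An arbitrary edge is removed first, only to see that a triangle exists.\<close>

theorem many_triangles:
  fixes G :: "'a ugraph"
  assumes "surplus n x G"
  shows "2 * (n div 2) + x \<le> card (triangles G)"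
  using assms
proof (induction n arbitrary: x G rule: less_induct)
  case (less n)
  have *: "2 * (n div 2) + x \<le> card (triangles G)"
    if "finite_simple_graph G" "order G = n" "num_edges G = n * n div 4 + 2 + x" for x and G :: "'a ugraph"
    using that
  proof (induction x arbitrary: G)
    case 0
    then show ?case using triangles_step[OF _ _ _ less.IH] by simp
  next
    case (Suc x)
    have fewer: "\<exists>H :: 'a ugraph. 2 * (n div 2) + x \<le> card (triangles H) \<and> triangles H \<subseteq> triangles G
      \<and> (\<forall>c. {a, b, c} \<notin> triangles H)" if ab: "adj G a b" for a b
    proof -
      obtain H :: "'a ugraph" where H: "finite_simple_graph H" "order H = order G"
        "num_edges H + 1 = num_edges G" "triangles H \<subseteq> triangles G" "\<And>c. {a, b, c} \<notin> triangles H"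
        using remove_edge[OF Suc.prems(1) ab] by blast
      have "2 * (n div 2) + x \<le> card (triangles H)" using H Suc.prems by (intro Suc.IH) auto
      then show ?thesis using H(4,5) by blast
    qed
    have "edges G \<noteq> {}" using Suc.prems(3) by (auto simp: num_edges_def)
    then obtain f where f: "f \<in> edges G" by blast
    then have f2: "card f = 2" "f \<subseteq> verts G" using Suc.prems by (auto simp: finite_simple_graph_def)
    then have "2 \<le> n"
      using card_mono[OF verts_finite[OF Suc.prems(1)] f2(2)] Suc.prems(2) by (simp add: order_def)
    obtain u v where "adj G u v" using f f2 by (auto simp: card_2_iff adj_def)
    from fewer[OF this] obtain H :: "'a ugraph" where "2 * (n div 2) + x \<le> card (triangles H)" "triangles H \<subseteq> triangles G"
      by blast
    then have "triangles G \<noteq> {}" using \<open>2 \<le> n\<close> by (cases "triangles H = {}") auto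
    then obtain T where "T \<in> triangles G" by blast
    then obtain a b c where t: "{a, b, c} \<in> triangles G" "adj G a b" unfolding triangles_def by blast
    from fewer[OF t(2)] obtain H :: "'a ugraph" where H: "2 * (n div 2) + x \<le> card (triangles H)" "triangles H \<subseteq> triangles G"
        "{a, b, c} \<notin> triangles H"
      by blast
    then have "triangles H \<subset> triangles G" using t by blast
    then have "card (triangles H) < card (triangles G)" by (rule psubset_card_mono[OF triangles_finite[OF Suc.prems(1)]])
    then show ?case using H(1) by simp
  qed
  obtain y where "num_edges G = n * n div 4 + 2 + (x + y)"
    using less.prems unfolding surplus_def by (metis add.assoc le_Suc_ex)
  then show ?case using *[of G "x + y"] less.prems by (simp add: surplus_def)
qed

subsection \<open>Short cycles\<close>

lemma finite_max:
  fixes f :: "'b \<Rightarrow> 'c :: linorder"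
  assumes "finite S" "x \<in> S"
  obtains y where "y \<in> S" "\<And>z. z \<in> S \<Longrightarrow> f z \<le> f y"
proof -
  have "Max (f ` S) \<in> f ` S" using assms by (intro Max_in) auto
  then obtain y where "y \<in> S" "f y = Max (f ` S)" by auto
  then show thesis using that assms by (metis Max_ge finite_imageI imageI)
qed

text \<open>The binomial expansion cut after its quadratic term, a Bonferroni upper bound.\<close>

lemma power_quadratic:
  fixes z :: real
  assumes "0 \<le> z" "z \<le> 1"
  shows "(1 - z) ^ k \<le> 1 - real k * z + real (k * (k - 1) div 2) * z\<^sup>2"
proof (induction k)
  case (Suc k)
  have "even (k * (k - 1))" by (cases k) auto
  then obtain c where c: "k * (k - 1) = 2 * c" by (rule evenE)
  then have "Suc k * (Suc k - 1) = 2 * (c + k)" by (cases k) (auto simp: algebra_simps)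
  then have d: "k * (k - 1) div 2 = c" "Suc k * (Suc k - 1) div 2 = c + k" using c by auto
  have "(1 - z) ^ Suc k \<le> (1 - z) * (1 - real k * z + real c * z\<^sup>2)"
    using Suc assms unfolding d by (simp add: mult_left_mono)
  also have "\<dots> = 1 - real (Suc k) * z + real (c + k) * z\<^sup>2 - real c * (z * z\<^sup>2)"
    by (simp add: algebra_simps power2_eq_square)
  also have "\<dots> \<le> 1 - real (Suc k) * z + real (c + k) * z\<^sup>2" using assms by simp
  finally show ?case unfolding d .
qed simp

text \<open>Here \<open>u\<close> is the density \<open>e / m^2\<close> of the maximizing set,
  \<open>d\<close> its minimum degree and \<open>n\<close> the original order. \<open>R1\<close>
  comes from deleting a vertex, \<open>R2\<close> from comparison with the whole graph.\<close>

lemma dense_core_numeric: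
  fixes u m n d :: real
  assumes n: "440 \<le> n" "m \<le> n" "0 < m" and u: "1 / 4 \<le> u" "u \<le> 1 / 2"
    and R1: "8 * u * m - 28 * u \<le> 5 * d" and R2: "n\<^sup>2 \<le> 1024 * u ^ 5 * m\<^sup>2"
  shows "1414 * n - 28000 \<le> 10000 * d" and "n - 21 \<le> 5 * (3 * d - m)"
proof -
  \<comment> \<open>The constant is just below \<open>1 / sqrt 128\<close>: with
    \<open>u <= 1/2\<close>, \<open>R2\<close> gives \<open>n^2 <= 128 (u m)^2\<close>.\<close>
  have um: "(8838 / 100000) * n \<le> u * m"
  proof (rule power2_le_imp_le)
    define X where "X = u\<^sup>2 * m\<^sup>2"
    have "u ^ 3 \<le> (1 / 2) ^ 3" using u by (intro power_mono) auto
    then have "u ^ 3 \<le> 1 / 8" by (simp add: power_divide)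
    then have "u ^ 3 * X \<le> 1 / 8 * X" by (intro mult_right_mono) (auto simp: X_def)
    moreover have "1024 * u ^ 5 * m\<^sup>2 = 1024 * (u ^ 3 * X)" by (simp add: X_def eval_nat_numeral)
    then have "n\<^sup>2 \<le> 1024 * (u ^ 3 * X)" using R2 by simp
    ultimately have *: "n\<^sup>2 \<le> 128 * (u\<^sup>2 * m\<^sup>2)" unfolding X_def[symmetric] by linarith
    have "((8838 / 100000) * n)\<^sup>2 = (8838 / 100000)\<^sup>2 * n\<^sup>2" by (rule power_mult_distrib)
    also have "\<dots> \<le> 1 / 128 * n\<^sup>2" by (intro mult_right_mono) (auto simp: power2_eq_square)
    also have "\<dots> \<le> u\<^sup>2 * m\<^sup>2" using * by simp
    finally show "((8838 / 100000) * n)\<^sup>2 \<le> (u * m)\<^sup>2" by (simp only: power_mult_distrib)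
  qed (use u n in simp)
  have ud: "8 * u * m - 14 \<le> 5 * d" using R1 u by linarith
  then show "1414 * n - 28000 \<le> 10000 * d" using um n by (simp add: mult.assoc)
  define t where "t = u - 1 / 4"
  have t: "0 \<le> t" "t \<le> 1 / 4" and ut: "u = 1 / 4 + t" using u by (simp_all add: t_def)
  \<comment> \<open>The factor is \<open>22.9 = 24 - 1.1\<close>: below, \<open>15 d\<close>
    contributes \<open>24 t m\<close>, of which at most \<open>1.1 t m\<close> pays for
    \<open>84 t\<close> because \<open>m >= 77\<close>.\<close>
  have "1024 * u ^ 5 \<le> (1 + 229 / 10 * t)\<^sup>2"
  proof -
    have "t\<^sup>2 * t \<le> t\<^sup>2 * (1 / 4)" using t by (intro mult_left_mono) auto
    then have "t ^ 3 \<le> t\<^sup>2 * (1 / 4)" by (simp add: power2_eq_square power3_eq_cube)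
    moreover have "t ^ 4 \<le> t\<^sup>2 * (1 / 16)"
    proof -
      have "t\<^sup>2 \<le> (1 / 4)\<^sup>2" using t by (intro power_mono) auto
      then have "t\<^sup>2 * t\<^sup>2 \<le> t\<^sup>2 * (1 / 16)" by (intro mult_left_mono) (auto simp: power2_eq_square)
      then show ?thesis by (simp add: power_add[symmetric])
    qed
    moreover have "t ^ 5 \<le> t\<^sup>2 * (1 / 64)"
    proof -
      have "t ^ 3 \<le> (1 / 4) ^ 3" using t by (intro power_mono) auto
      then have "t\<^sup>2 * t ^ 3 \<le> t\<^sup>2 * (1 / 64)" by (intro mult_left_mono) (auto simp: power3_eq_cube)
      then show ?thesis by (simp add: power_add[symmetric])
    qed
    moreover have "1024 * u ^ 5 = 1 + 20 * t + 160 * t\<^sup>2 + 640 * t ^ 3 + 1280 * t ^ 4 + 1024 * t ^ 5"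
      unfolding ut by (simp add: field_simps eval_nat_numeral)
    moreover have "(1 + 229 / 10 * t)\<^sup>2 = 1 + 229 / 5 * t + (229 / 10)\<^sup>2 * t\<^sup>2"
      by (simp add: field_simps power2_eq_square)
    moreover have "416 * t\<^sup>2 \<le> (229 / 10)\<^sup>2 * t\<^sup>2" by (intro mult_right_mono) (auto simp: power2_eq_square)
    ultimately show ?thesis using t(1) by linarith
  qed
  then have "1024 * u ^ 5 * m\<^sup>2 \<le> (1 + 229 / 10 * t)\<^sup>2 * m\<^sup>2" by (intro mult_right_mono) auto
  then have "n\<^sup>2 \<le> ((1 + 229 / 10 * t) * m)\<^sup>2" using R2 by (simp add: power_mult_distrib)
  then have 1: "n \<le> (1 + 229 / 10 * t) * m"
    by (rule power2_le_imp_le) (use t n in simp)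
  have "u * m \<le> 1 / 2 * m" using u n by (intro mult_right_mono) auto
  then have "77 \<le> m" using um n by linarith
  then have "84 * t \<le> (11 / 10 * m) * t" using t by (intro mult_right_mono) auto
  moreover have "24 * u * m - 84 * u = 6 * m + 24 * (t * m) - 21 - 84 * t"
    unfolding ut by (simp add: algebra_simps)
  ultimately show "n - 21 \<le> 5 * (3 * d - m)" using 1 R1 by (simp add: algebra_simps)
qed

lemma num_edges_le:
  assumes G: "finite_simple_graph G"
  shows "2 * num_edges G \<le> order G * order G"
proof -
  have "(\<Sum>v\<in>verts G. deg G v) \<le> (\<Sum>v\<in>verts G. order G)"
    unfolding deg_def order_def
    by (intro sum_mono card_mono verts_finite[OF G] nbrs_subset[OF G])
  then show ?thesis unfolding handshake[OF G] by (simp add: order_def)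
qed

lemma induced_self: "finite_simple_graph G \<Longrightarrow> edges (induced G (verts G)) = edges G"
  by (auto simp: edges_induced finite_simple_graph_def)

lemma del_induced: "del (induced G W) X = induced G (W - X)"
  by (auto simp: del_def induced_def edges_def verts_def)

text \<open>The ratio 8/5 is below 2, so a set can beat the whole graph only with density above 1/4.
  It is above 4/3, so already at density 1/4 the minimum degree is about \<open>2 m / 5\<close>,
  more than a third of the order.\<close>

lemma dense_core:
  fixes G :: "'a ugraph"
  assumes G: "finite_simple_graph G" and n: "order G = n" "440 \<le> n" and e: "n * n < 4 * num_edges G"
  obtains W \<delta> where "W \<subseteq> verts G" "\<And>v. v \<in> W \<Longrightarrow> \<delta> \<le> deg (induced G W) v"
    "1414 * int n - 28000 \<le> 10000 * int \<delta>" "int n - 21 \<le> 5 * (3 * int \<delta> - int (card W))"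
    "card W * card W < 4 * num_edges (induced G W)" "W \<noteq> {}"
proof -
  let ?e = "\<lambda>W. real (num_edges (induced G W))" and ?m = "\<lambda>W. real (card W)"
  have fV: "finite (verts G)" by (rule verts_finite[OF G])
  have neV: "verts G \<noteq> {}" using n by (auto simp: order_def)
  obtain W where W: "W \<in> Pow (verts G) - {{}}"
    and max: "\<And>Z. Z \<in> Pow (verts G) - {{}} \<Longrightarrow> ?e Z ^ 5 / ?m Z ^ 8 \<le> ?e W ^ 5 / ?m W ^ 8"
    using finite_max[of "Pow (verts G) - {{}}" "verts G" "\<lambda>W. ?e W ^ 5 / ?m W ^ 8"] fV neV by auto
  define H where "H = induced G W"
  have H: "finite_simple_graph H" "verts H = W" "order H = card W"
    using induced_simple[OF G] W by (auto simp: H_def order_def)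
  have fW: "finite W" using W fV finite_subset by blast
  define m where "m = ?m W"
  define ee where "ee = ?e W"
  have m0: "0 < m" using W fW by (auto simp: m_def card_gt_0_iff)
  have mn: "m \<le> real n" using W fV n by (auto simp: m_def order_def intro: card_mono)
  have base: "(real n)\<^sup>2 / 1024 < ee ^ 5 / m ^ 8"
  proof -
    have V: "?e (verts G) = real (num_edges G)" by (simp add: num_edges_def induced_self[OF G])
    have "real (n * n) < real (4 * num_edges G)" using e by (simp only: of_nat_less_iff)
    then have "(real n)\<^sup>2 / 4 < real (num_edges G)" by (simp add: power2_eq_square)
    then have "((real n)\<^sup>2 / 4) ^ 5 < real (num_edges G) ^ 5" by (intro power_strict_mono) auto
    then have "((real n)\<^sup>2 / 4) ^ 5 / real n ^ 8 < real (num_edges G) ^ 5 / real n ^ 8"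
      using n by (intro divide_strict_right_mono) auto
    also have "\<dots> \<le> ee ^ 5 / m ^ 8"
      using max[of "verts G"] neV V n by (simp add: ee_def m_def order_def)
    also have "((real n)\<^sup>2 / 4) ^ 5 / real n ^ 8 = (real n)\<^sup>2 / 1024"
      using n by (simp add: field_simps eval_nat_numeral)
    finally show ?thesis .
  qed
  have e0: "0 < ee"
  proof (rule ccontr)
    assume "\<not> ?thesis"
    then have "ee = 0" by (simp add: ee_def)
    then show False using base by (simp add: not_less[symmetric])
  qed
  define u where "u = ee / m\<^sup>2"
  have eu: "ee = u * m\<^sup>2" using m0 by (simp add: u_def)
  have u0: "0 < u" using e0 m0 by (simp add: u_def)
  have R2: "(real n)\<^sup>2 < 1024 * u ^ 5 * m\<^sup>2"
  proof -
    have "ee ^ 5 / m ^ 8 = u ^ 5 * m\<^sup>2" unfolding eu using m0 by (simp add: field_simps eval_nat_numeral)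
    then show ?thesis using base by simp
  qed
  have u2: "u \<le> 1 / 2"
  proof -
    have "real (2 * num_edges H) \<le> real (card W * card W)" using num_edges_le[OF H(1)] H(3) by (simp only: of_nat_le_iff)
    then have "2 * ee \<le> m\<^sup>2" by (simp add: ee_def m_def H_def power2_eq_square)
    then show ?thesis using m0 by (simp add: u_def field_simps)
  qed
  have u4: "1 / 4 < u"
  proof (rule power_less_imp_less_base)
    have "m\<^sup>2 \<le> (real n)\<^sup>2" using mn m0 by (intro power_mono) auto
    then have "m\<^sup>2 * 1 < m\<^sup>2 * (1024 * u ^ 5)" using R2 by (simp add: mult.commute)
    then have "1 < 1024 * u ^ 5" using m0 by (simp only: mult_less_cancel_left_pos zero_less_power)
    then show "(1 / 4) ^ 5 < u ^ 5" by (simp add: power_divide)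
  qed (use u0 in simp)
  have R1: "8 * u * m - 28 * u \<le> 5 * real (deg H v)" if v: "v \<in> W" for v
  proof -
    define d where "d = real (deg H v)"
    have del: "real (num_edges (induced G (W - {v}))) = ee - d"
      using del_edges[OF H(1), of v] by (simp add: H_def del_induced ee_def d_def)
    have "2 \<le> card W"
    proof (rule ccontr)
      assume "\<not> ?thesis"
      then have "card W = 1" using m0 by (simp add: m_def)
      then have "2 * ee \<le> 1" using num_edges_le[OF H(1)] H(3) by (simp add: ee_def H_def)
      then show False using e0 by (simp add: ee_def)
    qed
    then have m2: "2 \<le> m" "?m (W - {v}) = m - 1" using v fW by (simp_all add: m_def)
    have "W - {v} \<in> Pow (verts G) - {{}}"
    proof -
      have "card (W - {v}) \<noteq> 0" using m2 by linarith
      then have "W - {v} \<noteq> {}" by (metis card.empty)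
      then show ?thesis using W by auto
    qed
    from max[OF this] have ineq: "(ee - d) ^ 5 / (m - 1) ^ 8 \<le> ee ^ 5 / m ^ 8"
      unfolding del m2(2) ee_def[symmetric] m_def[symmetric] .
    have dle: "d \<le> ee"
    proof -
      have "0 \<le> ee - d" unfolding del[symmetric] by simp
      then show ?thesis by simp
    qed
    \<comment> \<open>Maximality against \<open>W - {v}\<close>; Bernoulli from below and
      \<open>power_quadratic\<close> from above make the inequality linear in
      \<open>d\<close>.\<close>
    have "(1 - d / ee) ^ 5 \<le> (1 - 1 / m) ^ 8"
    proof -
      have "(ee - d) ^ 5 / ee ^ 5 \<le> (m - 1) ^ 8 / m ^ 8"
        using ineq e0 m0 m2 by (simp add: field_simps)
      moreover have "1 - d / ee = (ee - d) / ee" "1 - 1 / m = (m - 1) / m" using e0 m0 by (simp_all add: field_simps)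
      ultimately show ?thesis by (simp only: power_divide)
    qed
    also have "\<dots> \<le> 1 - 8 * (1 / m) + 28 * (1 / m)\<^sup>2"
      using power_quadratic[of "1 / m" 8] m2 by simp
    finally have "(1 - d / ee) ^ 5 \<le> 1 - 8 * (1 / m) + 28 * (1 / m)\<^sup>2" .
    moreover have "1 + real 5 * (- (d / ee)) \<le> (1 + - (d / ee)) ^ 5"
      by (rule Bernoulli_inequality) (use dle e0 in simp)
    ultimately have "8 * (1 / m) - 28 * (1 / m)\<^sup>2 \<le> 5 * (d / ee)" by simp
    then have "(8 * (1 / m) - 28 * (1 / m)\<^sup>2) * ee \<le> 5 * (d / ee) * ee" using e0 by (intro mult_right_mono) auto
    moreover have "(8 * (1 / m) - 28 * (1 / m)\<^sup>2) * ee = 8 * u * m - 28 * u"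
      unfolding eu using m0 by (simp add: field_simps power2_eq_square)
    moreover have "5 * (d / ee) * ee = 5 * d" using e0 by simp
    ultimately show ?thesis unfolding d_def by simp
  qed
  obtain v where v: "v \<in> W" "\<And>w. w \<in> W \<Longrightarrow> deg H v \<le> deg H w"
  proof -
    obtain w where "w \<in> W" using W by blast
    then obtain v where "v \<in> W" "\<And>z. z \<in> W \<Longrightarrow> - int (deg H z) \<le> - int (deg H v)"
      using finite_max[OF fW, of w "\<lambda>z. - int (deg H z)"] by blast
    then show thesis using that[of v] by simp
  qed
  have num: "1414 * real n - 28000 \<le> 10000 * real (deg H v)" "real n - 21 \<le> 5 * (3 * real (deg H v) - m)"
    using dense_core_numeric[of "real n" m u "real (deg H v)"] n mn m0 u2 u4 R1[OF v(1)] R2 by simp_all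
  show thesis
  proof (rule that[of W "deg H v"])
    have "real_of_int (1414 * int n - 28000) \<le> real_of_int (10000 * int (deg H v))" using num(1) by simp
    then show "1414 * int n - 28000 \<le> 10000 * int (deg H v)" by (simp only: of_int_le_iff)
    have "real_of_int (int n - 21) \<le> real_of_int (5 * (3 * int (deg H v) - int (card W)))"
      using num(2) by (simp add: m_def)
    then show "int n - 21 \<le> 5 * (3 * int (deg H v) - int (card W))" by (simp only: of_int_le_iff)
    have "m\<^sup>2 < 4 * ee" unfolding eu using u4 m0 by simp
    then have "real (card W * card W) < real (4 * num_edges (induced G W))"
      by (simp add: m_def ee_def power2_eq_square)
    then show "card W * card W < 4 * num_edges (induced G W)" by (simp only: of_nat_less_iff)
  qed (use W v in \<open>auto simp: H_def\<close>)
qed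

context gcyc
begin

text \<open>The detours \<open>[a, b, c]\<close> with \<open>a\<close>, \<open>c\<close> in
  \<open>S\<close> and \<open>b\<close> in \<open>R\<close> number the sum of
  \<open>y (y - 1)\<close>, where \<open>y\<close> counts the neighbours of \<open>b\<close> in
  \<open>S\<close>. This is bounded linearly by \<open>(y - q) (y - q - 1) >= 0\<close>, with
  \<open>q\<close> near the mean of \<open>y\<close>.\<close>

lemma three_detours:
  fixes q D :: int
  assumes S: "finite S" "S \<subseteq> nbrs G (x i) \<inter> nbrs G (x (i + m)) - range x"
    and R: "finite R" "R \<inter> range x = {}"
    and D: "\<And>a. a \<in> S \<Longrightarrow> D \<le> int (card (nbrs G a \<inter> R))" and m: "1 \<le> m" "m \<le> n - 1"
    and q: "0 \<le> q"
  shows "2 * q * (int (card S) * D) - q * (q + 1) * int (card R) \<le> int (num_cycles (nat (n - m + 1) + 3) G)"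
proof -
  let ?d = "\<lambda>b. int (card (S \<inter> nbrs G b))"
  let ?A = "SIGMA b:R. SIGMA a:S \<inter> nbrs G b. S \<inter> nbrs G b - {a}"
  have "card ((\<lambda>(b, a, c). [a, b, c]) ` ?A) \<le> num_cycles (nat (n - m + 1) + 3) G"
  proof (rule card_detours[OF _ m])
    fix ws assume "ws \<in> (\<lambda>(b, a, c). [a, b, c]) ` ?A"
    then obtain a b c where ws: "ws = [a, b, c]" "b \<in> R" "a \<in> S" "c \<in> S" "adj G b a" "adj G b c" "c \<noteq> a"
      by (auto simp: nbrs_def)
    then have "adj G (x i) a" "adj G (x (i + m)) c" "a \<notin> range x" "c \<notin> range x" "b \<notin> range x"
      using S(2) R(2) by (auto simp: nbrs_def)
    moreover have "b \<noteq> a" "b \<noteq> c" using adj_neq[OF simple] ws by auto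
    ultimately show "detour i m ws \<and> length ws = 3"
      using ws by (auto simp: detour_def adj_def insert_commute)
  qed
  moreover have "card ((\<lambda>(b, a, c). [a, b, c]) ` ?A) = card ?A"
    by (rule card_image) (auto simp: inj_on_def)
  moreover have "int (card ?A) = (\<Sum>b\<in>R. ?d b * (?d b - 1))"
  proof -
    have "card (SIGMA a:S \<inter> nbrs G b. S \<inter> nbrs G b - {a}) = card (S \<inter> nbrs G b) * (card (S \<inter> nbrs G b) - 1)" for b
      using S(1) by (subst card_SigmaI) (auto simp: card_Diff_singleton)
    moreover have "card ?A = (\<Sum>b\<in>R. card (SIGMA a:S \<inter> nbrs G b. S \<inter> nbrs G b - {a}))"
      using S(1) R(1) by (intro card_SigmaI) auto
    moreover have "int (k * (k - 1)) = int k * (int k - 1)" for k by (cases k) (auto simp: algebra_simps)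
    ultimately show ?thesis by (simp only: of_nat_sum)
  qed
  moreover have "2 * q * (\<Sum>b\<in>R. ?d b) - q * (q + 1) * int (card R) \<le> (\<Sum>b\<in>R. ?d b * (?d b - 1))"
  proof -
    have "2 * q * y - q * (q + 1) \<le> y * (y - 1)" for y :: int
    proof -
      have "0 \<le> (y - q) * (y - q - 1)"
        by (cases "y \<le> q") (auto intro: mult_nonneg_nonneg mult_nonpos_nonpos)
      then show ?thesis by (simp add: algebra_simps)
    qed
    then have "(\<Sum>b\<in>R. 2 * q * ?d b - q * (q + 1)) \<le> (\<Sum>b\<in>R. ?d b * (?d b - 1))" by (intro sum_mono)
    then show ?thesis unfolding sum_subtractf sum_distrib_left[symmetric] by (simp add: ac_simps)
  qed
  moreover have "int (card S) * D \<le> (\<Sum>b\<in>R. ?d b)"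
  proof -
    have "int (card S) * D = (\<Sum>a\<in>S. D)" by simp
    also have "\<dots> \<le> (\<Sum>a\<in>S. int (card {b \<in> R. adj G a b}))"
    proof (rule sum_mono)
      fix a assume "a \<in> S"
      moreover have "nbrs G a \<inter> R = {b \<in> R. adj G a b}" by (auto simp: nbrs_def)
      ultimately show "D \<le> int (card {b \<in> R. adj G a b})" using D[of a] by simp
    qed
    also have "\<dots> = (\<Sum>a\<in>S. \<Sum>b\<in>R. of_bool (adj G a b))" by (simp only: card_of_bool[OF R(1)])
    also have "\<dots> = (\<Sum>b\<in>R. \<Sum>a\<in>S. of_bool (adj G a b))" by (rule sum.swap)
    also have "\<dots> = (\<Sum>b\<in>R. int (card {a \<in> S. adj G a b}))" by (simp only: card_of_bool[OF S(1)])
    also have "\<dots> = (\<Sum>b\<in>R. ?d b)"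
      by (intro sum.cong arg_cong[where f = "\<lambda>A. int (card A)"]) (auto simp: nbrs_def adj_sym)
    finally show ?thesis .
  qed
  then have "2 * q * (int (card S) * D) \<le> 2 * q * (\<Sum>b\<in>R. ?d b)" using q by (intro mult_left_mono) auto
  ultimately show ?thesis by linarith
qed

text \<open>Two vertices are inserted into the edge \<open>x 0 x 1\<close> or into
  \<open>x 1 x 2\<close>; only the first kind keeps \<open>x 1 x 2\<close>, so the kinds are
  disjoint. Using both edges, a neighbour \<open>w\<close> of \<open>x 1\<close> needs many
  neighbours only in the union of the other two neighbourhoods.\<close>

lemma two_detours:
  fixes s :: int
  assumes R: "R = verts G - range x"
    and s: "\<And>w. w \<in> nbrs G (x 1) \<inter> R \<Longrightarrow> s \<le> int (card (nbrs G w \<inter> ((nbrs G (x 0) \<union> nbrs G (x 2)) \<inter> R)))"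
  shows "int (card (nbrs G (x 1) \<inter> R)) * s \<le> int (num_cycles (nat (n + 2)) G)"
proof -
  let ?X = "nbrs G (x 0) \<inter> R" and ?Y = "nbrs G (x 1) \<inter> R" and ?Z = "nbrs G (x 2) \<inter> R"
  have fin: "finite ?X" "finite ?Y" "finite ?Z" "finite (nbrs G v)" for v using nbrs_finite[OF simple] by auto
  let ?A = "SIGMA w:?Y. nbrs G w \<inter> ?X" and ?B = "SIGMA w:?Y. nbrs G w \<inter> ?Z"
  define F where "F = (\<lambda>p. case p of Inl (w, a) \<Rightarrow> ins 0 1 [a, w] | Inr (w, b) \<Rightarrow> ins 1 1 [w, b])"
  have RR: "v \<notin> range x" if "v \<in> R" for v using that R by simp
  have dA: "detour 0 1 [a, w]" if "(w, a) \<in> ?A" for w a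
    using that RR[of a] RR[of w] adj_neq[OF simple, of w a]
    by (auto simp: detour_def nbrs_def adj_def insert_commute)
  have dB: "detour 1 1 [w, b]" if "(w, b) \<in> ?B" for w b
    using that RR[of b] RR[of w] adj_neq[OF simple, of w b]
    by (auto simp: detour_def nbrs_def adj_def insert_commute)
  have inA: "{x 1, x 2} \<in> cycle_edges (ins 0 1 ws)" for ws
  proof -
    have "{x 1, x 2} \<in> path_edges (map x [1..n])" unfolding path_edges_int using n3 by force
    then show ?thesis
      unfolding cycle_edges_def ins_def using n3 by (cases "ws = []") (auto simp: path_edges_append)
  qed
  have notB: "{x 1, x 2} \<notin> cycle_edges (ins 1 1 [w, b])" if "(w, b) \<in> ?B" for w b
  proof
    assume e: "{x 1, x 2} \<in> cycle_edges (ins 1 1 [w, b])"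
    have wb: "w \<notin> range x" "b \<notin> range x" using that RR by auto
    have "map x [1 + 1..1 + n] \<noteq> []" using n3 by simp
    then have "{x 1, x 2} \<in> path_edges (map x [1 + 1..1 + n]) \<or> w \<in> {x 1, x 2} \<or> b \<in> {x 1, x 2}"
      using e unfolding cycle_edges_def ins_def by (auto simp: path_edges_append)
    then have "{x 1, x 2} \<in> path_edges (map x [1 + 1..1 + n])" using wb by auto
    then obtain j where j: "j \<in> {2..<1 + n}" "{x 1, x (1 + 1)} = {x j, x (j + 1)}"
      unfolding path_edges_int by auto
    then have "x 1 = x j \<or> 1 + 1 = n" using chord_eq[OF j(2)] n3 by auto
    then show False using x_near[of 1 j] j n3 by auto
  qed
  have "card (?A <+> ?B) \<le> num_cycles (nat (n + 2)) G"
  proof (rule num_cycles_ge[OF simple, where F = F])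
    fix p assume p: "p \<in> ?A <+> ?B"
    then consider w a where "p = Inl (w, a)" "(w, a) \<in> ?A" | w b where "p = Inr (w, b)" "(w, b) \<in> ?B"
      by auto
    then show "cyc G (F p) \<and> length (F p) = nat (n + 2)"
    proof cases
      case 1 then show ?thesis using ins_cyc[OF dA[OF 1(2)]] n3 by (simp add: F_def)
    next
      case 2 then show ?thesis using ins_cyc[OF dB[OF 2(2)]] n3 by (simp add: F_def)
    qed
  next
    have AA: "w = w' \<and> a = a'" if o: "(w, a) \<in> ?A" "(w', a') \<in> ?A"
      "cycle_edges (ins 0 1 [a, w]) = cycle_edges (ins 0 1 [a', w'])" for w a w' a'
      using ins_inj[OF dA[OF o(1)] dA[OF o(2)]] o(3) n3 by simp
    have BB: "w = w' \<and> a = a'" if o: "(w, a) \<in> ?B" "(w', a') \<in> ?B"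
      "cycle_edges (ins 1 1 [w, a]) = cycle_edges (ins 1 1 [w', a'])" for w a w' a'
      using ins_inj[OF dB[OF o(1)] dB[OF o(2)]] o(3) n3 by simp
    show "inj_on (\<lambda>p. cycle_edges (F p)) (?A <+> ?B)"
    proof (rule inj_onI)
      fix p p' assume p: "p \<in> ?A <+> ?B" "p' \<in> ?A <+> ?B" and e: "cycle_edges (F p) = cycle_edges (F p')"
      consider w a w' a' where "p = Inl (w, a)" "(w, a) \<in> ?A" "p' = Inl (w', a')" "(w', a') \<in> ?A"
        | w a w' a' where "p = Inr (w, a)" "(w, a) \<in> ?B" "p' = Inr (w', a')" "(w', a') \<in> ?B"
        | w a w' a' where "p = Inl (w, a)" "(w, a) \<in> ?A" "p' = Inr (w', a')" "(w', a') \<in> ?B"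
        | w a w' a' where "p = Inr (w, a)" "(w, a) \<in> ?B" "p' = Inl (w', a')" "(w', a') \<in> ?A"
        using p by (elim PlusE) auto
      then show "p = p'"
      proof cases
        case (1 w a w' a') then show ?thesis using AA[of w a w' a'] e by (simp add: F_def)
      next
        case (2 w a w' a') then show ?thesis using BB[of w a w' a'] e by (simp add: F_def)
      next
        case (3 w a w' a') then show ?thesis using inA[of "[a, w]"] notB[of w' a'] e by (simp add: F_def)
      next
        case (4 w a w' a') then show ?thesis using inA[of "[a', w']"] notB[of w a] e by (simp add: F_def)
      qed
    qed
  qed
  moreover have "int (card ?Y) * s \<le> int (card (?A <+> ?B))"
  proof -
    have "int (card ?Y) * s = (\<Sum>w\<in>?Y. s)" by simp
    also have "\<dots> \<le> (\<Sum>w\<in>?Y. int (card (nbrs G w \<inter> ?X) + card (nbrs G w \<inter> ?Z)))"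
    proof (rule sum_mono)
      fix w assume w: "w \<in> ?Y"
      have "nbrs G w \<inter> ((nbrs G (x 0) \<union> nbrs G (x 2)) \<inter> R) = (nbrs G w \<inter> ?X) \<union> (nbrs G w \<inter> ?Z)" by auto
      then show "s \<le> int (card (nbrs G w \<inter> ?X) + card (nbrs G w \<inter> ?Z))"
        using s[OF w] card_Un_le[of "nbrs G w \<inter> ?X" "nbrs G w \<inter> ?Z"] by simp
    qed
    also have "\<dots> = int (card ?A) + int (card ?B)"
      using fin by (simp add: sum.distrib)
    also have "\<dots> = int (card (?A <+> ?B))"
      using fin by (subst card_Plus) auto
    finally show ?thesis .
  qed
  ultimately show ?thesis by linarith
qed

text \<open>If \<open>x 0\<close> and \<open>x 2\<close> share nine outside neighbours, replace
  \<open>x 1\<close> by three vertices. Otherwise their outside neighbourhoods are nearly disjoint,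
  and since three minimum degrees exceed the order, every neighbourhood meets the union
  substantially.\<close>

lemma extend_cycle:
  fixes \<delta> N :: int
  assumes \<delta>: "\<And>v. v \<in> verts G \<Longrightarrow> \<delta> \<le> int (deg G v)"
    and n: "n \<le> 30" and N: "440 \<le> N" "1414 * N - 28000 \<le> 10000 * \<delta>" "N - 21 \<le> 5 * (3 * \<delta> - int (order G))"
  shows "N \<le> int (num_cycles (nat (n + 2)) G)"
proof -
  define R where "R = verts G - range x"
  have xV: "range x \<subseteq> verts G" using x_verts by auto
  have fR: "finite R" using verts_finite[OF simple] by (simp add: R_def)
  have cR: "int (card R) = int (order G) - n"
  proof -
    have "card R = card (verts G) - card (range x)" "card (range x) \<le> card (verts G)"
      using xV verts_finite[OF simple] finite_range by (auto simp: R_def card_Diff_subset card_mono)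
    then show ?thesis using card_range n3 by (simp add: order_def)
  qed
  define D where "D = \<delta> - n"
  have D30: "30 \<le> D" using n N by (simp add: D_def)
  have DR: "D \<le> int (card (nbrs G v \<inter> R))" if "v \<in> verts G" for v
  proof -
    have "nbrs G v \<subseteq> (nbrs G v \<inter> R) \<union> range x" using nbrs_subset[OF simple] by (auto simp: R_def)
    then have "deg G v \<le> card ((nbrs G v \<inter> R) \<union> range x)"
      unfolding deg_def using fR finite_range by (intro card_mono) auto
    also have "\<dots> \<le> card (nbrs G v \<inter> R) + nat n" using card_Un_le[of "nbrs G v \<inter> R" "range x"] card_range by simp
    finally show ?thesis using \<delta>[OF that] n3 by (simp add: D_def)
  qed
  let ?X = "nbrs G (x 0) \<inter> R" and ?Y = "nbrs G (x 1) \<inter> R" and ?Z = "nbrs G (x 2) \<inter> R"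
  have XYZ: "D \<le> int (card ?X)" "D \<le> int (card ?Y)" "D \<le> int (card ?Z)" using DR x_verts by auto
  show ?thesis
  proof (cases "9 \<le> card (?X \<inter> ?Z)")
    case True
    then obtain S where S: "S \<subseteq> ?X \<inter> ?Z" "card S = 9" "finite S"
      using obtain_subset_with_card_n by metis
    have "2 * 2 * (int (card S) * D) - 2 * (2 + 1) * int (card R) \<le> int (num_cycles (nat (n - 2 + 1) + 3) G)"
      by (rule three_detours[of S 0 2 R D 2]) (use S fR DR n3 in \<open>auto simp: R_def\<close>)
    moreover have "nat (n - 2 + 1) + 3 = nat (n + 2)" using n3 by simp
    ultimately show ?thesis unfolding cR S(2) using N n D30 unfolding D_def by simp
  next
    case False
    \<comment> \<open>This is \<open>D + (2 * D - 8) - card R\<close>, the overlap forced inside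
      \<open>R\<close>.\<close>
    define s where "s = 3 * \<delta> - int (order G) - 2 * n - 8"
    have XZ: "2 * D - 8 \<le> int (card (?X \<union> ?Z))"
      using card_Un_Int[of ?X ?Z] fR False XYZ by simp
    have "int (card ?Y) * s \<le> int (num_cycles (nat (n + 2)) G)"
    proof (rule two_detours[OF R_def])
      have aux: "s \<le> int c" if "a + b \<le> r + c" "D \<le> int a" "2 * D - 8 \<le> int b" "int r = int (order G) - n"
        for a b c r :: nat
      proof -
        have "int a + int b \<le> int r + int c" using that(1) by (simp only: of_nat_add[symmetric] of_nat_le_iff)
        then show ?thesis using that(2-4) unfolding s_def D_def by (smt (verit))
      qed
      fix w assume w: "w \<in> nbrs G (x 1) \<inter> R"
      then have wV: "w \<in> verts G" by (simp add: R_def)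
      let ?A = "nbrs G w \<inter> R" and ?B = "?X \<union> ?Z"
      have "card (?A \<union> ?B) \<le> card R" using fR by (intro card_mono) auto
      moreover have "card ?A + card ?B = card (?A \<union> ?B) + card (?A \<inter> ?B)"
        using fR by (intro card_Un_Int) auto
      moreover have "?A \<inter> ?B = nbrs G w \<inter> ((nbrs G (x 0) \<union> nbrs G (x 2)) \<inter> R)" by auto
      ultimately have "card ?A + card ?B \<le> card R + card (nbrs G w \<inter> ((nbrs G (x 0) \<union> nbrs G (x 2)) \<inter> R))"
        by simp
      then show "s \<le> int (card (nbrs G w \<inter> ((nbrs G (x 0) \<union> nbrs G (x 2)) \<inter> R)))"
        by (rule aux[OF _ DR[OF wV] XZ cR])
    qed
    \<comment> \<open>At least \<open>30 s >= 6 (N - 361)\<close> cycles arise, and this reaches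
      \<open>N\<close> because \<open>5 N >= 2166\<close>.\<close>
    moreover have s0: "N - 361 \<le> 5 * s" using N n by (simp add: s_def)
    then have "30 * s \<le> int (card ?Y) * s" using XYZ(2) D30 N by (intro mult_right_mono) linarith+
    ultimately show ?thesis using s0 N by linarith
  qed
qed

end


text \<open>Cauchy-Schwarz for the degrees in the division-free form
  \<open>(m y - 2 e)^2 >= 0\<close>, against \<open>triangles_ge\<close> with no triangles.\<close>

lemma mantel:
  assumes G: "finite_simple_graph G" and e: "order G * order G < 4 * num_edges G"
  shows "triangles G \<noteq> {}"
proof
  assume "triangles G = {}"
  then have T: "(\<Sum>v\<in>verts G. int (deg G v) * int (deg G v)) \<le> int (order G) * int (num_edges G)"
    using triangles_ge[OF G] by simp
  let ?m = "int (order G)" and ?e = "int (num_edges G)"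
  have sq: "4 * ?e * ?m * y - 4 * ?e * ?e \<le> ?m * ?m * (y * y)" for y :: int
    using zero_le_square[of "?m * y - 2 * ?e"] by (simp add: algebra_simps)
  have "(\<Sum>v\<in>verts G. 4 * ?e * ?m * int (deg G v) - 4 * ?e * ?e)
      \<le> (\<Sum>v\<in>verts G. ?m * ?m * (int (deg G v) * int (deg G v)))"
    by (intro sum_mono sq)
  then have "4 * ?e * ?m * (2 * ?e) - ?m * (4 * ?e * ?e)
      \<le> ?m * ?m * (\<Sum>v\<in>verts G. int (deg G v) * int (deg G v))"
    unfolding sum_subtractf sum_distrib_left[symmetric] sum_deg_int[OF G] by (simp add: order_def)
  also have "\<dots> \<le> ?m * ?m * (?m * ?e)" using T by (intro mult_left_mono) auto
  finally have "(4 * ?e) * (?m * ?e) \<le> (?m * ?m) * (?m * ?e)" by (simp add: algebra_simps)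
  moreover have "int (order G * order G) < int (4 * num_edges G)" using e by (simp only: of_nat_less_iff)
  then have lt: "?m * ?m < 4 * ?e" by simp
  moreover have "0 < ?m * ?e"
  proof -
    have "0 < num_edges G" using e by (cases "num_edges G") auto
    then have "edges G \<noteq> {}" by (auto simp: num_edges_def)
    then obtain f where "f \<in> edges G" by blast
    then have "f \<noteq> {}" "f \<subseteq> verts G" using G by (auto simp: finite_simple_graph_def)
    then have "verts G \<noteq> {}" by blast
    then have "0 < order G" using verts_finite[OF G] by (simp add: order_def card_gt_0_iff)
    then show ?thesis using \<open>0 < num_edges G\<close> by simp
  qed
  ultimately show False by (metis mult_right_less_imp_less mult_less_cancel_right_pos not_le)
qed

text \<open>The starting point for even lengths. If there are fewer than \<open>N\<close> 4-cycles,
  then each edge \<open>vu\<close> lies in fewer than \<open>N\<close>; summing over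
  \<open>u\<close> bounds \<open>q_w (q_w - 1)\<close>, with \<open>q_w\<close> the codegree of
  \<open>v\<close> and \<open>w\<close>. But the \<open>q_w\<close> have sum at least
  \<open>d (\<delta> - 1)\<close> over at most \<open>3 d\<close> vertices.\<close>

lemma four_cycles:
  fixes \<delta> N :: int
  assumes G: "finite_simple_graph G" and v: "v \<in> verts G"
    and \<delta>: "\<And>v. v \<in> verts G \<Longrightarrow> \<delta> \<le> int (deg G v)"
    and N: "440 \<le> N" "1414 * N - 28000 \<le> 10000 * \<delta>" "N - 21 \<le> 5 * (3 * \<delta> - int (order G))"
  shows "N \<le> int (num_cycles 4 G)"
proof (rule ccontr)
  assume small: "\<not> ?thesis"
  let ?A = "\<lambda>u. SIGMA w:nbrs G u - {v}. nbrs G v \<inter> nbrs G w - {u}"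
  let ?q = "\<lambda>w. int (card (nbrs G v \<inter> nbrs G w))"
  have fin: "finite (nbrs G u)" for u by (rule nbrs_finite[OF G])
  have A: "int (card (?A u)) \<le> N" if u: "u \<in> nbrs G v" for u
  proof -
    have uv: "adj G v u" "u \<noteq> v" using u adj_neq[OF G, of v u] by (auto simp: nbrs_def)
    have "card (?A u) \<le> num_cycles 4 G"
    proof (rule num_cycles_ge[OF G, where F = "\<lambda>(w, u'). [v, u, w, u']"])
      fix p assume "p \<in> ?A u"
      then obtain w u' where p: "p = (w, u')" "adj G u w" "w \<noteq> v" "adj G v u'" "adj G w u'" "u' \<noteq> u"
        by (auto simp: nbrs_def)
      have "u \<noteq> w" "v \<noteq> u'" "w \<noteq> u'" using adj_neq[OF G] p by auto
      then show "cyc G (case p of (w, u') \<Rightarrow> [v, u, w, u']) \<and> length (case p of (w, u') \<Rightarrow> [v, u, w, u']) = 4"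
        using p uv by (auto simp: cyc_def cycle_edges_def adj_def insert_commute)
    next
      show "inj_on (\<lambda>p. cycle_edges (case p of (w, u') \<Rightarrow> [v, u, w, u'])) (?A u)"
      proof (rule inj_onI)
        fix p p' assume pp: "p \<in> ?A u" "p' \<in> ?A u"
          and e: "cycle_edges (case p of (w, u') \<Rightarrow> [v, u, w, u']) = cycle_edges (case p' of (w, u') \<Rightarrow> [v, u, w, u'])"
        obtain w u' where p: "p = (w, u')" "adj G u w" "w \<noteq> v" "adj G v u'" "adj G w u'" "u' \<noteq> u"
          using pp(1) by (auto simp: nbrs_def)
        obtain y z where p': "p' = (y, z)" "adj G u y" "y \<noteq> v" "adj G v z" "adj G y z" "z \<noteq> u"
          using pp(2) by (auto simp: nbrs_def)
        have "u \<noteq> w" "v \<noteq> u'" "w \<noteq> u'" "u \<noteq> y" "v \<noteq> z" "y \<noteq> z" using adj_neq[OF G] p p' by auto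
        then have "[v, u, w, u'] = [v, u, y, z]"
          using e p p' uv by (intro cycle_edges_unique) auto
        then show "p = p'" using p p' by simp
      qed
    qed
    then show ?thesis using small by simp
  qed
  let ?V = "verts G - {v}"
  have nV: "nbrs G v = {u \<in> verts G. adj G v u}" using nbrs_subset[OF G] by (auto simp: nbrs_def)
  have swap: "(\<Sum>u\<in>nbrs G v. \<Sum>w\<in>nbrs G u - {v}. f w) = (\<Sum>w\<in>?V. ?q w * f w)" for f :: "'a \<Rightarrow> int"
  proof -
    have "(\<Sum>u\<in>nbrs G v. \<Sum>w\<in>nbrs G u - {v}. f w) = (\<Sum>u\<in>nbrs G v. \<Sum>w\<in>{w \<in> ?V. adj G u w}. f w)"
      using adj_verts[OF G] by (intro sum.cong) (auto simp: nbrs_def)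
    also have "\<dots> = (\<Sum>w\<in>?V. \<Sum>u\<in>{u \<in> nbrs G v. adj G u w}. f w)"
      using fin verts_finite[OF G] by (intro sum.swap_restrict) auto
    also have "\<dots> = (\<Sum>w\<in>?V. ?q w * f w)"
    proof (rule sum.cong[OF refl])
      fix w
      have "{u \<in> nbrs G v. adj G u w} = nbrs G v \<inter> nbrs G w" by (auto simp: nbrs_def adj_sym)
      then show "(\<Sum>u\<in>{u \<in> nbrs G v. adj G u w}. f w) = ?q w * f w" by simp
    qed
    finally show ?thesis .
  qed
  define d where "d = int (deg G v)"
  have d: "\<delta> \<le> d" using \<delta>[OF v] by (simp add: d_def)
  have "(\<Sum>w\<in>?V. ?q w * (?q w - 1)) = (\<Sum>u\<in>nbrs G v. int (card (?A u)))"
  proof -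
    have "int (card (?A u)) = (\<Sum>w\<in>nbrs G u - {v}. ?q w - 1)" if u: "u \<in> nbrs G v" for u
    proof -
      have "card (?A u) = (\<Sum>w\<in>nbrs G u - {v}. card (nbrs G v \<inter> nbrs G w - {u}))"
        using fin by (intro card_SigmaI) auto
      moreover have "int (card (nbrs G v \<inter> nbrs G w - {u})) = ?q w - 1" if "w \<in> nbrs G u - {v}" for w
      proof -
        have "u \<in> nbrs G v \<inter> nbrs G w" using that u adj_sym[of G] by (auto simp: nbrs_def)
        then have "Suc (card (nbrs G v \<inter> nbrs G w - {u})) = card (nbrs G v \<inter> nbrs G w)"
          using fin by (intro card_Suc_Diff1) auto
        then show ?thesis by linarith
      qed
      ultimately show ?thesis by simp
    qed
    then show ?thesis unfolding swap[symmetric] by simp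
  qed
  also have "\<dots> \<le> (\<Sum>u\<in>nbrs G v. N)" by (intro sum_mono A)
  also have "\<dots> = d * N" by (simp add: d_def deg_def)
  finally have up: "(\<Sum>w\<in>?V. ?q w * (?q w - 1)) \<le> d * N" .
  \<comment> \<open>This is \<open>(y - 10) (y - 11) >= 0\<close> for integers; the constant 330
    below is 110 times the factor 3 in \<open>3 * d\<close>.\<close>
  have "20 * y - 110 \<le> y * (y - 1)" for y :: int
  proof -
    have "0 \<le> (y - 10) * (y - 11)"
      by (cases "y \<le> 10") (auto intro: mult_nonneg_nonneg mult_nonpos_nonpos)
    then show ?thesis by (simp add: algebra_simps)
  qed
  then have "(\<Sum>w\<in>?V. 20 * ?q w - 110) \<le> (\<Sum>w\<in>?V. ?q w * (?q w - 1))" by (intro sum_mono)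
  then have "20 * (\<Sum>w\<in>?V. ?q w) - 110 * int (card ?V) \<le> d * N"
    using up unfolding sum_subtractf sum_distrib_left[symmetric] by simp
  moreover have "d * (\<delta> - 1) \<le> (\<Sum>w\<in>?V. ?q w)"
  proof -
    have "(\<Sum>u\<in>nbrs G v. \<delta> - 1) \<le> (\<Sum>u\<in>nbrs G v. \<Sum>w\<in>nbrs G u - {v}. 1)"
    proof (rule sum_mono)
      fix u assume "u \<in> nbrs G v"
      then have "u \<in> verts G" using nbrs_subset[OF G] by blast
      then have "\<delta> \<le> int (card (nbrs G u))" using \<delta> by (simp add: deg_def)
      moreover have "card (nbrs G u) \<le> card (nbrs G u - {v}) + 1" using diff_card_le_card_Diff[of "{v}" "nbrs G u"] by simp
      ultimately show "\<delta> - 1 \<le> (\<Sum>w\<in>nbrs G u - {v}. 1)" by simp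
    qed
    then show ?thesis using swap[of "\<lambda>_. 1"] by (simp add: d_def deg_def)
  qed
  moreover have "int (card ?V) \<le> 3 * d"
  proof -
    have "card ?V \<le> order G" unfolding order_def using verts_finite[OF G] by (intro card_mono) auto
    then have "int (card ?V) \<le> int (order G)" by (simp only: of_nat_le_iff)
    then show ?thesis using d N by (smt (verit))
  qed
  ultimately have "20 * (d * (\<delta> - 1)) - 330 * d \<le> d * N" by linarith
  then have "d * (20 * (\<delta> - 1) - 330) \<le> d * N" by (simp add: algebra_simps)
  then have "20 * (\<delta> - 1) - 330 \<le> N" using d N by simp
  then have "20 * \<delta> \<le> N + 350" by simp
  then have "10000 * \<delta> \<le> 500 * N + 175000" by simp
  then have "914 * N \<le> 203000" using N(2) by simp
  then show False using N(1) by simp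
qed

theorem short_cycles:
  fixes G :: "'a ugraph"
  assumes G: "finite_simple_graph G" and n: "order G = n" "440 \<le> n" and e: "n * n < 4 * num_edges G"
    and l: "4 \<le> l" "l \<le> 32"
  shows "n \<le> num_cycles l G"
proof -
  obtain W \<delta> where W: "W \<subseteq> verts G" "\<And>v. v \<in> W \<Longrightarrow> \<delta> \<le> deg (induced G W) v"
    "1414 * int n - 28000 \<le> 10000 * int \<delta>" "int n - 21 \<le> 5 * (3 * int \<delta> - int (card W))"
    "card W * card W < 4 * num_edges (induced G W)" "W \<noteq> {}"
    using dense_core[OF G n e] by blast
  define H where "H = induced G W"
  have H: "finite_simple_graph H" "verts H = W" "order H = card W"
    using induced_simple[OF G] W by (auto simp: H_def order_def)
  have \<delta>: "int \<delta> \<le> int (deg H v)" if "v \<in> verts H" for v using that W(2) H by (simp add: H_def)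
  have N: "440 \<le> int n" "int n - 21 \<le> 5 * (3 * int \<delta> - int (order H))" using n W(4) H(3) by auto
  have 3: "0 < num_cycles 3 H"
  proof -
    have "triangles H \<noteq> {}" using mantel[OF H(1)] W(5) H(3) by (simp add: H_def)
    then have "0 < card (triangles H)" using triangles_finite[OF H(1)] by (simp add: card_gt_0_iff)
    then show ?thesis using num_cycles_triangles[OF H(1)] by linarith
  qed
  \<comment> \<open>Odd lengths grow from triangles and even ones from 4-cycles, two vertices at a
    time, all inside the core.\<close>
  have "0 < num_cycles k H \<and> (4 \<le> k \<longrightarrow> n \<le> num_cycles k H)" if "3 \<le> k" "k \<le> 32" for k
    using that
  proof (induction k rule: less_induct)
    case (less k)
    consider "k = 3" | "k = 4" | "5 \<le> k" using less.prems by linarith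
    then show ?case
    proof cases
      case 1 then show ?thesis using 3 by simp
    next
      case 2
      obtain v where "v \<in> verts H" using W(6) H(2) by auto
      then have "int n \<le> int (num_cycles 4 H)" using four_cycles[OF H(1) _ \<delta> N(1) W(3) N(2)] by blast
      then show ?thesis using 2 n by simp
    next
      case 3
      then have "0 < num_cycles (k - 2) H" using less.IH[of "k - 2"] less.prems by simp
      then obtain xs where xs: "cyc H xs" "length xs = k - 2" using num_cycles_obtain by blast
      interpret gcyc "\<lambda>i. xs ! nat (i mod int (length xs))" "int (length xs)" H
        by (rule list_gcyc(1)[OF H(1) xs(1)])
      have "int n \<le> int (num_cycles (nat (int (length xs) + 2)) H)"
        by (rule extend_cycle[OF \<delta> _ N(1) W(3) N(2)]) (use xs(2) less.prems in auto)
      moreover have "nat (int (length xs) + 2) = k" using xs(2) 3 by simp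
      ultimately show ?thesis using n by simp
    qed
  qed
  then have "n \<le> num_cycles l H" using l by simp
  also have "\<dots> \<le> num_cycles l G"
    unfolding H_def by (rule num_cycles_mono[OF G induced_subgraph[OF G W(1)]])
  finally show ?thesis .
qed

subsection \<open>Intermediate lengths\<close>

context cyclic
begin

lemma sum_shift1:
  fixes f :: "int \<Rightarrow> int"
  assumes "\<And>i. f (i + n) = f i"
  shows "(\<Sum>i\<in>{0..<n}. f (i + 1)) = (\<Sum>i\<in>{0..<n}. f i)"
proof -
  have "(\<Sum>i\<in>{0..<n}. f (i + 1)) = (\<Sum>i\<in>{1..<n + 1}. f i)"
    by (rule sum.reindex_bij_witness[of _ "\<lambda>i. i - 1" "\<lambda>i. i + 1"]) auto
  also have "{1..<n + 1} = insert n {1..<n}" using n3 by auto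
  also have "(\<Sum>i\<in>insert n {1..<n}. f i) = (\<Sum>i\<in>insert 0 {1..<n}. f i)"
    using assms[of 0] by simp
  also have "insert 0 {1..<n} = {0..<n}" using n3 by auto
  finally show ?thesis .
qed

lemma sum_shift2:
  fixes f :: "int \<Rightarrow> int"
  assumes f: "\<And>i. f (i + n) = f i"
  shows "(\<Sum>i\<in>{0..<n}. f (i + 2)) = (\<Sum>i\<in>{0..<n}. f i)"
proof -
  have "f (i + n + 1) = f (i + 1)" for i using f[of "i + 1"] by (simp add: algebra_simps)
  from sum_shift1[of "\<lambda>i. f (i + 1)", OF this] sum_shift1[of f, OF f] show ?thesis
    by (simp add: add.assoc)
qed

lemma sum_range: "(\<Sum>v\<in>range x. f v) = (\<Sum>i\<in>{0..<n}. f (x i))"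
  using sum.reindex[OF inj_window[of 0], of f] unfolding range_window[of 0] by simp

end

context ham
begin

lemma sum_pair_excess:
  "(\<Sum>i\<in>{0..<n}. int (deg G (x i)) + int (deg G (x (i + 1))) - n) = Q"
proof -
  have "(\<Sum>i\<in>{0..<n}. int (deg G (x i))) = 2 * int (num_edges G)"
    using sum_range[of "\<lambda>v. int (deg G v)"] sum_deg_int[OF simple] unfolding verts_range by simp
  then show ?thesis
    unfolding Q_edges sum_subtractf sum.distrib
    using sum_shift1[of "\<lambda>i. int (deg G (x i))"] periodic n3 by simp
qed

lemma Q_le_cycles:
  assumes "1 \<le> h" "h + 5 \<le> n"
  shows "Q \<le> 2 * int (num_cycles (nat (n - h)) G)"
proof -
  have "Q \<le> (\<Sum>i\<in>{0..<n}. max 0 (int (deg G (x i)) + int (deg G (x (i + 1))) - n))"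
    unfolding sum_pair_excess[symmetric] by (rule sum_mono) simp
  then show ?thesis using degree_excess[OF assms] by linarith
qed

text \<open>Ore's argument on the path left by removing \<open>x i\<close>: its ends are adjacent,
  or the degree sum forces a crossing pair of chords that closes it.\<close>

lemma hamiltonian_del:
  assumes n5: "5 \<le> n" and d: "n < int (deg G (x (i - 1))) + int (deg G (x (i + 1)))"
  shows "hamiltonian (del G {x i})"
proof -
  define p where "p = i - 1"
  have i: "x i = x (p + 1)" "x (i + 1) = x (p + 2)" by (simp_all add: p_def add.commute)
  have "\<exists>ys. cyc G ys \<and> set ys = x ` {p + 2..p + n}"
  proof (cases "ch p 2")
    case True
    then show ?thesis using one_cyc[of 1 p] set_one[of 1 p] n5 by (intro exI[of _ "one 1 p"]) (simp add: add.assoc)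
  next
    case False
    let ?A = "{e \<in> {1..<n}. ch p e}" and ?B = "{e \<in> {1..<n}. ch (p + 2) e}"
    have fin: "finite ?A" "finite ?B" by (auto intro: finite_subset[of _ "{1..<n}"])
    have AB: "n < int (card ?A) + int (card ?B)"
      using d unfolding p_def[symmetric] i(2) deg_ch .
    have "x (p + 2 + (n - 2)) = x p" using periodic[of p] by (simp add: algebra_simps)
    then have n2: "\<not> ch (p + 2) (n - 2)" using False by (simp add: adj_sym)
    \<comment> \<open>Chords to the removed vertex are dropped, length 1 at one end and
      \<open>n - 1\<close> at the other. After the shift, a common \<open>e\<close> means chords to
      \<open>x (p + e)\<close> and to \<open>x (p + e + 1)\<close>.\<close>
    let ?A' = "?A - {1}" and ?B' = "(\<lambda>e. e + 1) ` (?B - {n - 1})"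
    have "?A' \<union> ?B' \<subseteq> {2..n - 1}" by auto
    then have "card (?A' \<union> ?B') \<le> card {2..n - 1}" by (intro card_mono) auto
    then have "int (card (?A' \<union> ?B')) \<le> n - 2" using n5 by simp
    moreover have "card ?A' + card ?B' = card (?A' \<union> ?B') + card (?A' \<inter> ?B')"
      using fin by (intro card_Un_Int) auto
    moreover have "card ?A \<le> card ?A' + 1" using diff_card_le_card_Diff[of "{1}" ?A] by simp
    moreover have "card ?B' = card (?B - {n - 1})" by (rule card_image) (simp add: inj_on_def)
    moreover have "card ?B \<le> card (?B - {n - 1}) + 1" using diff_card_le_card_Diff[of "{n - 1}" ?B] by simp
    ultimately have "0 < card (?A' \<inter> ?B')" using AB by linarith
    then have "?A' \<inter> ?B' \<noteq> {}" by (metis card.empty less_irrefl)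
    then obtain e where e: "e \<in> ?A'" "e \<in> ?B'" by blast
    then obtain b where b: "b \<in> ?B" "e = b + 1" by blast
    then have "e - 1 = b" by simp
    then have e': "ch p e" "ch (p + 2) (e - 1)" "2 \<le> e" "e \<le> n - 1" using e(1) b by simp_all
    have "e \<noteq> 2" using e'(1) False by auto
    moreover have "e \<noteq> n - 1"
    proof
      assume "e = n - 1"
      then have "e - 1 = n - 2" by simp
      from e'(2)[unfolded this] n2 show False by blast
    qed
    ultimately have e3: "3 \<le> e" "e \<le> n - 2" using e' by auto
    have "cyc G (cross 1 p e 2)"
      using cross_cyc[of 1 2 e p] e' e3 n5 by simp
    moreover have "set (cross 1 p e 2) = x ` {p + 2..p + n}"
    proof -
      have "{p + 2..p + e} \<union> {p + e + 1 + 2 - 2..p + n} = {p + 2..p + n}" using e3 by auto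
      then show ?thesis unfolding set_cross by (rule arg_cong)
    qed
    ultimately show ?thesis by blast
  qed
  then obtain ys where ys: "cyc G ys" "set ys = x ` {p + 2..p + n}" by blast
  have s: "set ys = verts G - {x i}"
  proof -
    have "{p + 1..<p + 1 + n} = insert (p + 1) {p + 2..p + n}" using n5 by auto
    then have "range x = insert (x i) (x ` {p + 2..p + n})" unfolding range_window[of "p + 1"] i by simp
    moreover have "x i \<notin> x ` {p + 2..p + n}"
      using x_near[of "p + 1"] unfolding i by (auto simp: image_iff)
    ultimately show ?thesis unfolding ys(2) verts_range by blast
  qed
  have "cycle_edges ys \<subseteq> edges (del G {x i})"
    using ys(1) s cyc_set_edges[OF ys(1)] unfolding del_def edges_induced cyc_def by blast
  then have "cyc (del G {x i}) ys" using ys(1) by (simp add: cyc_def)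
  then show ?thesis using cyc_hamiltonian[OF del_simple[OF simple], of "{x i}" ys] s by simp
qed

end

lemma induced_verts: "finite_simple_graph G \<Longrightarrow> induced G (verts G) = G"
  using induced_self[of G] by (intro prod_eqI) (simp_all add: verts_def edges_def induced_def)

text \<open>By maximality, a vertex of degree well below \<open>k / 2\<close> cannot be deleted
  without losing hamiltonicity. So by \<open>hamiltonian_del\<close> its two neighbours on the
  Hamilton cycle have degree sum at most \<open>k\<close>, and its deficit is paid by the negative
  parts of \<open>S\<close> at its two cycle edges. Their total is the positive part, at most
  \<open>2 c\<close> by \<open>degree_excess\<close>, minus \<open>4 e - k^2\<close>.\<close>

lemma balanced_core:
  fixes G :: "'a ugraph"
  assumes G: "finite_simple_graph G" and hG: "hamiltonian G"
    and e: "int (order G) * int (order G) + 7 \<le> 4 * int (num_edges G)"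
    and l: "5 \<le> l" "l + 20 \<le> order G"
    and c: "num_cycles l G + l \<le> order G + 1"
  obtains W dep where "W \<subseteq> verts G"
    "20 * (int (order G) - int (card W)) + 7 \<le> 2 * int (num_cycles l G)"
    "0 < num_cycles l (induced G W)" "\<And>v. (0 :: int) \<le> dep v"
    "\<And>v. v \<in> W \<Longrightarrow> 2 * int (card W) - 21 - 2 * dep v \<le> 4 * int (deg (induced G W) v)"
    "(\<Sum>v\<in>W. dep v) \<le> 4 * int (num_cycles l G)"
proof -
  let ?e = "\<lambda>W. int (num_edges (induced G W))" and ?k = "\<lambda>W. int (card W)"
  \<comment> \<open>Deleting a vertex of degree \<open>d\<close> changes this by
    \<open>2 k - 21 - 4 d\<close>, and comparison with the whole graph shows that fewer than
    \<open>c / 10\<close> vertices are missing.\<close>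
  define pot where "pot = (\<lambda>W. 4 * ?e W - ?k W * ?k W + 20 * ?k W)"
  let ?S = "{W. W \<subseteq> verts G \<and> hamiltonian (induced G W) \<and> l < card W}"
  have "finite ?S" using verts_finite[OF G] by simp
  moreover have VS: "verts G \<in> ?S" using hG l by (simp add: induced_verts[OF G] order_def)
  ultimately obtain W where W: "W \<in> ?S" and max: "\<And>Z. Z \<in> ?S \<Longrightarrow> pot Z \<le> pot W"
    using finite_max[of ?S "verts G" pot] by blast
  define H where "H = induced G W"
  have H: "finite_simple_graph H" "verts H = W" "order H = card W"
    using induced_simple[OF G] W by (auto simp: H_def order_def)
  have fW: "finite W" using W verts_finite[OF G] finite_subset by blast
  obtain xs where xs: "cyc H xs" "set xs = verts H" using W hamiltonian_obtain unfolding H_def by blast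
  define x where "x = (\<lambda>i. xs ! nat (i mod int (length xs)))"
  define k where "k = int (length xs)"
  have gx: "gcyc x k H" "range x = set xs" unfolding x_def k_def using list_gcyc[OF H(1) xs(1)] by auto
  interpret ham x k H
    by (intro ham.intro gx(1) ham_axioms.intro) (use gx(2) xs(2) in simp)
  have kW: "k = int (card W)" using n_card H(3) by simp
  have lk: "int l < k" using W kW by simp
  define c where "c = int (num_cycles l H)"
  have cG: "c \<le> int (num_cycles l G)"
    unfolding c_def H_def using num_cycles_mono[OF G induced_subgraph[OF G]] W by auto
  define S where "S = (\<lambda>i. int (deg H (x i)) + int (deg H (x (i + 1))) - k)"
  have up: "(\<Sum>i\<in>{0..<k}. max 0 (S i)) \<le> 2 * c"
    using degree_excess[of "k - int l"] lk l unfolding S_def c_def by simp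
  have per: "x (i + 1 + k) = x (i + 1)" "x (i + k + 1) = x (i + 1)" for i
    using periodic[of "i + 1"] by (simp_all add: algebra_simps)
  have sumS: "(\<Sum>i\<in>{0..<k}. S i) = 4 * ?e W - k * k"
    using sum_pair_excess unfolding Q_edges S_def by (simp add: H_def)
  have "pot (verts G) \<le> pot W" by (rule max[OF VS])
  then have Q: "7 + 20 * (int (order G) - k) \<le> 4 * ?e W - k * k"
    using e unfolding pot_def induced_verts[OF G] order_def[symmetric] kW[symmetric] by (smt (verit))
  have "(\<Sum>i\<in>{0..<k}. S i) \<le> (\<Sum>i\<in>{0..<k}. max 0 (S i))" by (intro sum_mono) simp
  then have big: "20 * (int (order G) - k) + 7 \<le> 2 * c" using up sumS Q by linarith
  have kn: "k \<le> int (order G)"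
    unfolding kW order_def using W verts_finite[OF G] by (auto intro: card_mono)
  then have "0 \<le> 20 * (int (order G) - k)" by simp
  then have c0: "0 < c" using big by linarith
  have Q0: "0 \<le> 4 * ?e W - k * k" using Q \<open>0 \<le> 20 * (int (order G) - k)\<close> by linarith
  \<comment> \<open>Leaves room to delete one more vertex and still have more than
    \<open>l\<close>.\<close>
  have lk2: "int l + 2 \<le> k"
  proof -
    have cl: "c \<le> int (order G) - int l + 1" using cG c by linarith
    have "int l + 20 \<le> int (order G)" using l by simp
    then have "18 * int l + 360 \<le> 18 * int (order G)" by linarith
    moreover have "2 * c \<le> 2 * int (order G) - 2 * int l + 2" using cl by simp
    from order_trans[OF big this] have "18 * int (order G) + 2 * int l + 5 \<le> 20 * k" by (simp add: algebra_simps)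
    ultimately show ?thesis by linarith
  qed
  define low where "low = (\<lambda>v. 4 * int (deg H v) < 2 * k - 21)"
  define dep where "dep = (\<lambda>v. if low v then k - 2 * int (deg H v) else 0)"
  have lowi: "int (deg H (x (i - 1))) + int (deg H (x (i + 1))) \<le> k" if "low (x i)" for i
  proof (rule ccontr)
    assume "\<not> ?thesis"
    then have "hamiltonian (del H {x i})" using hamiltonian_del[of i] lk2 l by simp
    then have ham': "hamiltonian (induced G (W - {x i}))" by (simp add: H_def del_induced)
    have xW: "x i \<in> W" using x_verts H(2) by simp
    have card': "?k (W - {x i}) = k - 1" using xW fW kW lk by (simp add: card_Diff_singleton)
    have "W - {x i} \<in> ?S"
    proof -
      have "l < card (W - {x i})" using card' lk2 by linarith
      then show ?thesis using W ham' by auto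
    qed
    from max[OF this] have "4 * ?e (W - {x i}) - (k - 1) * (k - 1) + 20 * (k - 1) \<le> 4 * ?e W - k * k + 20 * k"
      unfolding pot_def card' kW[symmetric] .
    moreover have "?e (W - {x i}) + int (deg H (x i)) = ?e W"
      using del_edges[OF H(1), of "x i"] by (simp add: H_def del_induced)
    moreover have "(k - 1) * (k - 1) = k * k - 2 * k + 1" by (simp add: algebra_simps)
    moreover have "2 * k - 21 \<le> 4 * d"
      if "4 * a - X + 20 * (k - 1) \<le> 4 * b - Y + 20 * k" "a + d = b" "X = Y - 2 * k + 1" for a b d X Y :: int
      using that by presburger
    ultimately have "2 * k - 21 \<le> 4 * int (deg H (x i))" by blast
    then show False using that by (simp add: low_def)
  qed
  have depi: "dep (x (i + 1)) \<le> max 0 (- S i) + max 0 (- S (i + 1))" for i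
  proof (cases "low (x (i + 1))")
    case True
    have "int (deg H (x i)) + int (deg H (x (i + 1 + 1))) \<le> k" using lowi[OF True] by simp
    then have "k - 2 * int (deg H (x (i + 1))) \<le> - S i + - S (i + 1)" unfolding S_def by linarith
    then show ?thesis using True by (simp add: dep_def)
  qed (simp add: dep_def)
  show thesis
  proof (rule that[of W dep])
    show "W \<subseteq> verts G" using W by simp
    show "20 * (int (order G) - int (card W)) + 7 \<le> 2 * int (num_cycles l G)"
      using order_trans[OF big, of "2 * int (num_cycles l G)"] cG kW by simp
    show "0 < num_cycles l (induced G W)" using c0 by (simp add: c_def H_def)
    show "0 \<le> dep v" for v by (simp add: dep_def low_def)
    show "2 * int (card W) - 21 - 2 * dep v \<le> 4 * int (deg (induced G W) v)" if "v \<in> W" for v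
      unfolding kW[symmetric] H_def[symmetric] by (simp add: dep_def low_def)
    have "(\<Sum>v\<in>W. dep v) = (\<Sum>i\<in>{0..<k}. dep (x (i + 1)))"
      using sum_range[of dep] sum_shift1[of "\<lambda>i. dep (x i)"] periodic verts_range H(2) by simp
    also have "\<dots> \<le> (\<Sum>i\<in>{0..<k}. max 0 (- S i) + max 0 (- S (i + 1)))" by (intro sum_mono depi)
    also have "\<dots> = 2 * (\<Sum>i\<in>{0..<k}. max 0 (- S i))"
      unfolding sum.distrib using sum_shift1[of "\<lambda>i. max 0 (- S i)"] periodic per by (simp add: S_def)
    finally have "(\<Sum>v\<in>W. dep v) \<le> 2 * (\<Sum>i\<in>{0..<k}. max 0 (- S i))" .
    moreover have "(\<Sum>i\<in>{0..<k}. max 0 (- S i)) = (\<Sum>i\<in>{0..<k}. max 0 (S i)) - (\<Sum>i\<in>{0..<k}. S i)"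
      unfolding sum_subtractf[symmetric] by (intro sum.cong) auto
    then have "(\<Sum>i\<in>{0..<k}. max 0 (- S i)) \<le> 2 * c" using up Q0 unfolding sumS by linarith
    ultimately show "(\<Sum>v\<in>W. dep v) \<le> 4 * int (num_cycles l G)" using cG by linarith
  qed
qed


context gcyc
begin

text \<open>Replacing \<open>x (i + 1)\<close> by an outside common neighbour of its two cycle
  neighbours keeps the length; the vertex set reveals both the new and the lost vertex.\<close>

lemma swap_cycles:
  assumes R: "finite R" "R \<inter> range x = {}" and n4: "4 \<le> n"
  shows "(\<Sum>i\<in>{0..<n}. int (card (nbrs G (x i) \<inter> nbrs G (x (i + 2)) \<inter> R))) \<le> int (num_cycles (nat n) G)"
proof -
  let ?N = "\<lambda>i. nbrs G (x i) \<inter> nbrs G (x (i + 2)) \<inter> R"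
  let ?A = "SIGMA i:{0..<n}. ?N i"
  have d: "detour i 2 [r]" if "(i, r) \<in> ?A" for i r
    using that R(2) by (auto simp: detour_def nbrs_def adj_def insert_commute)
  have c: "cyc G (ins i 2 [r])" "int (length (ins i 2 [r])) = n" if "(i, r) \<in> ?A" for i r
    using ins_cyc[OF d[OF that]] n4 by simp_all
  have s: "set (ins i 2 [r]) = x ` {i + 2..i + n} \<union> {r}" for i r
    by (auto simp: ins_def)
  have comp: "x (i + 1) \<notin> x ` {i + 2..i + n}" "range x = insert (x (i + 1)) (x ` {i + 2..i + n})" for i
  proof -
    have "x (i + 1) \<noteq> x j" if "j \<in> {i + 2..i + n}" for j
      using x_near[of "i + 1" j] that by auto
    then show "x (i + 1) \<notin> x ` {i + 2..i + n}" by blast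
    have "{i + 1..<i + 1 + n} = insert (i + 1) {i + 2..i + n}" using n4 by auto
    then show "range x = insert (x (i + 1)) (x ` {i + 2..i + n})" unfolding range_window[of "i + 1"] by simp
  qed
  have "card ?A \<le> num_cycles (nat n) G"
  proof (rule num_cycles_ge[OF simple, where F = "\<lambda>(i, r). ins i 2 [r]"])
    fix p assume "p \<in> ?A"
    then show "cyc G (case p of (i, r) \<Rightarrow> ins i 2 [r]) \<and> length (case p of (i, r) \<Rightarrow> ins i 2 [r]) = nat n"
      using c[of "fst p" "snd p"] by (cases p) auto
  next
    show "inj_on (\<lambda>p. cycle_edges (case p of (i, r) \<Rightarrow> ins i 2 [r])) ?A"
    proof (rule inj_onI)
      fix p p' assume p: "p \<in> ?A" "p' \<in> ?A"
        and e: "cycle_edges (case p of (i, r) \<Rightarrow> ins i 2 [r]) = cycle_edges (case p' of (i, r) \<Rightarrow> ins i 2 [r])"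
      obtain i r j t where ir: "p = (i, r)" "p' = (j, t)" by (cases p; cases p') auto
      have "set (ins i 2 [r]) = set (ins j 2 [t])"
        using cyc_set_edges[OF c(1), of i r] cyc_set_edges[OF c(1), of j t] p e unfolding ir by simp
      then have eq: "x ` {i + 2..i + n} \<union> {r} = x ` {j + 2..j + n} \<union> {t}" unfolding s .
      have rt: "r \<notin> range x" "t \<notin> range x" using p R(2) unfolding ir by auto
      have rt': "r = t" using eq rt by blast
      have "x ` {i + 2..i + n} = x ` {j + 2..j + n}" using eq rt unfolding rt' by blast
      then have "x (i + 1) \<notin> x ` {j + 2..j + n}" using comp(1)[of i] by simp
      moreover have "x (i + 1) \<in> insert (x (j + 1)) (x ` {j + 2..j + n})"
        unfolding comp(2)[of j, symmetric] by (rule rangeI)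
      ultimately have "x (i + 1) = x (j + 1)" by blast
      then have "i = j" using x_near[of "i + 1" "j + 1"] p unfolding ir by auto
      then show "p = p'" using rt' ir by simp
    qed
  qed
  moreover have "card ?A = (\<Sum>i\<in>{0..<n}. card (?N i))"
    using R(1) by (intro card_SigmaI) auto
  ultimately show ?thesis by (simp only: of_nat_sum[symmetric] of_nat_le_iff)
qed

text \<open>Crossing pairs with \<open>h = 0\<close>, \<open>t = 1\<close> keep the vertex set and
  lose exactly the cycle edges at \<open>p\<close> and \<open>p + d\<close>, so each cycle has at
  most two sources \<open>(p, d)\<close>. Few cycles thus bound the edges inside the vertex set of
  the cycle.\<close>

lemma two_switch_rows: "2 * (\<Sum>d\<in>{1..<n}. row d) \<le> n * n + n + 2 * int (num_cycles (nat n) G)"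
  if n4: "4 \<le> n"
proof -
  let ?P = "\<lambda>p d. ch p d \<and> ch (p + 1) d"
  let ?T = "{(p, d). p \<in> {0..<n} \<and> d \<in> {2..n - 2} \<and> ?P p d}"
  let ?T1 = "{(p, d). (p, d) \<in> ?T \<and> p + d < n}"
  let ?T2 = "{(p, d). (p, d) \<in> ?T \<and> n \<le> p + d}"
  have T: "?T = ?T1 \<union> ?T2" "?T1 \<inter> ?T2 = {}" by auto
  have "?T \<subseteq> {0..<n} \<times> {2..n - 2}" by auto
  then have fT: "finite ?T" by (rule finite_subset) auto
  have fT1: "finite ?T1" by (rule finite_subset[OF _ fT]) auto
  have "card ?T1 \<le> num_cycles (nat n) G"
  proof (rule num_cycles_ge[OF simple, where F = "\<lambda>(p, d). cross 0 p d 1"])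
    fix q assume "q \<in> ?T1"
    then obtain p d where q: "q = (p, d)" "2 \<le> d" "d \<le> n - 2" "ch p d" "ch (p + 1) d" by auto
    then show "cyc G (case q of (p, d) \<Rightarrow> cross 0 p d 1) \<and> length (case q of (p, d) \<Rightarrow> cross 0 p d 1) = nat n"
      using cross_cyc[of 0 1 d p] n4 by simp
  next
    have miss: "hm j \<in> cycle_edges (cross 0 p d 1) \<longleftrightarrow> j \<noteq> p \<and> j \<noteq> p + d"
      if q: "(p, d) \<in> ?T1" and j: "j \<in> {0..<n}" for p d j
    proof -
      have pd: "0 \<le> p" "2 \<le> d" "d \<le> n - 2" "p + d < n" using q by auto
      let ?J = "{p + 1..<p + d} \<union> {p + d + 1..<p + n}"
      have E: "cycle_edges (cross 0 p d 1) = {{x p, x (p + d)}, {x (p + 1), x (p + 1 + d)}} \<union> hm ` ?J"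
        using cross_edges[of 1 0 d p] pd by (simp add: algebra_simps)
      have "hm j \<notin> {{x p, x (p + d)}, {x (p + 1), x (p + 1 + d)}}"
        using chord_not_hm[OF pd(2,3), of p j] chord_not_hm[OF pd(2,3), of "p + 1" j] by auto
      then have "hm j \<in> cycle_edges (cross 0 p d 1) \<longleftrightarrow> (\<exists>i\<in>?J. x j = x i)"
        unfolding E by (simp only: Un_iff image_iff hm_eq simp_thms)
      also have "\<dots> \<longleftrightarrow> j \<noteq> p \<and> j \<noteq> p + d"
      proof
        assume "\<exists>i\<in>?J. x j = x i"
        then obtain i where i: "i \<in> ?J" "x j = x i" by blast
        show "j \<noteq> p \<and> j \<noteq> p + d" using i pd x_near[of j i] by auto
      next
        assume a: "j \<noteq> p \<and> j \<noteq> p + d"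
        show "\<exists>i\<in>?J. x j = x i"
        proof (cases "p < j")
          case True then show ?thesis using a j pd by (intro bexI[of _ j]) auto
        next
          case False then show ?thesis using a j pd periodic[of j] by (intro bexI[of _ "j + n"]) auto
        qed
      qed
      finally show ?thesis .
    qed
    show "inj_on (\<lambda>q. cycle_edges (case q of (p, d) \<Rightarrow> cross 0 p d 1)) ?T1"
    proof (rule inj_onI)
      fix q q' assume qq: "q \<in> ?T1" "q' \<in> ?T1"
        and e: "cycle_edges (case q of (p, d) \<Rightarrow> cross 0 p d 1) = cycle_edges (case q' of (p, d) \<Rightarrow> cross 0 p d 1)"
      obtain p d p' d' where q: "q = (p, d)" "q' = (p', d')" by (cases q; cases q') auto
      have e': "cycle_edges (cross 0 p d 1) = cycle_edges (cross 0 p' d' 1)" using e unfolding q by simp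
      have m: "(j \<noteq> p \<and> j \<noteq> p + d) = (j \<noteq> p' \<and> j \<noteq> p' + d')" if "j \<in> {0..<n}" for j
        using miss[OF qq(1)[unfolded q(1)] that] miss[OF qq(2)[unfolded q(2)] that] unfolding e' by blast
      have pd: "0 \<le> p" "2 \<le> d" "p + d < n" "0 \<le> p'" "2 \<le> d'" "p' + d' < n" using qq unfolding q by auto
      have "p = p' \<or> p = p' + d'" "p + d = p' \<or> p + d = p' + d'" "p' = p \<or> p' = p + d"
        using m[of p] m[of "p + d"] m[of p'] pd by auto
      then show "q = q'" using pd unfolding q by auto
    qed
  qed
  moreover have "card ?T2 \<le> card ?T1"
  proof (rule card_inj_on_le[OF _ _ fT1])
    show "inj_on (\<lambda>(p, d). (p + d - n, n - d)) ?T2" by (auto simp: inj_on_def)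
    show "(\<lambda>(p, d). (p + d - n, n - d)) ` ?T2 \<subseteq> ?T1"
    proof (rule image_subsetI)
      fix q assume "q \<in> ?T2"
      then obtain p d where q: "q = (p, d)" "p \<in> {0..<n}" "2 \<le> d" "d \<le> n - 2" "ch p d" "ch (p + 1) d" "n \<le> p + d"
        by auto
      have "ch (p + d - n) (n - d)"
        using ch_sym[of p d] ch_periodic[of "p + d - n" "n - d"] q(5) by simp
      moreover have "ch (p + d - n + 1) (n - d)"
        using ch_sym[of "p + 1" d] ch_periodic[of "p + d - n + 1" "n - d"] q(6) by (simp add: algebra_simps)
      ultimately show "(case q of (p, d) \<Rightarrow> (p + d - n, n - d)) \<in> ?T1" using q by simp
    qed
  qed
  moreover have "card ?T = card ?T1 + card ?T2"
    by (rule trans[OF arg_cong[where f = card, OF T(1)] card_Un_disjoint[OF fT1 _ T(2)]])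
      (rule finite_subset[OF _ fT], auto)
  ultimately have cT: "int (card ?T) \<le> 2 * int (num_cycles (nat n) G)" by linarith
  have "(\<Sum>d\<in>{2..n - 2}. 2 * row d - n) \<le> (\<Sum>d\<in>{2..n - 2}. both 1 d d)"
  proof (rule sum_mono)
    fix d show "2 * row d - n \<le> both 1 d d"
      using both_neither[of 1 d d] neither_nonneg[of 1 d d] by linarith
  qed
  also have "\<dots> = int (card ?T)"
    by (subst card_pairs) (auto simp: both_def)
  also have "(\<Sum>d\<in>{2..n - 2}. 2 * row d - n) = 2 * (\<Sum>d\<in>{2..n - 2}. row d) - (n - 3) * n"
    unfolding sum_subtractf sum_distrib_left[symmetric] using n4 by simp
  finally have "2 * (\<Sum>d\<in>{2..n - 2}. row d) \<le> (n * n - 3 * n) + 2 * int (num_cycles (nat n) G)"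
    using cT by (simp add: left_diff_distrib)
  moreover have "(\<Sum>d\<in>{1..<n}. row d) = 2 * n + (\<Sum>d\<in>{2..n - 2}. row d)"
  proof -
    have "{1..<n} = insert 1 (insert (n - 1) {2..n - 2})" using n4 by auto
    then show ?thesis using n4 row_1 row_sym[of 1] by simp
  qed
  ultimately show ?thesis by linarith
qed

end

text \<open>In \<open>mid_cycles\<close>, \<open>n\<close> is the cycle length, \<open>n + h\<close>
  the original order, \<open>\<rho>\<close> the number of core vertices off the cycle and
  \<open>B\<close> the number of exceptional ones among them.\<close>

lemma mid_numeric:
  fixes h n \<rho> c B :: int
  assumes h: "33 \<le> n" "440 \<le> n + h" "n \<le> 2 * h + 2" and c: "c \<le> h + 1" and \<rho>: "18 * h + 5 \<le> 20 * \<rho>"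
    and B: "B * (4 * \<rho> - 63) \<le> 30 * c" "0 \<le> B" and main: "n * (2 * \<rho> - 113 - 8 * B) \<le> 44 * c"
  shows False
proof -
  have h146: "146 \<le> h" using h by linarith
  have "B \<le> 9"
  proof (rule ccontr)
    assume "\<not> B \<le> 9"
    then have "10 * (4 * \<rho> - 63) \<le> B * (4 * \<rho> - 63)" using h146 \<rho> by (intro mult_right_mono) linarith+
    then have "40 * \<rho> \<le> 30 * c + 630" using B(1) by (simp add: algebra_simps)
    then show False using c \<rho> h146 by linarith
  qed
  \<comment> \<open>The constant is \<open>113 + 8 * 9\<close>, from \<open>B <= 9\<close>.\<close>
  define z where "z = 2 * \<rho> - 185"
  have z: "18 * h \<le> 10 * z + 1845" using \<rho> by (simp add: z_def)
  then have z0: "0 \<le> z" using h146 by linarith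
  have "n * z \<le> n * (2 * \<rho> - 113 - 8 * B)" using h \<open>B \<le> 9\<close> by (intro mult_left_mono) (auto simp: z_def)
  then have nz: "n * z \<le> 44 * h + 44" using main c by linarith
  have mono: "k * z \<le> 44 * h + 44" if "k \<le> n" for k
    using mult_right_mono[OF that z0] nz by linarith
  \<comment> \<open>The cases dovetail: \<open>33 z <= 44 h + 44\<close> fails from
    \<open>h = 399\<close> on, \<open>h <= 398\<close> gives \<open>n >= 42\<close>, which fails
    from 247 on, and \<open>h <= 246\<close> gives \<open>n >= 194\<close>, which fails for all
    \<open>h >= 146\<close>.\<close>
  consider "399 \<le> h" | "247 \<le> h" "h \<le> 398" | "h \<le> 246" by linarith
  then show False
  proof cases
    case 1 then show False using mono[of 33] h z by linarith
  next
    case 2 then show False using mono[of 42] h z by linarith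
  next
    case 3 then show False using mono[of 194] h z h146 by linarith
  qed
qed

context gcyc
begin

lemma nbrs_range_count:
  assumes "a \<notin> range x"
  shows "int (card (nbrs G a \<inter> range x)) = (\<Sum>i\<in>{0..<n}. of_bool (adj G (x i) a))"
proof -
  have "nbrs G a \<inter> range x = x ` {i \<in> {0..<n}. adj G (x i) a}"
    unfolding range_window[of 0] by (auto simp: nbrs_def adj_sym)
  moreover have "inj_on x {i \<in> {0..<n}. adj G (x i) a}"
    using inj_window[of 0] by (auto simp: inj_on_def)
  ultimately have "card (nbrs G a \<inter> range x) = card {i \<in> {0..<n}. adj G (x i) a}" by (simp only: card_image)
  then show ?thesis by (simp only: card_of_bool[OF finite_atLeastLessThan_int])
qed

text \<open>On average a cycle vertex has about \<open>\<rho> / 2\<close> neighbours off the cycle,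
  since its core degree is near half the core order and \<open>two_switch_rows\<close> limits the
  edges inside. But three cycle vertices at mutual distances two and four have nearly disjoint
  neighbourhoods there, leaving about \<open>\<rho> / 3\<close> each.\<close>

lemma mid_cycles:
  fixes h \<rho> c :: int and dep :: "'a \<Rightarrow> int"
  assumes cn: "int (num_cycles (nat n) G) \<le> c" and \<rho>: "int (order G) = \<rho> + n"
    and dep0: "\<And>v. 0 \<le> dep v" and dep: "\<And>v. v \<in> verts G \<Longrightarrow> 2 * (\<rho> + n) - 21 - 2 * dep v \<le> 4 * int (deg G v)"
    and depc: "(\<Sum>v\<in>verts G. dep v) \<le> 4 * c"
    and h: "33 \<le> n" "440 \<le> n + h" "n \<le> 2 * h + 2" and ch: "c \<le> h + 1" and \<rho>h: "18 * h + 5 \<le> 20 * \<rho>"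
  shows False
proof -
  define R where "R = verts G - range x"
  have fV: "finite (verts G)" by (rule verts_finite[OF simple])
  have xV: "range x \<subseteq> verts G" using x_verts by auto
  have R: "finite R" "R \<inter> range x = {}" "R \<subseteq> verts G" using fV by (auto simp: R_def)
  have cR: "int (card R) = \<rho>"
  proof -
    have "card R = card (verts G) - card (range x)" "card (range x) \<le> card (verts G)"
      using xV fV finite_range by (auto simp: R_def card_Diff_subset card_mono)
    then show ?thesis using card_range n3 \<rho> by (simp add: order_def)
  qed
  define A where "A = (\<lambda>i a. of_bool (adj G (x i) a) :: int)"
  have A01: "0 \<le> A i a" "A i a \<le> 1" "A (i + n) a = A i a" for i a by (simp_all add: A_def periodic)
  define dC where "dC = (\<lambda>v. int (card (nbrs G v \<inter> range x)))"
  define dR where "dR = (\<lambda>v. int (card (nbrs G v \<inter> R)))"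
  have degCR: "int (deg G v) = dC v + dR v" for v
  proof -
    have "nbrs G v = (nbrs G v \<inter> range x) \<union> (nbrs G v \<inter> R)" using nbrs_subset[OF simple] by (auto simp: R_def)
    moreover have "card ((nbrs G v \<inter> range x) \<union> (nbrs G v \<inter> R)) = card (nbrs G v \<inter> range x) + card (nbrs G v \<inter> R)"
      using R finite_range by (intro card_Un_disjoint) auto
    ultimately show ?thesis by (simp add: deg_def dC_def dR_def)
  qed
  have NA: "int (card (nbrs G (x i) \<inter> X)) = (\<Sum>a\<in>X. A i a)" if "finite X" for X i
  proof -
    have "nbrs G (x i) \<inter> X = {a \<in> X. adj G (x i) a}" by (auto simp: nbrs_def)
    then show ?thesis by (simp only: A_def card_of_bool[OF that])
  qed
  have N2: "int (card (nbrs G (x i) \<inter> nbrs G (x j) \<inter> X)) = (\<Sum>a\<in>X. A i a * A j a)" if "finite X" for X i j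
  proof -
    have "nbrs G (x i) \<inter> nbrs G (x j) \<inter> X = {a \<in> X. adj G (x i) a \<and> adj G (x j) a}" by (auto simp: nbrs_def)
    then show ?thesis by (simp only: A_def card_of_bool[OF that] of_bool_conj)
  qed
  have dCA: "dC a = (\<Sum>i\<in>{0..<n}. A i a)" if "a \<in> R" for a
    using nbrs_range_count[of a] that R(2) unfolding dC_def A_def by blast
  have sw: "(\<Sum>i\<in>{0..<n}. \<Sum>a\<in>R. A i a * A (i + 2) a) \<le> c"
    using swap_cycles[OF R(1,2)] h cn unfolding N2[OF R(1)] by simp
  have s2: "(\<Sum>i\<in>{0..<n}. f (i + 2)) = (\<Sum>i\<in>{0..<n}. f i)" if "\<And>i. f (i + n) = f i" for f :: "int \<Rightarrow> int"
    by (rule sum_shift2) (rule that)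
  have per2: "A (i + n + 2) a = A (i + 2) a" "A (i + 2 + n) a = A (i + 2) a" for i a
    using A01(3)[of "i + 2" a] by (simp_all add: algebra_simps)

  \<comment> \<open>A vertex adjacent to more than half of the cycle has neighbours at distance two
    on it, and each such coincidence is a swap cycle.\<close>
  define y where "y = (\<lambda>a. max 0 (2 * dC a - n))"
  have ysum: "(\<Sum>a\<in>R. y a) \<le> c"
  proof -
    have "y a \<le> (\<Sum>i\<in>{0..<n}. A i a * A (i + 2) a)" if a: "a \<in> R" for a
    proof -
      have "(\<Sum>i\<in>{0..<n}. A i a + A (i + 2) a - 1) \<le> (\<Sum>i\<in>{0..<n}. A i a * A (i + 2) a)"
        by (rule sum_mono) (auto simp: A_def)
      moreover have "(\<Sum>i\<in>{0..<n}. A i a + A (i + 2) a - 1) = 2 * dC a - n"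
        unfolding sum_subtractf sum.distrib dCA[OF a] using s2[of "\<lambda>i. A i a"] A01(3) n3 by simp
      moreover have "0 \<le> (\<Sum>i\<in>{0..<n}. A i a * A (i + 2) a)" using A01(1) by (intro sum_nonneg) simp
      ultimately show ?thesis by (simp add: y_def)
    qed
    then have "(\<Sum>a\<in>R. y a) \<le> (\<Sum>a\<in>R. \<Sum>i\<in>{0..<n}. A i a * A (i + 2) a)" by (rule sum_mono)
    also have "\<dots> = (\<Sum>i\<in>{0..<n}. \<Sum>a\<in>R. A i a * A (i + 2) a)" by (rule sum.swap)
    finally show ?thesis using sw by linarith
  qed

  \<comment> \<open>Vertices of \<open>R\<close> with few neighbours in \<open>R\<close> would need
    many on the cycle or a large deficit; both totals are bounded by multiples of \<open>c\<close>,
    so the exceptional set is small.\<close>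
  define R' where "R' = {a \<in> R. \<rho> \<le> 6 * dR a}"
  have fR': "finite R'" "R' \<subseteq> R" using R by (auto simp: R'_def)
  define B where "B = int (card (R - R'))"
  have cR': "int (card R') = \<rho> - B"
    using fR' R(1) cR card_mono[OF R(1) fR'(2)] by (simp add: B_def card_Diff_subset)
  have Bbound: "B * (4 * \<rho> - 63) \<le> 30 * c"
  proof -
    have one: "4 * \<rho> - 63 \<le> 6 * dep a + 6 * y a" if a: "a \<in> R - R'" for a
    proof -
      have 1: "6 * dR a < \<rho>" using a unfolding R'_def by auto
      have 2: "2 * (\<rho> + n) - 21 - 2 * dep a \<le> 4 * (dC a + dR a)" using dep[of a] a R(3) unfolding degCR by blast
      have 3: "2 * dC a - n \<le> y a" by (simp add: y_def)
      have 4: "2 * \<rho> + 2 * n - 21 - 2 * dep a \<le> 4 * dC a + 4 * dR a" using 2 by (simp add: algebra_simps)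
      show ?thesis using 1 3 4 by linarith
    qed
    have "B * (4 * \<rho> - 63) = (\<Sum>a\<in>R - R'. 4 * \<rho> - 63)" by (simp add: B_def)
    also have "\<dots> \<le> (\<Sum>a\<in>R - R'. 6 * dep a + 6 * y a)" by (rule sum_mono) (rule one)
    also have "\<dots> = 6 * (\<Sum>a\<in>R - R'. dep a) + 6 * (\<Sum>a\<in>R - R'. y a)"
      by (simp only: sum.distrib sum_distrib_left)
    finally have "B * (4 * \<rho> - 63) \<le> 6 * (\<Sum>a\<in>R - R'. dep a) + 6 * (\<Sum>a\<in>R - R'. y a)" .
    moreover have "(\<Sum>a\<in>R - R'. dep a) \<le> (\<Sum>v\<in>verts G. dep v)"
      using fV R(3) dep0 by (intro sum_mono2) auto
    moreover have "(\<Sum>a\<in>R - R'. y a) \<le> (\<Sum>a\<in>R. y a)"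
      using R(1) by (intro sum_mono2) (auto simp: y_def)
    ultimately show ?thesis using depc ysum by linarith
  qed

  \<comment> \<open>Twelve common neighbours, each with at least \<open>\<rho> / 6\<close>
    neighbours in \<open>R\<close>, would give by \<open>three_detours\<close> with
    \<open>q = 1\<close> at least \<open>24 \<rho> / 6 - 2 \<rho> = 2 \<rho>\<close> cycles, more
    than \<open>c\<close>.\<close>
  have four: "int (card (nbrs G (x i) \<inter> nbrs G (x (i + 4)) \<inter> R')) \<le> 11" for i
  proof (rule ccontr)
    assume "\<not> ?thesis"
    then have "12 \<le> card (nbrs G (x i) \<inter> nbrs G (x (i + 4)) \<inter> R')" by simp
    then obtain S where S: "S \<subseteq> nbrs G (x i) \<inter> nbrs G (x (i + 4)) \<inter> R'" "card S = 12" "finite S"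
      using obtain_subset_with_card_n by metis
    define D where "D = (\<rho> + 5) div 6"
    have D: "\<rho> \<le> 6 * D" unfolding D_def by presburger
    have "2 * 1 * (int (card S) * D) - 1 * (1 + 1) * int (card R) \<le> int (num_cycles (nat (n - 4 + 1) + 3) G)"
    proof (rule three_detours)
      fix a assume "a \<in> S"
      then have "\<rho> \<le> 6 * dR a" using S(1) by (auto simp: R'_def)
      then have "D \<le> dR a" unfolding D_def by presburger
      then show "D \<le> int (card (nbrs G a \<inter> R))" by (simp add: dR_def)
    next
      show "S \<subseteq> nbrs G (x i) \<inter> nbrs G (x (i + 4)) - range x" using S(1) fR'(2) R(2) by blast
    qed (use S R fR' h in auto)
    moreover have "nat (n - 4 + 1) + 3 = nat n" using h by simp
    ultimately have "24 * D - 2 * \<rho> \<le> c" unfolding cR S(2) using cn by simp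
    then show False using D ch \<rho>h h by linarith
  qed

  let ?N' = "\<lambda>i. \<Sum>a\<in>R'. A i a"
  \<comment> \<open>Bonferroni for the neighbourhoods of \<open>x i\<close>,
    \<open>x (i + 2)\<close>, \<open>x (i + 4)\<close> in \<open>R'\<close>: overlaps at distance
    two sum to at most \<open>c\<close> by swaps, those at distance four are at most 11
    each.\<close>
  have three: "3 * (\<Sum>i\<in>{0..<n}. ?N' i) \<le> n * (\<rho> - B) + 2 * c + 11 * n"
  proof -
    let ?I = "\<lambda>i j. \<Sum>a\<in>R'. A i a * A j a"
    have "?N' i + ?N' (i + 2) + ?N' (i + 2 + 2) \<le> (\<rho> - B) + ?I i (i + 2) + ?I (i + 2) (i + 2 + 2) + 11" for i
    proof -
      have i4: "i + 4 = i + 2 + 2" by simp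
      have "?N' i + ?N' (i + 2) + ?N' (i + 2 + 2) = (\<Sum>a\<in>R'. A i a + A (i + 2) a + A (i + 2 + 2) a)"
        by (simp only: sum.distrib)
      also have "\<dots> \<le> (\<Sum>a\<in>R'. 1 + A i a * A (i + 2) a + A (i + 2) a * A (i + 2 + 2) a + A i a * A (i + 2 + 2) a)"
        by (rule sum_mono) (auto simp: A_def)
      also have "\<dots> = int (card R') + ?I i (i + 2) + ?I (i + 2) (i + 2 + 2) + ?I i (i + 2 + 2)"
        by (simp add: sum.distrib)
      finally show ?thesis using four[of i] unfolding i4 N2[OF fR'(1)] cR' by linarith
    qed
    then have "(\<Sum>i\<in>{0..<n}. ?N' i + ?N' (i + 2) + ?N' (i + 2 + 2))
        \<le> (\<Sum>i\<in>{0..<n}. (\<rho> - B) + ?I i (i + 2) + ?I (i + 2) (i + 2 + 2) + 11)" by (intro sum_mono)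
    moreover have "(\<Sum>i\<in>{0..<n}. ?N' (i + 2)) = (\<Sum>i\<in>{0..<n}. ?N' i)" by (rule s2) (simp add: A01)
    moreover have "(\<Sum>i\<in>{0..<n}. ?N' (i + 2 + 2)) = (\<Sum>i\<in>{0..<n}. ?N' (i + 2))"
      by (rule s2[of "\<lambda>i. ?N' (i + 2)"]) (simp add: per2)
    moreover have "(\<Sum>i\<in>{0..<n}. ?I (i + 2) (i + 2 + 2)) = (\<Sum>i\<in>{0..<n}. ?I i (i + 2))"
      by (rule s2[of "\<lambda>i. ?I i (i + 2)"]) (simp add: A01 per2)
    moreover have "(\<Sum>i\<in>{0..<n}. ?I i (i + 2)) \<le> (\<Sum>i\<in>{0..<n}. \<Sum>a\<in>R. A i a * A (i + 2) a)"
      using R(1) fR' A01(1) by (intro sum_mono sum_mono2) auto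
    moreover have "(\<Sum>i\<in>{0..<n}. (\<rho> - B)) = n * (\<rho> - B)" "(\<Sum>i\<in>{0..<n}. 11) = 11 * n" using n3 by simp_all
    ultimately show ?thesis using sw unfolding sum.distrib by linarith
  qed

  have rows: "2 * (\<Sum>v\<in>range x. dC v) \<le> n * n + n + 2 * c"
    using two_switch_rows h cn unfolding sum_row dC_def by simp
  have depx: "(\<Sum>v\<in>range x. dep v) \<le> 4 * c"
    using sum_mono2[OF fV xV, of dep] dep0 depc by (meson order_trans)
  have "(\<Sum>v\<in>range x. 2 * (\<rho> + n) - 21 - 2 * dep v) \<le> (\<Sum>v\<in>range x. 4 * dC v + 4 * dR v)"
  proof (rule sum_mono)
    fix v assume "v \<in> range x"
    then show "2 * (\<rho> + n) - 21 - 2 * dep v \<le> 4 * dC v + 4 * dR v" using dep[of v] xV degCR[of v] by auto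
  qed
  then have "n * (2 * (\<rho> + n) - 21) - 2 * (\<Sum>v\<in>range x. dep v) \<le> 4 * (\<Sum>v\<in>range x. dC v) + 4 * (\<Sum>v\<in>range x. dR v)"
    unfolding sum_subtractf sum.distrib sum_distrib_left[symmetric] using card_range n3 by (simp add: algebra_simps)
  moreover have "n * (2 * (\<rho> + n) - 21) = 2 * (n * \<rho>) + 2 * (n * n) - 21 * n" by (simp add: algebra_simps)
  ultimately have low: "2 * (n * \<rho>) - 23 * n - 12 * c \<le> 4 * (\<Sum>v\<in>range x. dR v)"
    using rows depx by linarith
  have "(\<Sum>v\<in>range x. dR v) = (\<Sum>i\<in>{0..<n}. \<Sum>a\<in>R. A i a)"
    unfolding sum_range by (simp add: dR_def NA[OF R(1)])
  also have "\<dots> \<le> (\<Sum>i\<in>{0..<n}. ?N' i + B)"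
  proof (rule sum_mono)
    fix i
    have "(\<Sum>a\<in>R. A i a) = (\<Sum>a\<in>R - R'. A i a) + ?N' i" by (rule sum.subset_diff[OF fR'(2) R(1)])
    moreover have "(\<Sum>a\<in>R - R'. A i a) \<le> (\<Sum>a\<in>R - R'. 1)" using A01(2) by (rule sum_mono)
    ultimately show "(\<Sum>a\<in>R. A i a) \<le> ?N' i + B" by (simp add: B_def)
  qed
  also have "\<dots> = (\<Sum>i\<in>{0..<n}. ?N' i) + n * B" unfolding sum.distrib using n3 by simp
  finally have up: "(\<Sum>v\<in>range x. dR v) \<le> (\<Sum>i\<in>{0..<n}. ?N' i) + n * B" .
  \<comment> \<open>Twelve times the off-cycle degree sum lies between
    \<open>6 n \<rho> - 69 n - 36 c\<close> and
    \<open>4 n \<rho> + 8 n B + 44 n + 8 c\<close>.\<close>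
  have "n * (\<rho> - B) = n * \<rho> - n * B" by (rule right_diff_distrib)
  then have "2 * (n * \<rho>) - 113 * n - 8 * (n * B) \<le> 44 * c" using three low up by linarith
  then have "n * (2 * \<rho> - 113 - 8 * B) \<le> 44 * c" by (simp add: algebra_simps)
  moreover have "0 \<le> B" by (simp add: B_def)
  ultimately show False using mid_numeric[OF h ch \<rho>h Bbound] by blast
qed

end

theorem mid_length_cycles:
  fixes G :: "'a ugraph"
  assumes G: "finite_simple_graph G" and hG: "hamiltonian G" and n: "order G = n" "440 \<le> n"
    and e: "int n * int n + 7 \<le> 4 * int (num_edges G)" and l: "33 \<le> l" "3 * l \<le> 2 * n + 2"
  shows "n - l + 2 \<le> num_cycles l G"
proof (rule ccontr)
  assume "\<not> ?thesis"
  then have few: "num_cycles l G + l \<le> n + 1" using l by linarith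
  obtain W dep where W: "W \<subseteq> verts G"
    "20 * (int n - int (card W)) + 7 \<le> 2 * int (num_cycles l G)"
    "0 < num_cycles l (induced G W)" "\<And>v. (0 :: int) \<le> dep v"
    "\<And>v. v \<in> W \<Longrightarrow> 2 * int (card W) - 21 - 2 * dep v \<le> 4 * int (deg (induced G W) v)"
    "(\<Sum>v\<in>W. dep v) \<le> 4 * int (num_cycles l G)"
    using balanced_core[OF G hG _ _ _ _, of l] e l n few by (auto simp: n)
  define H where "H = induced G W"
  have H: "finite_simple_graph H" "verts H = W" "order H = card W"
    using induced_simple[OF G] W by (auto simp: H_def order_def)
  have mono: "num_cycles l H \<le> num_cycles l G"
    unfolding H_def by (rule num_cycles_mono[OF G induced_subgraph[OF G W(1)]])
  obtain xs where xs: "cyc H xs" "length xs = l" using num_cycles_obtain[OF W(3)[folded H_def]] by blast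
  interpret gcyc "\<lambda>i. xs ! nat (i mod int (length xs))" "int (length xs)" H
    by (rule list_gcyc(1)[OF H(1) xs(1)])
  have few': "int (num_cycles l G) \<le> (int n - int l) + 1" using few by linarith
  show False
  proof (rule mid_cycles[of "int (num_cycles l G)" "int (card W) - int l" dep "int n - int l"])
    show "18 * (int n - int l) + 5 \<le> 20 * (int (card W) - int l)"
    proof -
      have "20 * int n + 7 \<le> 20 * int (card W) + 2 * int (num_cycles l G)" using W(2) by (simp add: algebra_simps)
      then have "18 * int n + 2 * int l + 5 \<le> 20 * int (card W)" using few' by linarith
      then show ?thesis by (simp add: algebra_simps)
    qed
  qed (use W mono few' l n xs(2) H in \<open>simp_all add: H_def\<close>)
qed

theorem theorem1p2:
  fixes G :: "'a ugraph" and n :: nat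
  assumes "finite_simple_graph G"
    and "hamiltonian G"
    and "order G = n"
    and "n \<ge> 440"
    and "num_edges G > n ^ 2 div 4 + 1"
  shows "\<forall>l::nat. 3 \<le> l \<and> l \<le> n \<longrightarrow> num_cycles l G \<ge> n - l + 2"
proof (intro allI impI)
  fix l :: nat
  assume l: "3 \<le> l \<and> l \<le> n"
  note G = assms(1)
  have sur: "n * n div 4 + 2 \<le> num_edges G" using assms(5) by (simp add: power2_eq_square)
  \<comment> \<open>A square is 0 or 1 modulo 4, so rounding costs at most 1 of the
    \<open>4 * 2\<close>.\<close>
  have e: "n * n + 7 \<le> 4 * num_edges G"
  proof -
    have "n * n mod 4 \<le> 1"
    proof (cases "even n")
      case True
      then obtain m where "n = 2 * m" by (rule evenE)
      then show ?thesis by simp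
    next
      case False
      then obtain m where "n = 2 * m + 1" by (rule oddE)
      then have "n * n = 4 * (m * m + m) + 1" by (simp add: algebra_simps)
      then show ?thesis by presburger
    qed
    moreover have "4 * (n * n div 4) + n * n mod 4 = n * n" by simp
    ultimately show ?thesis using sur by linarith
  qed
  then have "int (n * n + 7) \<le> int (4 * num_edges G)" by (simp only: of_nat_le_iff)
  then have e': "int n * int n + 7 \<le> 4 * int (num_edges G)" by simp
  \<comment> \<open>In the last range \<open>h = n - l\<close> satisfies
    \<open>3 h + 3 <= n\<close>, as the rigidity argument requires.\<close>
  consider "l = 3" | "4 \<le> l" "l \<le> 32" | "33 \<le> l" "3 * l \<le> 2 * n + 2" | "2 * n + 3 \<le> 3 * l"
    using l by linarith
  then show "n - l + 2 \<le> num_cycles l G"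
  proof cases
    case 1
    have "2 * (n div 2) + 0 \<le> card (triangles G)"
      using assms sur by (intro many_triangles) (simp add: surplus_def)
    moreover have "n \<le> 2 * (n div 2) + 1" by presburger
    ultimately have "n \<le> num_cycles 3 G + 1" using num_cycles_triangles[OF G] by linarith
    then show ?thesis using 1 assms(4) by simp
  next
    case 2
    have "n \<le> num_cycles l G" by (rule short_cycles[OF G assms(3,4) _ 2]) (use e in simp)
    moreover have "n - l + 2 \<le> n" using 2 assms(4) by simp
    ultimately show ?thesis by (rule order_trans[rotated])
  next
    case 3
    then show ?thesis by (rule mid_length_cycles[OF G assms(2,3,4) e'])
  next
    case 4
    obtain xs where xs: "cyc G xs" "set xs = verts G" using hamiltonian_obtain[OF assms(2)] by blast
    have len: "length xs = n"
      using distinct_card[of xs] xs assms(3) by (simp add: cyc_def order_def)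
    define x where "x = (\<lambda>i. xs ! nat (i mod int (length xs)))"
    have gx: "gcyc x (int n) G" "range x = set xs"
      unfolding x_def using list_gcyc(1,2)[OF G xs(1)] by (simp_all add: len)
    interpret ham x "int n" G
      by (intro ham.intro gx(1) ham_axioms.intro) (use gx(2) xs(2) in simp)
    have Q: "7 \<le> Q" using e' unfolding Q_edges by simp
    define h where "h = int n - int l"
    have hl: "nat (int n - h) = l" by (simp add: h_def)
    have h: "0 \<le> h" "3 * h + 3 \<le> int n" using 4 l by (simp_all add: h_def)
    consider "h = 0" | "1 \<le> h" "h \<le> 2" | "3 \<le> h" using h by linarith
    then show ?thesis
    proof cases
      case 1
      then have "l = n" by (simp add: h_def)
      then show ?thesis using two_ham_cycles[OF Q] assms(4) by simp
    next
      case 2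
      \<comment> \<open>Hence there are at least 4 cycles, which is enough for \<open>h + 2\<close>
        as long as \<open>h <= 2\<close>.\<close>
      have "7 \<le> 2 * int (num_cycles l G)" using Q_le_cycles[of h] Q 2 assms(4) by (simp add: hl)
      then show ?thesis using 2(2) unfolding h_def by linarith
    next
      case 3
      show ?thesis
      proof (rule ccontr)
        assume "\<not> ?thesis"
        then have "num_cycles l G + l \<le> n + 1" using l by auto
        then have "int (num_cycles l G) \<le> h + 1" unfolding h_def by linarith
        then interpret arcs x "int n" G h
          by unfold_locales (use 3 h Q in \<open>simp_all add: hl\<close>)
        show False by (rule few_cycles_contradiction)
      qed
    qed
  qed
qed

end
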